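(* There exists an infinite $\{3,7\}$-surface immersed in $\mathbb{R}^3$ that is a cover of Klein's quartic. Explicitly: there exist a connected triangulated surface $S$ without boundary, with infinitely many triangles and exactly seven triangles incident to each vertex, an immersion $f\colon S\to\mathbb{R}^3$ mapping each triangle of $S$ onto a flat Euclidean equilateral triangle (all of these triangles having the same side length), and a covering map $\pi\colon S\to K$ onto Klein's quartic $K$ that maps the vertices, edges and triangles of $S$ to the vertices, edges and triangles, respectively, of the $\{3,7\}$-tiling of $K$.
   Context: A Schläfli symbol $\{p,q\}$ describes a surface tiled by $p$-sided regular polygons with $q$ faces incident to each vertex. A $\{3,7\}$-surface in $\mathbb{R}^3$ is a polyhedral surface in $\mathbb{R}^3$ whose faces are Euclidean equilateral triangles, joined edge to edge, with exactly seven triangles incident to each vertex. It is infinite if it has infinitely many triangles. "Immersed" means that the surface is given by a continuous map $f\colon S\to\mathbb{R}^3$ from an abstract triangulated surface $S$ that is affine and injective on each triangle and locally injective (every point of $S$, including vertices and points on edges, has a neighborhood on which $f$ is injective). Global injectivity is not required, so self-intersections are allowed. Klein's quartic $K$ is the compact Riemann surface of genus $3$ given by $x^3y+y^3z+z^3x=0$ in $\mathbb{P}^2(\mathbb{C})$. With its hyperbolic metric it carries the $\{3,7\}$-tiling by $56$ equilateral hyperbolic triangles with angles $\left(\frac{2\pi}{7},\frac{2\pi}{7},\frac{2\pi}{7}\right)$, seven at each vertex ($24$ vertices, $84$ edges, $56$ faces), invariant under the full automorphism group of $K$, which acts transitively on flags. Combinatorially it is the regular map $\{3,7\}_8$, i.e.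 the $\{3,7\}$-tiling in which every Petrie polygon (the eight-step geodesic, connecting midpoints of successive edges and turning alternately left and right) closes after eight steps. That the infinite surface is a cover of Klein's quartic means that it is a topological covering of $K$ compatible with the tilings: the covering map takes vertices, edges and triangles of the surface to vertices, edges and triangles of the $\{3,7\}$-tiling of $K$. It is not required that the surface be periodic under translations of $\mathbb{R}^3$, nor that the deck transformations of the covering be realized by isometries of $\mathbb{R}^3$. *)

theory Defs
  imports "HOL-Complex_Analysis.Complex_Analysis"
begin

section \<open>Klein's quartic in the complex projective plane\<close>

definition proj_rel :: "complex^3 \<Rightarrow> complex^3 \<Rightarrow> bool" where
  "proj_rel v w \<longleftrightarrow> v \<noteq> 0 \<and> w \<noteq> 0 \<and> (\<exists>c. w = c *s v)"

lemma part_equivp_proj_rel: "part_equivp proj_rel"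
proof (rule part_equivpI)
  show "\<exists>v. proj_rel v v"
    by (rule exI[of _ "1 :: complex^3"]) (auto simp: proj_rel_def intro: exI[of _ 1])
  show "symp proj_rel"
  proof (rule sympI)
    fix v w assume "proj_rel v w"
    then obtain c where "v \<noteq> 0" "w \<noteq> 0" "w = c *s v" by (auto simp: proj_rel_def)
    moreover from this have "c \<noteq> 0" by auto
    ultimately have "v = inverse c *s w" by (simp add: vec_eq_iff)
    with \<open>v \<noteq> 0\<close> \<open>w \<noteq> 0\<close> show "proj_rel w v" unfolding proj_rel_def by blast
  qed
  show "transp proj_rel"
    by (rule transpI) (auto simp: proj_rel_def vector_smult_assoc)
qed

quotient_type cp2 = "complex^3" / partial: proj_rel
  morphisms rep_cp2 proj_pt
  by (rule part_equivp_proj_rel)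

instantiation cp2 :: topological_space
begin

text \<open>The quotient topology.\<close>

definition open_cp2 :: "cp2 set \<Rightarrow> bool" where
  "open_cp2 U \<longleftrightarrow> open {v. v \<noteq> 0 \<and> proj_pt v \<in> U}"

instance
proof
  have "{v :: complex^3. v \<noteq> 0 \<and> proj_pt v \<in> UNIV} = - {0}" by auto
  then show "open (UNIV :: cp2 set)" by (simp only: open_cp2_def) auto
next
  fix S T :: "cp2 set" assume "open S" "open T"
  moreover have "{v. v \<noteq> 0 \<and> proj_pt v \<in> S \<inter> T}
      = {v. v \<noteq> 0 \<and> proj_pt v \<in> S} \<inter> {v. v \<noteq> 0 \<and> proj_pt v \<in> T}" by auto
  ultimately show "open (S \<inter> T)" by (simp only: open_cp2_def) (rule open_Int)
next
  fix K :: "cp2 set set" assume *: "\<forall>S\<in>K. open S"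
  have "{v. v \<noteq> 0 \<and> proj_pt v \<in> \<Union>K} = (\<Union>S\<in>K. {v. v \<noteq> 0 \<and> proj_pt v \<in> S})" by auto
  with * show "open (\<Union>K)" by (simp only: open_cp2_def) (rule open_UN)
qed

end

definition klein_quartic :: "cp2 set" where
  "klein_quartic = {proj_pt v | v. v \<noteq> 0 \<and>
     (v$1)^3 * v$2 + (v$2)^3 * v$3 + (v$3)^3 * v$1 = 0}"


section \<open>The hyperbolic plane (Poincare disc, curvature -1)\<close>

abbreviation hdisc :: "complex set" where
  "hdisc \<equiv> ball 0 1"

definition hdist :: "complex \<Rightarrow> complex \<Rightarrow> real" where
  "hdist z w = arcosh (1 + 2 * (cmod (z - w))\<^sup>2 / ((1 - (cmod z)\<^sup>2) * (1 - (cmod w)\<^sup>2)))"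

definition hsegment :: "complex \<Rightarrow> complex \<Rightarrow> complex set" where
  "hsegment z w = {x \<in> hdisc. hdist z x + hdist x w = hdist z w}"

definition hconvex :: "complex set \<Rightarrow> bool" where
  "hconvex C \<longleftrightarrow> C \<subseteq> hdisc \<and> (\<forall>x\<in>C. \<forall>y\<in>C. hsegment x y \<subseteq> C)"

text \<open>
  So \<open>hconvex hull s\<close> is the empty set, a point, a geodesic segment or a filled geodesic triangle,
  according to whether \<open>s\<close> has 0, 1, 2 or 3 (non-collinear) elements.
\<close>

text \<open>
  The angle at \<open>a\<close>: \<open>Moebius_function 0 a\<close> is a hyperbolic isometry taking \<open>a\<close> to the origin, where
  geodesics are diameters and hyperbolic angles are Euclidean ones.
\<close>

definition hangle :: "complex \<Rightarrow> complex \<Rightarrow> complex \<Rightarrow> real" where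
  "hangle b a c = \<bar>Arg (Moebius_function 0 a b / Moebius_function 0 a c)\<bar>"

definition equilateral_htriangle :: "real \<Rightarrow> complex set \<Rightarrow> bool" where
  "equilateral_htriangle \<alpha> t \<longleftrightarrow> t \<subseteq> hdisc \<and> card t = 3 \<and>
     (\<forall>a\<in>t. \<forall>b\<in>t. \<forall>c\<in>t. distinct [a, b, c] \<longrightarrow>
        hdist a b = hdist a c \<and> hangle b a c = \<alpha>)"


section \<open>The hyperbolic structure of the quartic and its automorphisms\<close>

definition holomorphic_cp2 :: "(complex \<Rightarrow> cp2) \<Rightarrow> bool" where
  "holomorphic_cp2 g \<longleftrightarrow> (\<forall>z\<in>hdisc. \<exists>e>0. \<exists>F :: complex \<Rightarrow> complex^3. ball z e \<subseteq> hdisc \<and>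
     (\<forall>k. (\<lambda>w. F w $ k) holomorphic_on ball z e) \<and>
     (\<forall>w\<in>ball z e. F w \<noteq> 0 \<and> g w = proj_pt (F w)))"

text \<open>
  The hyperbolic metric of \<open>K\<close> is the one for which a holomorphic universal covering by the
  Poincare disc is a local isometry; it does not depend on the choice of the covering.
\<close>

definition klein_uniformization :: "(complex \<Rightarrow> cp2) \<Rightarrow> bool" where
  "klein_uniformization u \<longleftrightarrow> covering_space hdisc u klein_quartic \<and> holomorphic_cp2 u"

text \<open>
  The full automorphism group: conformal and anticonformal bijections of \<open>K\<close>.  As \<open>u\<close> is locally
  biholomorphic onto \<open>K\<close>, \<open>\<phi>\<close> is holomorphic iff \<open>\<phi> \<circ> u\<close> is, and antiholomorphic iff
  \<open>\<phi> \<circ> u \<circ> cnj\<close> is holomorphic.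
\<close>

definition klein_automorphisms :: "(complex \<Rightarrow> cp2) \<Rightarrow> (cp2 \<Rightarrow> cp2) set" where
  "klein_automorphisms u = {\<phi>. bij_betw \<phi> klein_quartic klein_quartic \<and>
     (holomorphic_cp2 (\<phi> \<circ> u) \<or> holomorphic_cp2 (\<phi> \<circ> u \<circ> cnj))}"


section \<open>The tiling of the quartic\<close>

text \<open>
  A tiling of \<open>K\<close> by geodesic triangles is given by a set \<open>A\<close> of (vertex sets of) hyperbolic
  triangles in the disc, which \<open>u\<close> maps onto the tiles; several members of \<open>A\<close> may lie over the
  same tile.  The cells with \<open>n\<close> corners are the vertices (as singletons) for \<open>n = 1\<close>, the edges
  for \<open>n = 2\<close> and the triangles for \<open>n = 3\<close>.
\<close>

definition tiling_cells :: "(complex \<Rightarrow> cp2) \<Rightarrow> complex set set \<Rightarrow> nat \<Rightarrow> cp2 set set" where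
  "tiling_cells u A n = {u ` (hconvex hull s) | s t. t \<in> A \<and> s \<subseteq> t \<and> card s = n}"

text \<open>
  The third conjunct says that any two tiles meet edge to edge: in nothing (\<open>s' = t' = {}\<close>), in a
  common vertex, in a common edge, or they are the same tile.
\<close>

definition hyperbolic_37_tiling :: "(complex \<Rightarrow> cp2) \<Rightarrow> complex set set \<Rightarrow> bool" where
  "hyperbolic_37_tiling u A \<longleftrightarrow>
     (\<forall>t\<in>A. equilateral_htriangle (2 * pi / 7) t \<and> inj_on u (hconvex hull t)) \<and>
     \<Union> (tiling_cells u A 3) = klein_quartic \<and>
     (\<forall>s\<in>A. \<forall>t\<in>A. \<exists>s'\<subseteq>s. \<exists>t'\<subseteq>t. u ` s' = u ` t' \<and>
        u ` (hconvex hull s) \<inter> u ` (hconvex hull t) = u ` (hconvex hull s') \<and>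
        u ` (hconvex hull s) \<inter> u ` (hconvex hull t) = u ` (hconvex hull t')) \<and>
     (\<forall>t\<in>A. \<forall>a\<in>t. card {F \<in> tiling_cells u A 3. u a \<in> F} = 7) \<and>
     card (tiling_cells u A 1) = 24 \<and>
     card (tiling_cells u A 2) = 84 \<and>
     card (tiling_cells u A 3) = 56"

definition automorphism_invariant :: "(complex \<Rightarrow> cp2) \<Rightarrow> complex set set \<Rightarrow> bool" where
  "automorphism_invariant u A \<longleftrightarrow>
     (\<forall>\<phi>\<in>klein_automorphisms u. \<forall>F\<in>tiling_cells u A 3. \<phi> ` F \<in> tiling_cells u A 3)"

definition flag_transitive :: "(complex \<Rightarrow> cp2) \<Rightarrow> complex set set \<Rightarrow> bool" where
  "flag_transitive u A \<longleftrightarrow>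
     (\<forall>a b c a' b' c'. {a, b, c} \<in> A \<and> {a', b', c'} \<in> A \<longrightarrow>
        (\<exists>\<phi>\<in>klein_automorphisms u. \<phi> (u a) = u a' \<and>
           \<phi> ` u ` (hconvex hull {a, b}) = u ` (hconvex hull {a', b'}) \<and>
           \<phi> ` u ` (hconvex hull {a, b, c}) = u ` (hconvex hull {a', b', c'})))"

text \<open>
  The Petrie polygon through the midpoints of the edges \<open>p 0 p 1\<close>, \<open>p 1 p 2\<close>, \<open>p 2 p 3\<close>, \dots\ is
  recorded by the zigzag \<open>p\<close> of vertices: three consecutive ones span a triangle, and the next
  triangle is always a different one.  Turning around \<open>p 1\<close>, \<open>p 2\<close>, \<open>p 3\<close>, \dots\ is alternately a
  left and a right turn.
\<close>

definition petrie_zigzag :: "(complex \<Rightarrow> cp2) \<Rightarrow> complex set set \<Rightarrow> (nat \<Rightarrow> cp2) \<Rightarrow> bool" where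
  "petrie_zigzag u A p \<longleftrightarrow>
     (\<forall>i. {p i, p (i+1), p (i+2)} \<in> (`) u ` A \<and> p (i+3) \<noteq> p i)"

text \<open>The \<open>{3,7}\<close>-tiling of \<open>K\<close>; combinatorially it is the regular map \<open>{3,7}\<^sub>8\<close>.\<close>

definition klein_tiling :: "(complex \<Rightarrow> cp2) \<Rightarrow> complex set set \<Rightarrow> bool" where
  "klein_tiling u A \<longleftrightarrow> klein_uniformization u \<and> hyperbolic_37_tiling u A \<and>
     automorphism_invariant u A \<and> flag_transitive u A \<and>
     (\<forall>p. petrie_zigzag u A p \<longrightarrow> (\<forall>i. p (i+8) = p i))"


section \<open>Triangulated surfaces and their immersions\<close>

text \<open>
  An abstract simplicial complex is given by its set \<open>T\<close> of triangles, and points of its geometric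
  realization by their barycentric coordinates.  As the complexes below are locally finite, the
  topology of coordinatewise convergence is the usual (weak) topology of the realization.
\<close>

definition simplex_of :: "nat set \<Rightarrow> (nat \<Rightarrow> real) set" where
  "simplex_of s = {x. (\<forall>v. 0 \<le> x v) \<and> (\<forall>v. v \<notin> s \<longrightarrow> x v = 0) \<and> (\<Sum>v\<in>s. x v) = 1}"

definition vertex_pt :: "nat \<Rightarrow> (nat \<Rightarrow> real)" where
  "vertex_pt v = (\<lambda>w. if w = v then 1 else 0)"

definition realization :: "nat set set \<Rightarrow> (nat \<Rightarrow> real) set" where
  "realization T = (\<Union>t\<in>T. simplex_of t)"

definition triangulated_surface :: "nat set set \<Rightarrow> bool" where
  "triangulated_surface T \<longleftrightarrow>
     (\<forall>t\<in>T. card t = 3) \<and>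
     (\<forall>v. finite {t \<in> T. v \<in> t}) \<and>
     (\<forall>x\<in>realization T. \<exists>U. x \<in> U \<and> openin (top_of_set (realization T)) U \<and>
        U homeomorphic (UNIV :: (real^2) set))"

definition triangle_degree_seven :: "nat set set \<Rightarrow> bool" where
  "triangle_degree_seven T \<longleftrightarrow> (\<forall>v\<in>\<Union>T. card {t \<in> T. v \<in> t} = 7)"

definition immersion3 :: "nat set set \<Rightarrow> ((nat \<Rightarrow> real) \<Rightarrow> real^3) \<Rightarrow> bool" where
  "immersion3 T f \<longleftrightarrow>
     continuous_on (realization T) f \<and>
     (\<forall>t\<in>T. \<forall>x\<in>simplex_of t. f x = (\<Sum>v\<in>t. x v *\<^sub>R f (vertex_pt v))) \<and>
     (\<forall>t\<in>T. inj_on f (simplex_of t)) \<and>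
     (\<forall>x\<in>realization T. \<exists>U. x \<in> U \<and> openin (top_of_set (realization T)) U \<and> inj_on f U)"

definition equilateral_faces :: "nat set set \<Rightarrow> ((nat \<Rightarrow> real) \<Rightarrow> real^3) \<Rightarrow> bool" where
  "equilateral_faces T f \<longleftrightarrow> (\<exists>l>0. \<forall>t\<in>T. \<exists>P. card P = 3 \<and>
     (\<forall>p\<in>P. \<forall>q\<in>P. p \<noteq> q \<longrightarrow> dist p q = l) \<and> f ` simplex_of t = convex hull P)"

definition maps_cells_to_cells ::
    "nat set set \<Rightarrow> ((nat \<Rightarrow> real) \<Rightarrow> cp2) \<Rightarrow> (complex \<Rightarrow> cp2) \<Rightarrow> complex set set \<Rightarrow> bool" where
  "maps_cells_to_cells T \<pi> u A \<longleftrightarrow>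
     (\<forall>t\<in>T. \<forall>s. s \<subseteq> t \<and> s \<noteq> {} \<longrightarrow> \<pi> ` simplex_of s \<in> tiling_cells u A (card s))"

end

theory Submission
  imports Defs
begin

text \<open>
  The surface is built over the Klein map \<open>{3,7}\<^sub>8\<close>, written down as an explicit complex
  \<open>klein_complex\<close> on the vertices \<open>0, \<dots>, 23\<close>.  To each directed edge \<open>i j\<close> of this complex one attaches a
  vector \<open>e i j\<close> among the twelve shortest vectors of the face-centred cubic lattice, in such a way that
  the three vectors around every triangle add up to zero and the seven vectors at every vertex are
  distinct.  Integrating the cocycle \<open>e\<close> gives a covering of the complex: its vertices are pairs \<open>(i, x)\<close> of a
  vertex and a lattice point, and \<open>(i, x)\<close> is joined to \<open>(j, x + e i j)\<close>.  The covering space develops into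
  space by \<open>(i, x) \<mapsto> x\<close>.

  Three shortest vectors with sum zero have angles of 120 degrees, so every triangle becomes equilateral
  with side \<open>sqrt 2\<close>.  Around a vertex, the images of the seven triangles span the cones over seven distinct
  edges of a cuboctahedron, and such cones meet only in common faces; this is the local injectivity
  (\<open>develop_inj_on_star\<close>).  The sum of \<open>e\<close> along some closed edge path is not zero, so the connected
  component of \<open>(0, 0)\<close> has infinitely many vertices (\<open>infinite_cover\<close>).

  It remains to see that the given tiling is the Klein map.  First, two tiles meet at each edge and the
  seven tiles at a vertex form a single cycle: the number of tiles at an edge is constant by transitivity,
  hence equal to \<open>168 / 84 = 2\<close>, and turning around a vertex permutes the 14 flags there in orbits of a common
  size, which turns out to be 7 (\<open>edge_degree_2\<close>, \<open>turn_pow_7_and_orbit\<close>).  Starting from one triangle, the closing of the links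
  and of the Petrie polygons of length eight then determines all vertices and triangles
  (\<open>klein_map_labelling\<close>).  Because the quartic is connected and the tiling has 24 vertices, the labelling is
  a bijection (\<open>vertex_labelling\<close>).

  Secondly, the quartic is homeomorphic to the realization of \<open>klein_complex\<close>, cells going to cells
  (\<open>quartic_homeomorphic_complex\<close>).  In the Klein model of the hyperbolic plane geodesics are straight, so
  barycentric coordinates parametrize every tile.  The parametrizations induced on an edge by its two
  tiles need not agree, and are corrected by a change of the parameter on each edge that is extended over the
  triangle (\<open>reparametrize_boundary\<close>).  A combinatorial covering of complexes is a covering of their
  realizations (\<open>covering_push_forward\<close>), and composing it with the homeomorphism gives the covering of the
  quartic.  The surface is locally a plane because the quartic is covered by the hyperbolic plane.
\<close>

section \<open>The Klein model of the hyperbolic plane\<close>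

text \<open>
  The form on \<open>\<real>\<^bsup>1,2\<^esup>\<close> for which the hyperbolic plane is one sheet of \<open>minkowski x x = 1\<close>.
\<close>

definition minkowski :: "real \<times> complex \<Rightarrow> real \<times> complex \<Rightarrow> real" where
  "minkowski x y = fst x * fst y - snd x \<bullet> snd y"

text \<open>
  The points of the disc as unit vectors of \<open>minkowski\<close>.  The Klein model \<open>klein_disc\<close> is the central
  projection of this sheet, and \<open>poincare_disc\<close> turns it back into the Poincare model.
\<close>

definition hyperboloid :: "complex \<Rightarrow> real \<times> complex" where
  "hyperboloid z = ((1 + (cmod z)\<^sup>2) / (1 - (cmod z)\<^sup>2), (2 / (1 - (cmod z)\<^sup>2)) *\<^sub>R z)"

definition klein_disc :: "complex \<Rightarrow> complex" where
  "klein_disc z = (2 / (1 + (cmod z)\<^sup>2)) *\<^sub>R z"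

definition poincare_disc :: "complex \<Rightarrow> complex" where
  "poincare_disc w = (1 / (1 + sqrt (1 - (cmod w)\<^sup>2))) *\<^sub>R w"

lemma minkowski_simps:
  "minkowski (x + y) z = minkowski x z + minkowski y z"
  "minkowski z (x + y) = minkowski z x + minkowski z y"
  "minkowski (r *\<^sub>R x) z = r * minkowski x z"
  "minkowski z (r *\<^sub>R x) = r * minkowski z x"
  by (simp_all add: minkowski_def inner_simps algebra_simps)

lemma minkowski_commute: "minkowski x y = minkowski y x"
  by (simp add: minkowski_def inner_commute algebra_simps)

lemma norm_lt_1_sq: "z \<in> hdisc \<Longrightarrow> (cmod z)\<^sup>2 < 1"
  by (simp add: power_less_one_iff abs_square_less_1)

lemma minkowski_hyperboloid_self: "z \<in> hdisc \<Longrightarrow> minkowski (hyperboloid z) (hyperboloid z) = 1"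
proof -
  assume "z \<in> hdisc"
  then have n: "1 - (cmod z)\<^sup>2 \<noteq> 0" using norm_lt_1_sq[of z] by simp
  have "((1 + r) / (1 - r))\<^sup>2 - (2 / (1 - r))\<^sup>2 * r = 1" if "1 - r \<noteq> 0" for r :: real
    using that by (simp add: power_divide divide_simps) (simp add: power2_eq_square algebra_simps)
  from this[OF n] show ?thesis
    by (simp add: minkowski_def hyperboloid_def power2_eq_square flip: power2_norm_eq_inner)
qed

lemma fst_hyperboloid_pos: "z \<in> hdisc \<Longrightarrow> fst (hyperboloid z) > 0"
  using norm_lt_1_sq[of z] by (simp add: hyperboloid_def add_pos_nonneg)

lemma klein_disc_hyperboloid: "z \<in> hdisc \<Longrightarrow> hyperboloid z = fst (hyperboloid z) *\<^sub>R (1, klein_disc z)"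
proof -
  assume "z \<in> hdisc"
  then have "1 - (cmod z)\<^sup>2 \<noteq> 0" "1 + (cmod z)\<^sup>2 \<noteq> 0"
    using norm_lt_1_sq[of z] by (auto simp: add_nonneg_eq_0_iff)
  moreover from this have "2 / (1 - (cmod z)\<^sup>2) = (1 + (cmod z)\<^sup>2) / (1 - (cmod z)\<^sup>2) * (2 / (1 + (cmod z)\<^sup>2))" by (simp add: frac_eq_eq divide_simps)
  ultimately show ?thesis by (metis hyperboloid_def klein_disc_def fst_conv scaleR_Pair scaleR_scaleR mult.right_neutral real_scaleR_def)
qed

lemma cosh_hdist:
  assumes "z \<in> hdisc" "w \<in> hdisc"
  shows "cosh (hdist z w) = minkowski (hyperboloid z) (hyperboloid w)" "hdist z w \<ge> 0"
proof -
  let ?p = "(cmod z)\<^sup>2" and ?q = "(cmod w)\<^sup>2"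
  have pq: "?p < 1" "?q < 1" using norm_lt_1_sq assms by auto
  have ge: "1 + 2 * (cmod (z - w))\<^sup>2 / ((1 - ?p) * (1 - ?q)) \<ge> 1" using pq by simp
  then have "cosh (hdist z w) = 1 + 2 * (cmod (z - w))\<^sup>2 / ((1 - ?p) * (1 - ?q))"
    unfolding hdist_def by (rule cosh_arcosh_real)
  also have "(cmod (z - w))\<^sup>2 = ?p + ?q - 2 * (z \<bullet> w)"
    by (simp add: power2_norm_eq_inner inner_simps inner_commute)
  also have "1 + 2 * (?p + ?q - 2 * (z \<bullet> w)) / ((1 - ?p) * (1 - ?q)) = minkowski (hyperboloid z) (hyperboloid w)"
  proof -
    have "1 + 2 * (p + q - 2 * r) / ((1 - p) * (1 - q)) = (1 + p) / (1 - p) * ((1 + q) / (1 - q)) - (2 / (1 - p)) * (2 / (1 - q)) * r"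
      if "1 - p \<noteq> 0" "1 - q \<noteq> 0" for p q r :: real
      using that by (simp add: divide_simps) (simp add: algebra_simps)
    then show ?thesis using pq by (simp add: minkowski_def hyperboloid_def)
  qed
  finally show "cosh (hdist z w) = minkowski (hyperboloid z) (hyperboloid w)" .
  show "hdist z w \<ge> 0" unfolding hdist_def using ge by (rule arcosh_nonneg_real)
qed

text \<open>
  The reverse Cauchy-Schwarz inequality \<open>minkowski x y \<ge> 1\<close> on the sheet is strict for distinct points.
\<close>

lemma hyperboloid_points_eq:
  assumes "minkowski x x = 1" "minkowski y y = 1" "minkowski x y = 1" "fst x > 0" "fst y > 0"
  shows "x = y"
proof -
  obtain s v t w where xy: "x = (s, v)" "y = (t, w)" by (cases x, cases y)
  have 1: "s\<^sup>2 - 1 = v \<bullet> v" "t\<^sup>2 - 1 = w \<bullet> w" "s * t - 1 = v \<bullet> w"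
    using assms xy by (auto simp: minkowski_def power2_eq_square)
  have "(s * t - 1)\<^sup>2 \<le> (s\<^sup>2 - 1) * (t\<^sup>2 - 1)" unfolding 1 by (rule Cauchy_Schwarz_ineq)
  then have "(s - t)\<^sup>2 \<le> 0" by (simp add: power2_eq_square algebra_simps)
  then have st: "s = t" by simp
  have "(v - w) \<bullet> (v - w) = 0" using 1 st by (simp add: inner_simps inner_commute power2_eq_square)
  then show ?thesis using st xy by simp
qed

lemma hyperboloid_inject:
  assumes "z \<in> hdisc" "w \<in> hdisc" "hyperboloid z = hyperboloid w" shows "z = w"
proof -
  have pq: "(cmod z)\<^sup>2 < 1" "(cmod w)\<^sup>2 < 1" using norm_lt_1_sq assms by auto
  have "(1 + (cmod z)\<^sup>2) / (1 - (cmod z)\<^sup>2) = (1 + (cmod w)\<^sup>2) / (1 - (cmod w)\<^sup>2)"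
    using assms(3) by (simp add: hyperboloid_def)
  then have "(cmod z)\<^sup>2 = (cmod w)\<^sup>2" using pq by (simp add: field_simps)
  then show ?thesis using assms(3) pq by (simp add: hyperboloid_def)
qed

lemma hdist_eq_0_iff:
  assumes "z \<in> hdisc" "w \<in> hdisc" shows "hdist z w = 0 \<longleftrightarrow> z = w"
  using cosh_hdist[OF assms] cosh_hdist[OF assms(1) assms(1)] hyperboloid_points_eq[of "hyperboloid z" "hyperboloid w"]
    hyperboloid_inject[OF assms] minkowski_hyperboloid_self assms fst_hyperboloid_pos
  by (auto simp: hdist_def)

text \<open>
  Both distances are computed from \<open>cosh\<close>: the coefficients \<open>\<beta>\<close> and \<open>\<alpha>\<close> are the quotients of the hyperbolic
  sines of the two partial distances by that of the whole one, and the addition theorem for \<open>cosh\<close> applies.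
\<close>

lemma hyperboloid_combination_hdist:
  assumes d: "z \<in> hdisc" "x \<in> hdisc" "w \<in> hdisc" and nn: "\<alpha> \<ge> 0" "\<beta> \<ge> 0"
    and x: "hyperboloid x = \<alpha> *\<^sub>R hyperboloid z + \<beta> *\<^sub>R hyperboloid w"
  shows "hdist z x + hdist x w = hdist z w"
proof -
  let ?a = "cosh (hdist z x)" and ?b = "cosh (hdist x w)" and ?c = "cosh (hdist z w)"
  note c = cosh_hdist
  have a: "?a = \<alpha> + \<beta> * ?c" and b: "?b = \<alpha> * ?c + \<beta>"
    using d by (simp_all add: c x minkowski_simps minkowski_hyperboloid_self)
  have n: "\<alpha>\<^sup>2 + \<beta>\<^sup>2 + 2 * \<alpha> * \<beta> * ?c = 1"
    using minkowski_hyperboloid_self[OF d(2)] d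
    by (simp add: c x minkowski_simps minkowski_hyperboloid_self minkowski_commute[of "hyperboloid w" "hyperboloid z"])
       (simp add: power2_eq_square algebra_simps)
  have s: "sinh (hdist u v) = sqrt ((cosh (hdist u v))\<^sup>2 - 1)" if "u \<in> hdisc" "v \<in> hdisc" for u v
    using c(2)[OF that] by (simp add: sinh_square_eq[symmetric])
  have c1: "?c\<^sup>2 - 1 \<ge> 0" by (simp add: sinh_square_eq[symmetric])
  have "?a\<^sup>2 - 1 = \<beta>\<^sup>2 * (?c\<^sup>2 - 1)" using n unfolding a by (simp add: power2_eq_square algebra_simps)
  then have sa: "sinh (hdist z x) = \<beta> * sqrt (?c\<^sup>2 - 1)" using s d nn by (simp add: real_sqrt_mult)
  have "?b\<^sup>2 - 1 = \<alpha>\<^sup>2 * (?c\<^sup>2 - 1)" using n unfolding b by (simp add: power2_eq_square algebra_simps)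
  then have sb: "sinh (hdist x w) = \<alpha> * sqrt (?c\<^sup>2 - 1)" using s d nn by (simp add: real_sqrt_mult)
  have "sinh (hdist z x) * sinh (hdist x w) = \<alpha> * \<beta> * (?c\<^sup>2 - 1)"
    unfolding sa sb using c1 by (simp add: algebra_simps)
  then have "cosh (hdist z x + hdist x w) = ?a * ?b + \<alpha> * \<beta> * (?c\<^sup>2 - 1)" by (simp add: cosh_add)
  also have "\<dots> = (\<alpha>\<^sup>2 + \<beta>\<^sup>2 + 2 * \<alpha> * \<beta> * ?c) * ?c"
    unfolding a b by (simp add: power2_eq_square algebra_simps)
  finally have "cosh (hdist z x + hdist x w) = ?c" using n by simp
  then show ?thesis using c(2) d by (metis add_nonneg_nonneg arcosh_cosh_real)
qed

text \<open>
  The coefficients are forced to be the quotients of hyperbolic sines.  The combination that they define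
  is a unit vector whose product with \<open>x\<close> is 1 by the addition theorem for \<open>sinh\<close>, hence it is \<open>x\<close>.
\<close>

lemma hdist_additive_imp_combination:
  assumes d: "z \<in> hdisc" "x \<in> hdisc" "w \<in> hdisc" and "z \<noteq> w"
    and add: "hdist z x + hdist x w = hdist z w"
  obtains \<alpha> \<beta> where "\<alpha> \<ge> 0" "\<beta> \<ge> 0" "hyperboloid x = \<alpha> *\<^sub>R hyperboloid z + \<beta> *\<^sub>R hyperboloid w"
proof -
  let ?d1 = "hdist z x" and ?d2 = "hdist x w" and ?d3 = "hdist z w"
  have nn: "?d1 \<ge> 0" "?d2 \<ge> 0" "?d3 > 0"
    using cosh_hdist d hdist_eq_0_iff[OF d(1,3)] \<open>z \<noteq> w\<close> by (auto simp: less_le)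
  define \<alpha> \<beta> where "\<alpha> = sinh ?d2 / sinh ?d3" and "\<beta> = sinh ?d1 / sinh ?d3"
  have s3: "sinh ?d3 > 0" using nn by simp
  have pos: "\<alpha> \<ge> 0" "\<beta> \<ge> 0" using nn s3 by (auto simp: \<alpha>_def \<beta>_def)
  let ?y = "\<alpha> *\<^sub>R hyperboloid z + \<beta> *\<^sub>R hyperboloid w"
  have s3e: "sinh ?d3 = sinh ?d1 * cosh ?d2 + cosh ?d1 * sinh ?d2"
    and c3e: "cosh ?d3 = cosh ?d1 * cosh ?d2 + sinh ?d1 * sinh ?d2"
    unfolding add[symmetric] by (simp_all add: sinh_add cosh_add)
  have "(sinh ?d2)\<^sup>2 + (sinh ?d1)\<^sup>2 + 2 * sinh ?d1 * sinh ?d2 * cosh ?d3 = (sinh ?d3)\<^sup>2"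
    unfolding s3e c3e using cosh_square_eq[of ?d1] cosh_square_eq[of ?d2]
    by algebra
  then have "\<alpha>\<^sup>2 + \<beta>\<^sup>2 + 2 * \<alpha> * \<beta> * cosh ?d3 = 1"
    unfolding \<alpha>_def \<beta>_def using s3 by (simp add: field_simps power2_eq_square)
  then have "minkowski ?y ?y = 1"
    using d by (simp add: minkowski_simps minkowski_hyperboloid_self minkowski_commute[of "hyperboloid w" "hyperboloid z"])
       (simp add: cosh_hdist power2_eq_square algebra_simps)
  moreover have "minkowski (hyperboloid x) ?y = 1"
  proof -
    have "minkowski (hyperboloid x) ?y = \<alpha> * cosh ?d1 + \<beta> * cosh ?d2"
      using d by (simp add: minkowski_simps cosh_hdist minkowski_commute)
    also have "\<dots> = (sinh ?d1 * cosh ?d2 + cosh ?d1 * sinh ?d2) / sinh ?d3"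
      unfolding \<alpha>_def \<beta>_def by (simp add: add_divide_distrib mult.commute)
    also have "\<dots> = sinh ?d3 / sinh ?d3" by (simp only: s3e)
    finally show ?thesis using s3 by simp
  qed
  moreover have "fst ?y > 0"
  proof -
    have "\<not> (\<alpha> = 0 \<and> \<beta> = 0)" using \<open>\<alpha>\<^sup>2 + \<beta>\<^sup>2 + _ = 1\<close> by auto
    then have "\<alpha> > 0 \<or> \<beta> > 0" using pos by auto
    then show ?thesis using pos fst_hyperboloid_pos[OF d(1)] fst_hyperboloid_pos[OF d(3)]
      by (auto intro: add_pos_nonneg add_nonneg_pos)
  qed
  ultimately have "hyperboloid x = ?y"
    using hyperboloid_points_eq minkowski_hyperboloid_self fst_hyperboloid_pos d by blast
  then show ?thesis using that pos by blast
qed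

lemma klein_disc_in: "z \<in> hdisc \<Longrightarrow> klein_disc z \<in> hdisc"
proof -
  assume z: "z \<in> hdisc"
  have "0 < (1 - cmod z)\<^sup>2" using z by simp
  then have "2 * cmod z < 1 + (cmod z)\<^sup>2" by (simp add: power2_eq_square algebra_simps)
  moreover have "1 + (cmod z)\<^sup>2 > 0" by (simp add: add_pos_nonneg)
  ultimately show ?thesis by (simp add: klein_disc_def)
qed

lemma poincare_klein_disc:
  assumes z: "z \<in> hdisc" shows "poincare_disc (klein_disc z) = z"
proof -
  let ?r = "cmod z"
  have p: "1 + ?r\<^sup>2 > 0" by (simp add: add_pos_nonneg)
  have "1 - (cmod (klein_disc z))\<^sup>2 = ((1 - ?r\<^sup>2) / (1 + ?r\<^sup>2))\<^sup>2"
    using p by (simp add: klein_disc_def power_divide power_mult_distrib field_simps) (simp add: power2_eq_square algebra_simps)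
  then have "sqrt (1 - (cmod (klein_disc z))\<^sup>2) = (1 - ?r\<^sup>2) / (1 + ?r\<^sup>2)"
    using norm_lt_1_sq[OF z] p by simp
  then have "1 + sqrt (1 - (cmod (klein_disc z))\<^sup>2) = 2 / (1 + ?r\<^sup>2)"
    using p by (simp add: field_simps)
  then have "poincare_disc (klein_disc z) = (1 / (2 / (1 + ?r\<^sup>2)) * (2 / (1 + ?r\<^sup>2))) *\<^sub>R z"
    unfolding poincare_disc_def by (simp only: klein_disc_def scaleR_scaleR)
  then show ?thesis using p by (metis divide_self_if mult.commute nonzero_divide_eq_eq scaleR_one times_divide_eq_right mult_1 zero_neq_numeral divide_eq_0_iff less_irrefl)
qed

lemma klein_poincare_disc:
  assumes w: "w \<in> hdisc" shows "klein_disc (poincare_disc w) = w" "poincare_disc w \<in> hdisc"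
proof -
  define s where "s = sqrt (1 - (cmod w)\<^sup>2)"
  have s: "s > 0" "(cmod w)\<^sup>2 = 1 - s\<^sup>2" using norm_lt_1_sq[OF w] by (auto simp: s_def)
  have n: "(cmod (poincare_disc w))\<^sup>2 = (1 - s) / (1 + s)"
  proof -
    have "(cmod (poincare_disc w))\<^sup>2 = (1 - s\<^sup>2) / (1 + s)\<^sup>2"
      using s by (simp add: poincare_disc_def s_def[symmetric] power_mult_distrib power_divide)
    moreover have "1 - s\<^sup>2 = (1 - s) * (1 + s)" by (simp add: power2_eq_square algebra_simps)
    ultimately show ?thesis using s by (simp add: power2_eq_square)
  qed
  have "(cmod (poincare_disc w))\<^sup>2 < 1" unfolding n using s by simp
  then show "poincare_disc w \<in> hdisc" by (simp add: power_less_one_iff abs_square_less_1)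
  have "1 + (cmod (poincare_disc w))\<^sup>2 = 2 / (1 + s)" unfolding n using s by (simp add: field_simps)
  then show "klein_disc (poincare_disc w) = w"
    unfolding klein_disc_def using s by (simp add: poincare_disc_def s_def[symmetric])
qed

lemma continuous_on_poincare_disc: "continuous_on hdisc poincare_disc"
proof -
  have "1 + sqrt (1 - (cmod w)\<^sup>2) \<noteq> 0" if "w \<in> hdisc" for w
    using norm_lt_1_sq[OF that] by (smt (verit) real_sqrt_gt_zero)
  then show ?thesis unfolding poincare_disc_def by (intro continuous_intros) auto
qed

text \<open>
  The nonnegative combinations of two vectors of the sheet project centrally onto the segment between
  the projections of the two vectors.
\<close>

lemma hsegment_iff_klein_disc:
  assumes d: "z \<in> hdisc" "x \<in> hdisc" "w \<in> hdisc"
  shows "x \<in> hsegment z w \<longleftrightarrow> klein_disc x \<in> closed_segment (klein_disc z) (klein_disc w)"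
proof
  let ?X = "\<lambda>z. fst (hyperboloid z)"
  note p = fst_hyperboloid_pos[OF d(1)] fst_hyperboloid_pos[OF d(2)] fst_hyperboloid_pos[OF d(3)]
  note kh = klein_disc_hyperboloid[OF d(1)] klein_disc_hyperboloid[OF d(2)] klein_disc_hyperboloid[OF d(3)]
  assume "klein_disc x \<in> closed_segment (klein_disc z) (klein_disc w)"
  then obtain t where t: "0 \<le> t" "t \<le> 1" "klein_disc x = (1 - t) *\<^sub>R klein_disc z + t *\<^sub>R klein_disc w"
    by (auto simp: closed_segment_def)
  have "hyperboloid x = (?X x * (1 - t) / ?X z) *\<^sub>R (?X z *\<^sub>R (1, klein_disc z)) + (?X x * t / ?X w) *\<^sub>R (?X w *\<^sub>R (1, klein_disc w))"
  proof -
    have "hyperboloid x = ?X x *\<^sub>R ((1 - t) *\<^sub>R (1, klein_disc z) + t *\<^sub>R (1, klein_disc w))"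
      using kh(2) t(3) by simp
    then show ?thesis using p by (simp only: scaleR_add_right scaleR_scaleR) simp
  qed
  then have "hyperboloid x = (?X x * (1 - t) / ?X z) *\<^sub>R hyperboloid z + (?X x * t / ?X w) *\<^sub>R hyperboloid w"
    by (simp only: kh(1,3)[symmetric])
  then show "x \<in> hsegment z w"
    using hyperboloid_combination_hdist[OF d, of "?X x * (1 - t) / ?X z" "?X x * t / ?X w"] t p d by (simp add: hsegment_def)
next
  let ?X = "\<lambda>z. fst (hyperboloid z)"
  note p = fst_hyperboloid_pos[OF d(1)] fst_hyperboloid_pos[OF d(2)] fst_hyperboloid_pos[OF d(3)]
  note kh = klein_disc_hyperboloid[OF d(1)] klein_disc_hyperboloid[OF d(2)] klein_disc_hyperboloid[OF d(3)]
  assume "x \<in> hsegment z w"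
  then have add: "hdist z x + hdist x w = hdist z w" by (simp add: hsegment_def)
  show "klein_disc x \<in> closed_segment (klein_disc z) (klein_disc w)"
  proof (cases "z = w")
    case True
    then have "hdist z x = 0" using add hdist_eq_0_iff[OF d(3) d(3)] cosh_hdist(2) d
      by (metis add_nonneg_eq_0_iff)
    then show ?thesis using hdist_eq_0_iff[OF d(1,2)] True by simp
  next
    case False
    obtain \<alpha> \<beta> where ab: "\<alpha> \<ge> 0" "\<beta> \<ge> 0" "hyperboloid x = \<alpha> *\<^sub>R hyperboloid z + \<beta> *\<^sub>R hyperboloid w"
      using hdist_additive_imp_combination[OF d False add] .
    then have f: "?X x = \<alpha> * ?X z + \<beta> * ?X w" by simp
    have "?X x *\<^sub>R klein_disc x = (\<alpha> * ?X z) *\<^sub>R klein_disc z + (\<beta> * ?X w) *\<^sub>R klein_disc w"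
      using arg_cong[OF ab(3), of snd] kh by (metis scaleR_scaleR snd_add snd_scaleR snd_conv)
    then have "klein_disc x = (1 / ?X x) *\<^sub>R ((\<alpha> * ?X z) *\<^sub>R klein_disc z + (\<beta> * ?X w) *\<^sub>R klein_disc w)"
      using p by (metis divide_inverse_commute less_irrefl mult.right_neutral real_vector_eq_affinity scaleR_one vector_fraction_eq_iff)
    also have "\<dots> = (1 - \<beta> * ?X w / ?X x) *\<^sub>R klein_disc z + (\<beta> * ?X w / ?X x) *\<^sub>R klein_disc w"
    proof -
      have "1 - \<beta> * ?X w / ?X x = \<alpha> * ?X z / ?X x" using f p by (simp add: field_simps)
      then show ?thesis by (simp add: scaleR_add_right)
    qed
    finally show ?thesis unfolding closed_segment_def
      using ab p f by (intro CollectI exI[of _ "\<beta> * ?X w / ?X x"]) (auto simp: field_simps)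
  qed
qed

lemma hconvex_iff_convex: "hconvex C \<longleftrightarrow> C \<subseteq> hdisc \<and> convex (klein_disc ` C)"
proof (cases "C \<subseteq> hdisc")
  case True
  have "hsegment x y \<subseteq> C \<longleftrightarrow> closed_segment (klein_disc x) (klein_disc y) \<subseteq> klein_disc ` C"
    if "x \<in> C" "y \<in> C" for x y
  proof -
    have xy: "x \<in> hdisc" "y \<in> hdisc" using that True by auto
    have cs: "closed_segment (klein_disc x) (klein_disc y) \<subseteq> hdisc"
      using klein_disc_in[OF xy(1)] klein_disc_in[OF xy(2)] by (intro closed_segment_subset) auto
    show ?thesis
    proof
      assume L: "hsegment x y \<subseteq> C"
      show "closed_segment (klein_disc x) (klein_disc y) \<subseteq> klein_disc ` C"
      proof
        fix w assume w: "w \<in> closed_segment (klein_disc x) (klein_disc y)"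
        then have "w \<in> hdisc" using cs by blast
        note kp = klein_poincare_disc[OF this]
        have "poincare_disc w \<in> hsegment x y"
          using hsegment_iff_klein_disc[OF xy(1) kp(2) xy(2)] w kp(1) by simp
        then show "w \<in> klein_disc ` C" using L kp(1) by (metis image_eqI subsetD)
      qed
    next
      assume R: "closed_segment (klein_disc x) (klein_disc y) \<subseteq> klein_disc ` C"
      show "hsegment x y \<subseteq> C"
      proof
        fix z assume z: "z \<in> hsegment x y"
        then have zd: "z \<in> hdisc" by (simp add: hsegment_def)
        then have "klein_disc z \<in> klein_disc ` C" using hsegment_iff_klein_disc[OF xy(1) zd xy(2)] z R by auto
        then show "z \<in> C" using poincare_klein_disc zd True by (metis imageE subsetD)
      qed
    qed
  qed
  then show ?thesis using True unfolding hconvex_def convex_contains_segment by auto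
qed (auto simp: hconvex_def)

lemma hconvex_hull_eq:
  assumes "s \<subseteq> hdisc"
  shows "hconvex hull s = poincare_disc ` (convex hull (klein_disc ` s))"
proof -
  let ?H = "poincare_disc ` (convex hull (klein_disc ` s))"
  have sub: "convex hull (klein_disc ` s) \<subseteq> hdisc"
    using assms klein_disc_in by (intro hull_minimal) auto
  have k: "klein_disc ` ?H = convex hull (klein_disc ` s)"
    using sub klein_poincare_disc by (force simp: image_image)
  show ?thesis
  proof (rule hull_unique)
    show "s \<subseteq> ?H"
    proof
      fix x assume "x \<in> s"
      then have "klein_disc x \<in> convex hull (klein_disc ` s)" by (simp add: hull_inc)
      moreover have "x = poincare_disc (klein_disc x)" using poincare_klein_disc \<open>x \<in> s\<close> assms by auto
      ultimately show "x \<in> ?H" by blast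
    qed
    show "hconvex ?H" unfolding hconvex_iff_convex k using sub klein_poincare_disc by auto
    show "?H \<subseteq> t" if t: "s \<subseteq> t" "hconvex t" for t
    proof -
      have "convex hull (klein_disc ` s) \<subseteq> klein_disc ` t"
        using t by (intro hull_minimal) (auto simp: hconvex_iff_convex)
      then have "?H \<subseteq> poincare_disc ` klein_disc ` t" by blast
      also have "\<dots> = t" using t(2) poincare_klein_disc unfolding hconvex_iff_convex by (force simp: image_image)
      finally show ?thesis .
    qed
  qed
qed

text \<open>
  If the corners were collinear in the Klein model, one of them would lie between the other two, and the
  side opposite to it would be as long as the other two sides together; all sides being equal, they would vanish.
\<close>

lemma equilateral_htriangle_affine_independent:
  assumes "equilateral_htriangle \<alpha> t"
  shows "t \<subseteq> hdisc" "finite t" "card t = 3" "inj_on klein_disc t" "\<not> affine_dependent (klein_disc ` t)"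
proof -
  show td: "t \<subseteq> hdisc" and c3: "card t = 3" using assms by (auto simp: equilateral_htriangle_def)
  then show "finite t" by (simp add: card_ge_0_finite)
  show inj: "inj_on klein_disc t" using poincare_klein_disc td by (metis inj_onI subsetD)
  obtain a b c where t: "t = {a, b, c}" and abc: "a \<noteq> b" "b \<noteq> c" "a \<noteq> c"
    using c3 by (auto simp: card_3_iff)
  have eq: "hdist x y = hdist x z" if "{x, y, z} = t" "distinct [x, y, z]" for x y z
    using assms that unfolding equilateral_htriangle_def by blast
  have sym: "hdist x y = hdist y x" for x y
    by (simp add: hdist_def norm_minus_commute mult.commute)
  have no: "\<not> klein_disc x \<in> closed_segment (klein_disc y) (klein_disc z)"
    if "{x, y, z} = t" "distinct [x, y, z]" for x y z
  proof
    assume "klein_disc x \<in> closed_segment (klein_disc y) (klein_disc z)"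
    moreover have d: "x \<in> hdisc" "y \<in> hdisc" "z \<in> hdisc" using that td by auto
    ultimately have "hdist y x + hdist x z = hdist y z"
      using hsegment_iff_klein_disc[of y x z] by (simp add: hsegment_def)
    moreover have "hdist x y = hdist x z" "hdist y x = hdist y z"
      using that eq[of x y z] eq[of y x z] by (auto simp: insert_commute)
    ultimately have "hdist x z = 0" by simp
    then show False using hdist_eq_0_iff[of x z] d that by auto
  qed
  show "\<not> affine_dependent (klein_disc ` t)"
  proof
    assume "affine_dependent (klein_disc ` t)"
    then have "collinear {klein_disc a, klein_disc b, klein_disc c}"
      unfolding t by (simp add: affine_dependent_imp_collinear_3)
    then have "between (klein_disc b, klein_disc c) (klein_disc a) \<or> between (klein_disc c, klein_disc a) (klein_disc b)
       \<or> between (klein_disc a, klein_disc b) (klein_disc c)" by (simp add: collinear_between_cases)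
    then show False using no[of a b c] no[of b c a] no[of c a b] abc
      unfolding between_mem_segment t by (auto simp: insert_commute)
  qed
qed

section \<open>Geometric realizations and their coverings\<close>

lemma simplex_of_support: "x \<in> simplex_of s \<Longrightarrow> x v \<noteq> 0 \<Longrightarrow> v \<in> s"
  unfolding simplex_of_def by blast

lemma simplex_of_nonneg: "x \<in> simplex_of s \<Longrightarrow> 0 \<le> x v"
  unfolding simplex_of_def by blast

lemma simplex_of_sum: "x \<in> simplex_of s \<Longrightarrow> (\<Sum>v\<in>s. x v) = 1"
  unfolding simplex_of_def by blast

text \<open>
  A point belongs to every simplex that contains its support.
\<close>

lemma simplex_of_face:
  assumes "x \<in> simplex_of t" "finite t" "finite s" "\<And>v. x v \<noteq> 0 \<Longrightarrow> v \<in> s"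
  shows "x \<in> simplex_of s"
proof -
  have "sum x s = sum x t"
    by (rule sum.mono_neutral_cong) (use assms simplex_of_support in blast)+
  then show ?thesis using assms by (auto simp: simplex_of_def)
qed

lemma simplex_of_mono: "finite t \<Longrightarrow> s \<subseteq> t \<Longrightarrow> simplex_of s \<subseteq> simplex_of t"
  by (meson finite_subset simplex_of_face simplex_of_support subset_iff)

lemma simplex_of_Int:
  "finite s \<Longrightarrow> finite t \<Longrightarrow> simplex_of s \<inter> simplex_of t = simplex_of (s \<inter> t)"
proof
  assume f: "finite s" "finite t"
  show "simplex_of s \<inter> simplex_of t \<subseteq> simplex_of (s \<inter> t)"
    using simplex_of_face[of _ s "s \<inter> t"] simplex_of_support f by blast
  show "simplex_of (s \<inter> t) \<subseteq> simplex_of s \<inter> simplex_of t" using f by (simp add: simplex_of_mono)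
qed

lemma simplex_of_pos:
  assumes "x \<in> simplex_of s" obtains v where "v \<in> s" "x v > 0"
proof -
  have "\<exists>v\<in>s. x v \<noteq> 0" using simplex_of_sum[OF assms] by (metis sum.neutral zero_neq_one)
  then show ?thesis using that simplex_of_nonneg[OF assms] by (metis less_le)
qed

lemma vertex_pt_in_simplex: "finite s \<Longrightarrow> v \<in> s \<Longrightarrow> vertex_pt v \<in> simplex_of s"
  by (auto simp: vertex_pt_def simplex_of_def)

lemma simplex_of_singleton: "simplex_of {v} = {vertex_pt v}"
  by (auto simp: vertex_pt_def simplex_of_def)

text \<open>
  The map of realizations induced by the vertex map \<open>p\<close>, in barycentric coordinates.
\<close>

definition push_forward :: "(nat \<Rightarrow> nat) \<Rightarrow> (nat \<Rightarrow> real) \<Rightarrow> (nat \<Rightarrow> real)" where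
  "push_forward p x = (\<lambda>w. \<Sum>v | x v \<noteq> 0 \<and> p v = w. x v)"

lemma push_forward_vertex:
  assumes "x \<in> simplex_of t" "inj_on p t" "v \<in> t"
  shows "push_forward p x (p v) = x v"
proof (cases "x v = 0")
  case True
  then have "{v'. x v' \<noteq> 0 \<and> p v' = p v} = {}" using assms simplex_of_support by (force dest: inj_onD)
  then show ?thesis using True by (simp only: push_forward_def sum.empty)
next
  case False
  then have "{v'. x v' \<noteq> 0 \<and> p v' = p v} = {v}" using assms simplex_of_support by (force dest: inj_onD)
  then show ?thesis by (simp add: push_forward_def)
qed

lemma push_forward_outside:
  assumes "x \<in> simplex_of t" "w \<notin> p ` t"
  shows "push_forward p x w = 0"
proof -
  have "{v'. x v' \<noteq> 0 \<and> p v' = w} = {}" using assms simplex_of_support by blast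
  then show ?thesis by (simp only: push_forward_def sum.empty)
qed

lemma push_forward_in_simplex:
  assumes "x \<in> simplex_of t" "inj_on p t"
  shows "push_forward p x \<in> simplex_of (p ` t)"
proof -
  have "push_forward p x w \<ge> 0" for w
    using push_forward_vertex[OF assms] push_forward_outside[OF assms(1)] simplex_of_nonneg[OF assms(1)]
    by (cases "w \<in> p ` t") auto
  moreover have "(\<Sum>w\<in>p ` t. push_forward p x w) = (\<Sum>v\<in>t. x v)"
    using assms push_forward_vertex[OF assms] by (simp add: sum.reindex)
  ultimately show ?thesis
    using simplex_of_sum[OF assms(1)] push_forward_outside[OF assms(1)] by (simp add: simplex_of_def)
qed

lemma push_forward_image_simplex:
  assumes "finite t" "inj_on p t"
  shows "push_forward p ` simplex_of t = simplex_of (p ` t)"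
proof
  show "push_forward p ` simplex_of t \<subseteq> simplex_of (p ` t)" using push_forward_in_simplex assms by blast
  show "simplex_of (p ` t) \<subseteq> push_forward p ` simplex_of t"
  proof
    fix y assume y: "y \<in> simplex_of (p ` t)"
    define x where "x v = (if v \<in> t then y (p v) else 0)" for v
    have x: "x \<in> simplex_of t"
      using y assms by (auto simp: simplex_of_def x_def sum.reindex)
    have "push_forward p x = y"
    proof
      fix w show "push_forward p x w = y w"
        using push_forward_vertex[OF x assms(2)] push_forward_outside[OF x] y
        by (cases "w \<in> p ` t") (auto simp: x_def simplex_of_def)
    qed
    then show "y \<in> push_forward p ` simplex_of t" using x by blast
  qed
qed

lemma continuous_on_relative_open_cover:
  assumes "\<And>x. x \<in> X \<Longrightarrow> \<exists>G. open G \<and> x \<in> G \<and> continuous_on (X \<inter> G) f"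
  shows "continuous_on X f"
  unfolding continuous_on_def
proof
  fix x assume "x \<in> X"
  then obtain G where G: "open G" "x \<in> G" "continuous_on (X \<inter> G) f" using assms by blast
  then have "(f \<longlongrightarrow> f x) (at x within (X \<inter> G))" using \<open>x \<in> X\<close> by (simp add: continuous_on_def)
  moreover have "at x within X = at x within (X \<inter> G)" by (rule at_within_nhd[OF G(2,1)]) auto
  ultimately show "(f \<longlongrightarrow> f x) (at x within X)" by simp
qed

lemma continuous_coordinate [continuous_intros]: "continuous_on S (\<lambda>x. x (v :: 'a) :: real)"
  by (rule continuous_on_subset[OF continuous_on_product_coordinates]) simp

lemma open_coordinate_pos: "open {x :: 'a \<Rightarrow> real. x v > 0}"
  by (rule open_Collect_less) (intro continuous_intros)+

text \<open>
  A simplicial map that restricts to a bijection from the star of each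
  vertex onto the star of its image.
\<close>

locale star_bijective_map =
  fixes p :: "nat \<Rightarrow> nat" and T K :: "nat set set"
  assumes fin: "t \<in> T \<Longrightarrow> finite t"
    and finK: "\<tau> \<in> K \<Longrightarrow> finite \<tau>"
    and image_in: "t \<in> T \<Longrightarrow> p ` t \<in> K"
    and inj_star: "v \<in> \<Union>T \<Longrightarrow> inj_on p (\<Union>{t \<in> T. v \<in> t})"
    and lift: "\<lbrakk>v \<in> \<Union>T; \<tau> \<in> K; p v \<in> \<tau>\<rbrakk> \<Longrightarrow> \<exists>t\<in>T. v \<in> t \<and> p ` t = \<tau>"
    and onto: "p ` \<Union>T = \<Union>K"
begin

lemma inj: assumes "t \<in> T" shows "inj_on p t"
proof (cases "t = {}")
  case False
  then obtain v where "v \<in> t" by blast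
  then show ?thesis using assms by (intro inj_on_subset[OF inj_star[of v]]) auto
qed simp

definition star :: "nat \<Rightarrow> nat set" where
  "star v = \<Union>{t \<in> T. v \<in> t}"

definition open_star :: "nat \<Rightarrow> (nat \<Rightarrow> real) set" where
  "open_star v = realization T \<inter> {x. x v > 0}"

lemma open_star_simplex:
  assumes "x \<in> open_star v" obtains t where "t \<in> T" "v \<in> t" "x \<in> simplex_of t"
  using assms simplex_of_support[of x _ v] unfolding open_star_def realization_def by auto

text \<open>
  On an open star the induced map only permutes coordinates; continuity and the inverse map follow from
  this description.
\<close>

lemma push_forward_on_open_star:
  assumes x: "x \<in> open_star v"
  shows "push_forward p x w = (if w \<in> p ` star v then x (the_inv_into (star v) p w) else 0)"
proof -
  obtain t where t: "t \<in> T" "v \<in> t" "x \<in> simplex_of t" using open_star_simplex[OF x] .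
  have ts: "t \<subseteq> star v" and v: "v \<in> \<Union>T" using t by (auto simp: star_def)
  note i = inj_star[OF v, folded star_def]
  show ?thesis
  proof (cases "w \<in> p ` star v")
    case True
    then obtain u where u: "u \<in> star v" "w = p u" by blast
    show ?thesis
    proof (cases "u \<in> t")
      case True
      then show ?thesis using u i push_forward_vertex[OF t(3) inj[OF t(1)] True] by (simp add: the_inv_into_f_f)
    next
      case False
      then have "p u \<notin> p ` t" using inj_onD[OF i _ u(1)] ts by blast
      then show ?thesis using u i push_forward_outside[OF t(3)] False t(3)
        by (auto simp: the_inv_into_f_f simplex_of_def)
    qed
  next
    case False
    then have "w \<notin> p ` t" using ts by blast
    then show ?thesis using push_forward_outside[OF t(3)] False by simp
  qed
qed

lemma realization_open_star:
  assumes "x \<in> realization T" obtains v where "v \<in> \<Union>T" "x \<in> open_star v"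
proof -
  obtain t where "t \<in> T" "x \<in> simplex_of t" using assms by (auto simp: realization_def)
  moreover from this obtain v where "v \<in> t" "x v > 0" using simplex_of_pos by blast
  ultimately show ?thesis using that[of v] assms by (auto simp: open_star_def)
qed

lemma continuous_push_forward: "continuous_on (realization T) (push_forward p)"
proof (rule continuous_on_relative_open_cover)
  fix x assume "x \<in> realization T"
  then obtain v where v: "x \<in> open_star v" using realization_open_star by blast
  have "continuous_on (open_star v) (push_forward p)"
  proof (rule continuous_on_coordinatewise_then_product)
    fix w
    have "continuous_on (open_star v) (\<lambda>x. if w \<in> p ` star v then x (the_inv_into (star v) p w) else 0)"
      by (cases "w \<in> p ` star v") (simp_all add: continuous_coordinate)
    then show "continuous_on (open_star v) (\<lambda>x. push_forward p x w)"
      by (rule continuous_on_eq) (simp add: push_forward_on_open_star)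
  qed
  then show "\<exists>G. open G \<and> x \<in> G \<and> continuous_on (realization T \<inter> G) (push_forward p)"
    using v open_coordinate_pos[of v] unfolding open_star_def by blast
qed

lemma open_star_homeomorphism:
  assumes v: "v \<in> \<Union>T"
  shows "homeomorphism (open_star v) (realization K \<inter> {y. y (p v) > 0}) (push_forward p)
     (\<lambda>y u. if u \<in> star v then y (p u) else 0)" (is "homeomorphism ?U ?V ?f ?g")
proof
  note i = inj_star[OF v, folded star_def]
  show "continuous_on ?U ?f"
    using continuous_push_forward by (rule continuous_on_subset) (auto simp: open_star_def)
  show "continuous_on ?V ?g"
  proof (rule continuous_on_coordinatewise_then_product)
    fix u show "continuous_on ?V (\<lambda>y. if u \<in> star v then y (p u) else 0)"
      by (cases "u \<in> star v") (simp_all add: continuous_coordinate)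
  qed
  show "?f ` ?U \<subseteq> ?V"
  proof clarify
    fix x assume x: "x \<in> ?U"
    obtain t where t: "t \<in> T" "v \<in> t" "x \<in> simplex_of t" using open_star_simplex[OF x] .
    have "?f x \<in> realization K"
      using push_forward_in_simplex[OF t(3) inj[OF t(1)]] image_in[OF t(1)] by (auto simp: realization_def)
    moreover have "?f x (p v) > 0" using push_forward_vertex[OF t(3) inj[OF t(1)] t(2)] x by (simp add: open_star_def)
    ultimately show "?f x \<in> realization K \<inter> {y. y (p v) > 0}" by blast
  qed
  have g: "?g y \<in> ?U \<and> ?f (?g y) = y" if y: "y \<in> ?V" for y
  proof -
    obtain \<tau> where \<tau>: "\<tau> \<in> K" "y \<in> simplex_of \<tau>" using y by (auto simp: realization_def)
    then have "p v \<in> \<tau>" using y simplex_of_support by fastforce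
    then obtain t where t: "t \<in> T" "v \<in> t" "p ` t = \<tau>" using lift[OF v \<tau>(1)] by blast
    have ts: "t \<subseteq> star v" using t by (auto simp: star_def)
    have supp: "?g y u = (if u \<in> t then y (p u) else 0)" for u
    proof (cases "u \<in> star v \<and> u \<notin> t")
      case True
      have "p u \<notin> p ` t"
      proof
        assume "p u \<in> p ` t"
        then obtain u' where "u' \<in> t" "p u = p u'" by blast
        then show False using inj_onD[OF i, of u u'] ts True by blast
      qed
      then have "p u \<notin> \<tau>" using t(3) by simp
      then show ?thesis using \<tau>(2) True by (simp add: simplex_of_def)
    qed (use ts in auto)
    have 1: "?g y \<in> simplex_of t"
    proof -
      have "(\<Sum>u\<in>t. y (p u)) = sum y \<tau>"
        unfolding t(3)[symmetric] by (rule sum.reindex_cong[OF inj[OF t(1)] refl refl, symmetric])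
      then show ?thesis using \<tau>(2) unfolding supp by (simp add: simplex_of_def)
    qed
    moreover have "?g y v > 0" using y t supp[of v] by simp
    moreover have "?f (?g y) = y"
    proof
      fix w show "?f (?g y) w = y w"
      proof (cases "w \<in> p ` t")
        case True
        then show ?thesis using push_forward_vertex[OF 1 inj[OF t(1)]] supp by auto
      next
        case False
        then show ?thesis using push_forward_outside[OF 1 False] \<tau>(2) t(3) by (simp add: simplex_of_def)
      qed
    qed
    ultimately show ?thesis using t(1) by (auto simp: open_star_def realization_def)
  qed
  then show "?g ` ?V \<subseteq> ?U" by blast
  show "?f (?g y) = y" if "y \<in> ?V" for y using g[OF that] by blast
  show "?g (?f x) = x" if x: "x \<in> ?U" for x
  proof
    fix u
    obtain t where t: "t \<in> T" "v \<in> t" "x \<in> simplex_of t" using open_star_simplex[OF x] .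
    show "?g (?f x) u = x u"
    proof (cases "u \<in> star v")
      case True
      then show ?thesis using push_forward_on_open_star[OF x] i by (simp add: the_inv_into_f_f)
    next
      case False
      then have "u \<notin> t" using t by (auto simp: star_def)
      then show ?thesis using False t(3) by (simp add: simplex_of_def)
    qed
  qed
qed

text \<open>
  The open star of a vertex is evenly covered by the open stars of the vertices above it.  Two of these
  are disjoint, as a common point would put two vertices with the same image into one triangle.
\<close>

lemma covering_push_forward: "covering_space (realization T) (push_forward p) (realization K)"
proof
  show "continuous_on (realization T) (push_forward p)" by (rule continuous_push_forward)
  show "push_forward p ` realization T = realization K"
  proof
    show "push_forward p ` realization T \<subseteq> realization K"
      using push_forward_in_simplex inj image_in by (force simp: realization_def)
    show "realization K \<subseteq> push_forward p ` realization T"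
    proof
      fix y assume "y \<in> realization K"
      then obtain \<tau> where \<tau>: "\<tau> \<in> K" "y \<in> simplex_of \<tau>" by (auto simp: realization_def)
      then have "\<tau> \<noteq> {}" by (auto simp: simplex_of_def)
      then obtain v where v: "v \<in> \<Union>T" "p v \<in> \<tau>" using \<tau>(1) onto by (metis UnionI imageE ex_in_conv)
      obtain t where t: "t \<in> T" "p ` t = \<tau>" using lift[OF v(1) \<tau>(1) v(2)] by blast
      then have "y \<in> push_forward p ` simplex_of t"
        using push_forward_image_simplex[OF fin inj, of t] \<tau>(2) by simp
      then show "y \<in> push_forward p ` realization T" using t(1) unfolding realization_def by blast
    qed
  qed
  fix y assume y: "y \<in> realization K"
  then obtain \<tau> w where w: "\<tau> \<in> K" "y \<in> simplex_of \<tau>" "w \<in> \<tau>" "y w > 0"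
    using simplex_of_pos by (metis UN_E realization_def)
  let ?V = "realization K \<inter> {y. y w > 0}" and ?S = "{v \<in> \<Union>T. p v = w}"
  show "\<exists>V. y \<in> V \<and> openin (top_of_set (realization K)) V \<and>
      (\<exists>\<U>. \<Union>\<U> = realization T \<inter> push_forward p -` V \<and> (\<forall>U\<in>\<U>. openin (top_of_set (realization T)) U) \<and>
        pairwise disjnt \<U> \<and> (\<forall>U\<in>\<U>. \<exists>q. homeomorphism U V (push_forward p) q))"
  proof (intro exI[of _ ?V] conjI exI[of _ "open_star ` ?S"] ballI)
    show "y \<in> ?V" using y w by blast
    show "openin (top_of_set (realization K)) ?V" by (simp add: openin_open_Int open_coordinate_pos)
    show "\<Union> (open_star ` ?S) = realization T \<inter> push_forward p -` ?V"
    proof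
      show "\<Union> (open_star ` ?S) \<subseteq> realization T \<inter> push_forward p -` ?V"
        using homeomorphism_image1[OF open_star_homeomorphism] by (auto simp: open_star_def)
      show "realization T \<inter> push_forward p -` ?V \<subseteq> \<Union> (open_star ` ?S)"
      proof
        fix x assume x: "x \<in> realization T \<inter> push_forward p -` ?V"
        then obtain t where t: "t \<in> T" "x \<in> simplex_of t" by (auto simp: realization_def)
        then have "w \<in> p ` t" using x push_forward_outside[OF t(2), of w p] by auto
        then obtain v where v: "v \<in> t" "p v = w" by blast
        then have "x v > 0" using push_forward_vertex[OF t(2) inj[OF t(1)] v(1)] x by auto
        then show "x \<in> \<Union> (open_star ` ?S)" using v t x by (auto simp: open_star_def)
      qed
    qed
    show "openin (top_of_set (realization T)) U" if "U \<in> open_star ` ?S" for U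
      using that by (auto simp: open_star_def openin_open_Int open_coordinate_pos)
    show "pairwise disjnt (open_star ` ?S)"
    proof (rule pairwiseI, clarify)
      fix v v' assume v: "p v' = p v" and ne: "open_star v \<noteq> open_star v'"
      show "disjnt (open_star v) (open_star v')"
      proof (rule ccontr)
        assume "\<not> disjnt (open_star v) (open_star v')"
        then obtain x where x: "x \<in> open_star v" "x \<in> open_star v'" by (auto simp: disjnt_def)
        then obtain t where t: "t \<in> T" "v \<in> t" "x \<in> simplex_of t" using open_star_simplex by blast
        then have "v' \<in> t" using x(2) simplex_of_support[of x t v'] by (auto simp: open_star_def)
        then show False using inj_onD[OF inj[OF t(1)] v] t(2) ne by blast
      qed
    qed
    show "\<exists>q. homeomorphism U ?V (push_forward p) q" if "U \<in> open_star ` ?S" for U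
      using that open_star_homeomorphism by blast
  qed
qed

end

lemma covering_space_compose_homeomorphism:
  assumes p: "covering_space X p S" and h: "homeomorphism S S' h k"
  shows "covering_space X (h \<circ> p) S'"
proof
  note hh = homeomorphism_cont1[OF h] homeomorphism_image1[OF h]
  show "continuous_on X (h \<circ> p)"
    using covering_space_imp_continuous[OF p] covering_space_imp_surjective[OF p] hh(1)
    by (metis continuous_on_compose)
  show "(h \<circ> p) ` X = S'"
    using covering_space_imp_surjective[OF p] hh(2) by (metis image_comp)
  fix y assume y: "y \<in> S'"
  then have "k y \<in> S" using homeomorphism_image2[OF h] by blast
  then obtain V \<U> where V: "k y \<in> V" "openin (top_of_set S) V" "\<Union>\<U> = X \<inter> p -` V"
    "\<forall>U\<in>\<U>. openin (top_of_set X) U" "pairwise disjnt \<U>" "\<forall>U\<in>\<U>. \<exists>q. homeomorphism U V p q"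
    using p unfolding covering_space_def by metis
  have VS: "V \<subseteq> S" using V(2) openin_imp_subset by blast
  show "\<exists>W. y \<in> W \<and> openin (top_of_set S') W \<and> (\<exists>\<U>. \<Union>\<U> = X \<inter> (h \<circ> p) -` W \<and>
      (\<forall>U\<in>\<U>. openin (top_of_set X) U) \<and> pairwise disjnt \<U> \<and> (\<forall>U\<in>\<U>. \<exists>q. homeomorphism U W (h \<circ> p) q))"
  proof (intro exI[of _ "h ` V"] exI[of _ \<U>] conjI)
    show "y \<in> h ` V" using V(1) homeomorphism_apply2[OF h y] by force
    show "openin (top_of_set S') (h ` V)" using homeomorphism_imp_open_map[OF h V(2)] .
    show "\<Union>\<U> = X \<inter> (h \<circ> p) -` h ` V"
      unfolding V(3) using covering_space_imp_surjective[OF p] VS homeomorphism_apply1[OF h]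
      by (auto) (metis image_eqI subsetD)
    have "homeomorphism V (h ` V) h k" using homeomorphism_of_subsets[OF h VS] VS hh(2) by blast
    then show "\<forall>U\<in>\<U>. \<exists>q. homeomorphism U (h ` V) (h \<circ> p) q"
      using V(6) homeomorphism_compose by blast
  qed (use V in auto)
qed

text \<open>
  Both coverings are local homeomorphisms, so a neighbourhood upstairs can be compared with a small
  disc in the hyperbolic plane.
\<close>

lemma covering_space_locally_plane:
  assumes \<pi>: "covering_space X \<pi> S" and u: "covering_space hdisc u S" and x: "x \<in> X"
  shows "\<exists>U. x \<in> U \<and> openin (top_of_set X) U \<and> U homeomorphic (UNIV :: (real^2) set)"
proof -
  obtain N V q where V: "x \<in> N" "openin (top_of_set X) N" "\<pi> x \<in> V" "openin (top_of_set S) V" "homeomorphism N V \<pi> q"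
    using covering_space_local_homeomorphism[OF \<pi> x] by metis
  have "\<pi> x \<in> S" using covering_space_imp_surjective[OF \<pi>] x by blast
  then obtain z where z: "z \<in> hdisc" "u z = \<pi> x" using covering_space_imp_surjective[OF u] by (metis imageE)
  obtain M W r where W: "z \<in> M" "openin (top_of_set hdisc) M" "u z \<in> W" "openin (top_of_set S) W" "homeomorphism M W u r"
    using covering_space_local_homeomorphism[OF u z(1)] by metis
  have cu: "continuous_on hdisc u" using covering_space_imp_continuous[OF u] .
  have "openin (top_of_set hdisc) (hdisc \<inter> u -` V)"
    by (rule continuous_openin_preimage[OF cu _ V(4)]) (use covering_space_imp_surjective[OF u] in auto)
  then have "open (M \<inter> (hdisc \<inter> u -` V))" using W(2) by (metis open_ball openin_Int openin_open_eq)
  moreover have "z \<in> M \<inter> (hdisc \<inter> u -` V)" using z W V by auto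
  ultimately obtain e where e: "e > 0" "ball z e \<subseteq> M \<inter> (hdisc \<inter> u -` V)" by (meson openE)
  let ?B = "u ` ball z e"
  have BV: "?B \<subseteq> V" using e by auto
  have "openin (top_of_set M) (ball z e)" using e by (auto intro!: open_subset)
  then have "openin (top_of_set W) ?B" by (rule homeomorphism_imp_open_map[OF W(5)])
  then have oB: "openin (top_of_set S) ?B" using W(4) openin_trans by blast
  then have "openin (top_of_set V) ?B" using BV openin_imp_subset[OF V(4)] openin_subset_trans by blast
  then have "openin (top_of_set N) (q ` ?B)" using homeomorphism_imp_open_map[OF homeomorphism_symD[OF V(5)]] by blast
  then have "openin (top_of_set X) (q ` ?B)" using V(2) openin_trans by blast
  moreover have "x \<in> q ` ?B" using homeomorphism_apply1[OF V(5,1)] z e by (metis centre_in_ball image_eqI)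
  moreover have "q ` ?B homeomorphic (UNIV :: (real^2) set)"
  proof -
    have "?B homeomorphic q ` ?B"
      using homeomorphism_of_subsets[OF homeomorphism_symD[OF V(5)] BV] homeomorphic_def homeomorphism_image2[OF V(5)] BV
      by blast
    moreover have "ball z e homeomorphic ?B"
      using homeomorphism_of_subsets[OF W(5), of "ball z e" W] e homeomorphism_image1[OF W(5)] unfolding homeomorphic_def by blast
    moreover have "ball z e homeomorphic (UNIV :: complex set)" using homeomorphic_ball_UNIV e by blast
    moreover have "(UNIV :: complex set) homeomorphic (UNIV :: (real^2) set)" by (simp add: homeomorphic_UNIV_UNIV)
    ultimately show ?thesis by (meson homeomorphic_sym homeomorphic_trans)
  qed
  ultimately show ?thesis by (intro exI[of _ "q ` ?B"] conjI)
qed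

definition triangle_chart :: "nat \<Rightarrow> nat \<Rightarrow> nat \<Rightarrow> real \<times> real \<Rightarrow> nat \<Rightarrow> real" where
  "triangle_chart a b c = (\<lambda>(x, y) v. if v = a then x else if v = b then y else if v = c then 1 - x - y else 0)"

lemma simplex_of_triangle:
  assumes "distinct [a, b, c]"
  shows "simplex_of {a, b, c} = triangle_chart a b c ` {(x, y). 0 \<le> x \<and> 0 \<le> y \<and> x + y \<le> 1}"
proof
  have "triangle_chart a b c (x, y) \<in> simplex_of {a, b, c}" if "0 \<le> x" "0 \<le> y" "x + y \<le> 1" for x y
    using assms that unfolding triangle_chart_def simplex_of_def by simp
  then show "triangle_chart a b c ` {(x, y). 0 \<le> x \<and> 0 \<le> y \<and> x + y \<le> 1} \<subseteq> simplex_of {a, b, c}"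
    by blast
  show "simplex_of {a, b, c} \<subseteq> triangle_chart a b c ` {(x, y). 0 \<le> x \<and> 0 \<le> y \<and> x + y \<le> 1}"
  proof
    fix x assume x: "x \<in> simplex_of {a, b, c}"
    then have s: "x a + x b + x c = 1" "x a \<ge> 0" "x b \<ge> 0" "x c \<ge> 0"
      using assms simplex_of_sum[OF x] simplex_of_nonneg[OF x] by auto
    have "x v = triangle_chart a b c (x a, x b) v" for v
    proof (cases "v \<in> {a, b, c}")
      case False
      then show ?thesis using simplex_of_support[OF x, of v] by (auto simp: triangle_chart_def)
    qed (use s assms in \<open>auto simp: triangle_chart_def\<close>)
    then have "x = triangle_chart a b c (x a, x b)" by blast
    moreover have "(x a, x b) \<in> {(x, y). 0 \<le> x \<and> 0 \<le> y \<and> x + y \<le> 1}" using s by auto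
    ultimately show "x \<in> triangle_chart a b c ` {(x, y). 0 \<le> x \<and> 0 \<le> y \<and> x + y \<le> 1}" by blast
  qed
qed

lemma simplex_of_triangle_compact_connected:
  assumes "card t = 3" shows "compact (simplex_of t)" "connected (simplex_of t)"
proof -
  obtain a b c where t: "t = {a, b, c}" "distinct [a, b, c]" using assms by (auto simp: card_3_iff)
  let ?D = "{(x, y). 0 \<le> x \<and> 0 \<le> y \<and> x + y \<le> (1::real)}"
  have cont: "continuous_on ?D (triangle_chart a b c)"
  proof (rule continuous_on_coordinatewise_then_product)
    fix v
    show "continuous_on ?D (\<lambda>z. triangle_chart a b c z v)"
      unfolding triangle_chart_def case_prod_unfold
      by (cases "v = a"; cases "v = b"; cases "v = c") (auto intro!: continuous_intros)
  qed
  have eq: "?D = {z. (1, 0) \<bullet> z \<ge> 0} \<inter> {z. (0, 1) \<bullet> z \<ge> 0} \<inter> {z. (1, 1) \<bullet> z \<le> 1}" by auto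
  have "convex ?D" unfolding eq by (intro convex_Int convex_halfspace_ge convex_halfspace_le)
  then have "connected ?D" by (rule convex_connected)
  moreover have "closed ?D" unfolding eq by (intro closed_Int closed_halfspace_ge closed_halfspace_le)
  moreover have "bounded ?D"
    by (rule bounded_subset[OF bounded_Times[of "{0..1}" "{0..1}"]]) auto
  ultimately show "compact (simplex_of t)" "connected (simplex_of t)"
    unfolding t(1) simplex_of_triangle[OF t(2)]
    by (auto intro!: compact_continuous_image connected_continuous_image cont simp: compact_eq_bounded_closed)
qed

lemma barycentric_image:
  fixes k :: "nat \<Rightarrow> 'a::real_vector"
  assumes "finite s" "inj_on k s"
  shows "(\<lambda>x. \<Sum>v\<in>s. x v *\<^sub>R k v) ` simplex_of s = convex hull (k ` s)"
proof
  show "(\<lambda>x. \<Sum>v\<in>s. x v *\<^sub>R k v) ` simplex_of s \<subseteq> convex hull (k ` s)"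
  proof clarify
    fix x assume x: "x \<in> simplex_of s"
    show "(\<Sum>v\<in>s. x v *\<^sub>R k v) \<in> convex hull (k ` s)"
      by (rule convex_sum) (use x assms(1) simplex_of_sum simplex_of_nonneg in \<open>auto intro: hull_inc\<close>)
  qed
  show "convex hull (k ` s) \<subseteq> (\<lambda>x. \<Sum>v\<in>s. x v *\<^sub>R k v) ` simplex_of s"
  proof
    fix q assume "q \<in> convex hull (k ` s)"
    then obtain c where c: "\<forall>p\<in>k ` s. 0 \<le> c p" "sum c (k ` s) = 1" "(\<Sum>p\<in>k ` s. c p *\<^sub>R p) = q"
      using convex_hull_finite[of "k ` s"] assms(1) by auto
    define z where "z v = (if v \<in> s then c (k v) else 0)" for v
    have "z \<in> simplex_of s" using c(1,2) assms(2) by (auto simp: simplex_of_def z_def sum.reindex)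
    moreover have "(\<Sum>v\<in>s. z v *\<^sub>R k v) = q" using c(3) assms(2) by (simp add: z_def sum.reindex)
    ultimately show "q \<in> (\<lambda>x. \<Sum>v\<in>s. x v *\<^sub>R k v) ` simplex_of s" by blast
  qed
qed

section \<open>Flag-transitive triangulations with seven triangles at each vertex\<close>

text \<open>
  The hypotheses are the properties of the tiling of the quartic from which the Klein map is reconstructed.
\<close>

locale flag_transitive_37_complex =
  fixes K :: "'v set set"
  assumes card_triangle: "t \<in> K \<Longrightarrow> card t = 3"
    and other_triangle: "{x, y, z} \<in> K \<Longrightarrow> \<exists>!w. w \<noteq> z \<and> {x, y, w} \<in> K"
    and card_star: "v \<in> \<Union>K \<Longrightarrow> card {t \<in> K. v \<in> t} = 7"
    and flag_automorphism: "\<lbrakk>{x, y, z} \<in> K; {x', y', z'} \<in> K\<rbrakk> \<Longrightarrow>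
      \<exists>\<psi>. inj_on \<psi> (\<Union>K) \<and> (\<forall>t\<in>K. \<psi> ` t \<in> K) \<and> \<psi> x = x' \<and> \<psi> y = y' \<and> \<psi> z = z'"
    and petrie_closes: "\<lbrakk>\<And>i. {p i, p (i+1), p (i+2)} \<in> K; \<And>i. p (i+3) \<noteq> p i\<rbrakk> \<Longrightarrow> p (8::nat) = p 0 \<and> p 9 = p 1 \<and> p 10 = p 2"
begin

definition across :: "'v \<Rightarrow> 'v \<Rightarrow> 'v \<Rightarrow> 'v" where
  "across x y z = (THE w. w \<noteq> z \<and> {x, y, w} \<in> K)"

definition hinge :: "'v \<Rightarrow> 'v \<Rightarrow> 'v \<Rightarrow> 'v \<Rightarrow> bool" where
  "hinge x y z w \<longleftrightarrow> {x, y, z} \<in> K \<and> {x, y, w} \<in> K \<and> w \<noteq> z"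

lemma triangle_distinct: "{x, y, z} \<in> K \<Longrightarrow> x \<noteq> y \<and> y \<noteq> z \<and> x \<noteq> z"
  using card_triangle[of "{x, y, z}"] by (auto simp: card_insert_if split: if_splits)

lemma hinge_swap_sides: "hinge x y z w \<Longrightarrow> hinge x y w z"
  and hinge_swap_ends: "hinge x y z w \<Longrightarrow> hinge y x z w"
  unfolding hinge_def by (auto simp: insert_commute)

lemma hinge_across: "{x, y, z} \<in> K \<Longrightarrow> hinge x y z (across x y z)"
  using theI'[OF other_triangle, of x y z] unfolding hinge_def across_def by auto

lemma hinge_unique: "hinge x y z w \<Longrightarrow> hinge x y z w' \<Longrightarrow> w = w'"
  using other_triangle[of x y z] unfolding hinge_def by auto

lemma across_eq: "hinge x y z w \<Longrightarrow> across x y z = w"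
  using hinge_unique hinge_across hinge_def by blast

definition link_flags :: "'v \<Rightarrow> ('v \<times> 'v) set" where
  "link_flags v = {(x, y). {v, x, y} \<in> K}"

text \<open>
  Flags \<open>{v, x, y}\<close> at \<open>v\<close> are pairs \<open>(x, y)\<close>; one step around \<open>v\<close> passes to the next triangle.
\<close>

definition turn :: "'v \<Rightarrow> 'v \<times> 'v \<Rightarrow> 'v \<times> 'v" where
  "turn v = (\<lambda>(x, y). (y, across v y x))"

lemma turn_hinge:
  assumes "(x, y) \<in> link_flags v" shows "hinge v y x (across v y x)"
  using assms hinge_across[of v y x] by (simp add: link_flags_def insert_commute)

lemma swap_link_flags: "f \<in> link_flags v \<Longrightarrow> prod.swap f \<in> link_flags v"
  by (cases f) (simp add: link_flags_def insert_commute)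

lemma turn_in: "f \<in> link_flags v \<Longrightarrow> turn v f \<in> link_flags v"
  using turn_hinge[of "fst f" "snd f" v] by (cases f) (simp add: turn_def hinge_def link_flags_def)

lemma turn_pow_in: "f \<in> link_flags v \<Longrightarrow> (turn v ^^ n) f \<in> link_flags v"
  by (induction n) (auto simp: turn_in)

lemma turn_swap: "f \<in> link_flags v \<Longrightarrow> turn v (prod.swap (turn v f)) = prod.swap f"
  using across_eq[OF hinge_swap_sides[OF turn_hinge]] by (cases f) (simp add: turn_def)

lemma turn_inj: "inj_on (turn v) (link_flags v)"
proof (rule inj_onI)
  fix f g assume "f \<in> link_flags v" "g \<in> link_flags v" "turn v f = turn v g"
  then have "prod.swap f = prod.swap g" using turn_swap[of f v] turn_swap[of g v] by simp
  then show "f = g" by (metis swap_swap)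
qed

lemma turn_pow_inj: "inj_on (turn v ^^ n) (link_flags v)"
proof (induction n)
  case (Suc n)
  show ?case
  proof (rule inj_onI)
    fix f g assume fg: "f \<in> link_flags v" "g \<in> link_flags v" "(turn v ^^ Suc n) f = (turn v ^^ Suc n) g"
    then have "(turn v ^^ n) f = (turn v ^^ n) g"
      using inj_onD[OF turn_inj _ turn_pow_in turn_pow_in, of v n f n g] by simp
    then show "f = g" using Suc fg by (simp add: inj_on_def)
  qed
qed auto

text \<open>
  A walk around \<open>v\<close> that came back in the opposite direction would be symmetric about its middle, where
  two consecutive vertices or two vertices on either side of a triangle would coincide.
\<close>

lemma turn_pow_not_swap: "f \<in> link_flags v \<Longrightarrow> (turn v ^^ n) f \<noteq> prod.swap f"
proof (induction n arbitrary: f rule: induct_nat_012)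
  case 0
  then show ?case using triangle_distinct[of v] by (cases f) (auto simp: link_flags_def)
next
  case 1
  then show ?case using turn_hinge[of "fst f" "snd f" v] by (cases f) (simp add: turn_def hinge_def)
next
  case (ge2 n)
  let ?g = "turn v f"
  have g: "?g \<in> link_flags v" using turn_in[OF ge2.prems] .
  show ?case
  proof
    assume "(turn v ^^ Suc (Suc n)) f = prod.swap f"
    then have "turn v ((turn v ^^ n) ?g) = turn v (prod.swap ?g)"
      using turn_swap[OF ge2.prems] by (simp add: funpow_swap1)
    moreover have "prod.swap ?g \<in> link_flags v"
      using g by (cases ?g) (simp add: link_flags_def insert_commute)
    ultimately have "(turn v ^^ n) ?g = prod.swap ?g"
      using inj_onD[OF turn_inj] turn_pow_in[OF g] by blast
    then show False using ge2(1)[OF g] by blast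
  qed
qed

lemma finite_link_flags:
  assumes "v \<in> \<Union>K" shows "finite (link_flags v)" and "card (link_flags v) = 14"
proof -
  let ?S = "{t \<in> K. v \<in> t}"
  let ?P = "\<lambda>t. {(x, y). {v, x, y} = t}"
  have S: "card ?S = 7" using card_star[OF assms] .
  then have finS: "finite ?S" by (intro card_ge_0_finite) simp
  have two: "card (?P t) = 2 \<and> finite (?P t)" if t: "t \<in> ?S" for t
  proof -
    have "card (t - {v}) = 2" using t card_triangle[of t] by (auto simp: card_Diff_singleton_if)
    then obtain x y where "t - {v} = {x, y}" "x \<noteq> y" by (auto simp: card_2_iff)
    then have xy: "t = {v, x, y}" "x \<noteq> v" "y \<noteq> v" "x \<noteq> y" using t by auto
    then have "?P t = {(x, y), (y, x)}" by (auto simp: doubleton_eq_iff set_eq_iff)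
    then show ?thesis using xy by auto
  qed
  have eq: "link_flags v = (\<Union>t\<in>?S. ?P t)" by (auto simp: link_flags_def)
  show "finite (link_flags v)" unfolding eq using finS two by blast
  have "card (\<Union>t\<in>?S. ?P t) = (\<Sum>t\<in>?S. card (?P t))"
    by (rule card_UN_disjoint) (use finS two in auto)
  also have "\<dots> = (\<Sum>t\<in>?S. 2)" by (rule sum.cong) (use two in auto)
  finally show "card (link_flags v) = 14" using S eq by simp
qed

text \<open>
  Automorphisms commute with \<open>turn v\<close>, so its orbits on the 14 flags at \<open>v\<close> all have the same size \<open>n\<close>, a
  divisor of 14.  Sizes 1 and 2 are excluded because consecutive triangles differ, and size 14 because an
  orbit does not contain a flag together with its reverse.
\<close>

lemma turn_pow_7_and_orbit:
  assumes f: "f \<in> link_flags v"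
  shows "(turn v ^^ 7) f = f \<and> card ((\<lambda>i. (turn v ^^ i) f) ` {..<7}) = 7"
proof -
  let ?F = "link_flags v" and ?R = "turn v"
  obtain x0 y0 where f0: "f = (x0, y0)" by (cases f)
  have "{v, x0, y0} \<in> K" using f f0 by (simp add: link_flags_def)
  then have v: "v \<in> \<Union>K" by blast
  note fin = finite_link_flags[OF v]
  have per: "(?R ^^ n) g = g" if g: "g \<in> ?F" and h: "h \<in> ?F" and n: "(?R ^^ n) h = h" for g h n
  proof -
    obtain \<psi> where \<psi>: "inj_on \<psi> (\<Union>K)" "\<And>t. t \<in> K \<Longrightarrow> \<psi> ` t \<in> K" "\<psi> v = v" "map_prod \<psi> \<psi> h = g"
      using flag_automorphism[of v "fst h" "snd h" v "fst g" "snd g"] g h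
      by (cases g, cases h) (auto simp: link_flags_def)
    have step: "map_prod \<psi> \<psi> (?R k) = ?R (map_prod \<psi> \<psi> k)" if k: "k \<in> ?F" for k
    proof (cases k)
      case (Pair x y)
      have hg: "hinge v y x (across v y x)" using k Pair by (auto simp: link_flags_def insert_commute intro!: hinge_across)
      then have "{v, y, x} \<in> K" "{v, y, across v y x} \<in> K" "across v y x \<noteq> x" by (auto simp: hinge_def)
      then have "hinge v (\<psi> y) (\<psi> x) (\<psi> (across v y x))"
        using \<psi>(2)[of "{v, y, x}"] \<psi>(2)[of "{v, y, across v y x}"] \<psi>(3) inj_onD[OF \<psi>(1), of "across v y x" x]
        unfolding hinge_def by (metis UnionI image_insert image_empty insertCI)
      then show ?thesis using Pair across_eq by (auto simp: turn_def)
    qed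
    have "map_prod \<psi> \<psi> ((?R ^^ n) h) = (?R ^^ n) (map_prod \<psi> \<psi> h)"
      by (induction n) (auto simp: step turn_pow_in h)
    then show ?thesis using n \<psi>(4) by simp
  qed
  have "\<not> inj_on (\<lambda>i. (?R ^^ i) f) {..14}"
    using card_inj_on_le[of "\<lambda>i. (?R ^^ i) f" "{..14}" ?F] fin turn_pow_in[OF f] by auto
  then obtain i j where "i < j" "(?R ^^ i) f = (?R ^^ j) f"
    unfolding inj_on_def by (metis linorder_neqE_nat)
  moreover from this have "(?R ^^ i) f = (?R ^^ i) ((?R ^^ (j - i)) f)" by (simp flip: funpow_add comp_apply[of "_ ^^ _"] )
  ultimately have "\<exists>n>0. (?R ^^ n) f = f"
    using inj_onD[OF turn_pow_inj[where n=i and v=v], of f "(?R ^^ (j - i)) f"] turn_pow_in[OF f] f by (metis zero_less_diff)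
  \<comment> \<open>By flag-transitivity the period \<open>n\<close> of \<open>f\<close> is the period of every flag at \<open>v\<close>.\<close>
  define n where "n = (LEAST n. n > 0 \<and> (?R ^^ n) f = f)"
  have n: "n > 0" "(?R ^^ n) f = f"
    using LeastI_ex[OF \<open>\<exists>n>0. _\<close>] unfolding n_def by auto
  have least: "n \<le> m" if "m > 0" "(?R ^^ m) f = f" for m unfolding n_def by (rule Least_le) (use that in auto)
  define orb where "orb g = (\<lambda>i. (?R ^^ i) g) ` {..<n}" for g
  have orbn: "(?R ^^ n) g = g" if "g \<in> ?F" for g using per[OF that f n(2)] .
  have orb_mod: "(?R ^^ i) g \<in> orb g" if "g \<in> ?F" for g i
    using funpow_mod_eq[OF orbn[OF that], of i] n(1) unfolding orb_def by (metis image_eqI lessThan_iff mod_less_divisor)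
  have orb_card: "card (orb g) = n" if g: "g \<in> ?F" for g
  proof -
    have "inj_on (\<lambda>i. (?R ^^ i) g) {..<n}"
    proof (rule linorder_inj_onI, goal_cases)
      case (1 i j)
      show ?case
      proof
        assume eq: "(?R ^^ i) g = (?R ^^ j) g"
        then have "(?R ^^ i) g = (?R ^^ i) ((?R ^^ (j - i)) g)" using 1 by (simp flip: funpow_add comp_apply[of "_ ^^ _"])
        then have "(?R ^^ (j - i)) g = g"
          using inj_onD[OF turn_pow_inj[where n=i and v=v], of g "(?R ^^ (j - i)) g"] turn_pow_in[OF g] g by metis
        then have "(?R ^^ (j - i)) f = f" using per[OF f g] by blast
        then show False using least[of "j - i"] 1 by auto
      qed
    qed auto
    then show ?thesis unfolding orb_def by (simp add: card_image)
  qed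
  have orb_sub: "orb g \<subseteq> ?F" if "g \<in> ?F" for g using turn_pow_in[OF that] by (auto simp: orb_def)
  have orb_trans: "orb h \<subseteq> orb g" if "g \<in> ?F" "h \<in> orb g" for g h
    using that orb_mod[OF that(1)] unfolding orb_def by (auto simp flip: funpow_add comp_apply[of "_ ^^ _"])
  have orb_eq: "orb h = orb g" if "g \<in> ?F" "h \<in> orb g" for g h
    using card_subset_eq[OF _ orb_trans[OF that]] orb_card that orb_sub fin(1) finite_subset by (metis subsetD)
  have self: "g \<in> orb g" if "g \<in> ?F" for g using orb_mod[OF that, of 0] by simp
  have "n dvd card (\<Union> (orb ` ?F))"
  proof (rule dvd_partition)
    show "finite (\<Union> (orb ` ?F))" using orb_sub fin(1) by (meson UN_least finite_subset)
    show "\<forall>c\<in>orb ` ?F. n dvd card c" using orb_card by auto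
    show "\<forall>c1\<in>orb ` ?F. \<forall>c2\<in>orb ` ?F. c1 \<noteq> c2 \<longrightarrow> c1 \<inter> c2 = {}"
      using orb_eq orb_sub by blast
  qed
  moreover have "\<Union> (orb ` ?F) = ?F" using orb_sub self by blast
  ultimately have "n dvd 14" using fin(2) by simp
  then have "n \<in> {1, 2, 7, 14}"
  proof -
    have "n \<le> 14" using \<open>n dvd 14\<close> by (rule dvd_imp_le) simp
    then have "n \<in> {0..14}" by auto
    then show ?thesis using \<open>n dvd 14\<close> by (auto simp: atLeastAtMost_upt upt_rec dvd_def) presburger+
  qed
  moreover have "n \<noteq> 1" using n turn_pow_not_swap[of f v 0] f triangle_distinct[of v x0 y0] f0
    by (auto simp: turn_def link_flags_def)
  moreover have "n \<noteq> 2"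
  proof
    assume "n = 2"
    then have "turn v (turn v f) = f" using n by (simp add: numeral_2_eq_2)
    then show False using f0 f turn_hinge[of x0 y0 v] by (auto simp: turn_def hinge_def)
  qed
  moreover have "n \<noteq> 14"
  proof
    assume "n = 14"
    then have "orb f = ?F" using card_subset_eq[OF fin(1) orb_sub[OF f]] fin orb_card f by auto
    moreover have "prod.swap f \<in> ?F" using f f0 by (auto simp: link_flags_def insert_commute)
    ultimately show False using turn_pow_not_swap[OF f] unfolding orb_def by (metis (no_types, lifting) imageE)
  qed
  ultimately have "n = 7" by auto
  then show ?thesis using n orb_card[OF f] unfolding orb_def by auto
qed

lemmas turn_pow_7 = turn_pow_7_and_orbit[THEN conjunct1]

lemma link_flags_orbit:
  assumes f: "f \<in> link_flags v" and g: "g \<in> link_flags v"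
  obtains i where "g = (turn v ^^ i) f \<or> g = prod.swap ((turn v ^^ i) f)"
proof -
  let ?S = "(\<lambda>i. (turn v ^^ i) f) ` {..<7}"
  have v: "v \<in> \<Union>K" using f by (cases f) (auto simp: link_flags_def)
  have S: "card ?S = 7" "finite ?S" using turn_pow_7_and_orbit[OF f] by auto
  have "?S \<inter> prod.swap ` ?S = {}"
  proof (rule ccontr)
    assume "?S \<inter> prod.swap ` ?S \<noteq> {}"
    then obtain i j where ij: "i < 7" "j < 7" "(turn v ^^ i) f = prod.swap ((turn v ^^ j) f)" by blast
    have "(turn v ^^ (i + 7)) f = (turn v ^^ i) f" using turn_pow_7[OF f] by (simp add: funpow_add)
    moreover have "i + 7 = (i + 7 - j) + j" using ij by simp
    ultimately have "(turn v ^^ (i + 7 - j)) ((turn v ^^ j) f) = prod.swap ((turn v ^^ j) f)"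
      using ij(3) by (metis funpow_add comp_apply)
    then show False using turn_pow_not_swap[OF turn_pow_in[OF f]] by blast
  qed
  then have "card (?S \<union> prod.swap ` ?S) = 14"
    using S by (subst card_Un_disjoint) (auto simp: card_image)
  moreover have "?S \<union> prod.swap ` ?S \<subseteq> link_flags v"
    using turn_pow_in[OF f] swap_link_flags by blast
  ultimately have "?S \<union> prod.swap ` ?S = link_flags v"
    using finite_link_flags[OF v] by (intro card_subset_eq) auto
  then show ?thesis using g that by blast
qed

text \<open>
  Every triangle at \<open>v\<close> is reached from \<open>\<tau>0\<close> by turning around \<open>v\<close>, that is, by crossing edges.
\<close>

lemma closed_under_hinges_star:
  assumes L: "L \<subseteq> K" and closed: "\<And>x y z w. {x, y, z} \<in> L \<Longrightarrow> hinge x y z w \<Longrightarrow> {x, y, w} \<in> L"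
    and \<tau>0: "\<tau>0 \<in> L" "v \<in> \<tau>0" and \<tau>: "\<tau> \<in> K" "v \<in> \<tau>"
  shows "\<tau> \<in> L"
proof -
  have flag: "\<exists>x y. \<sigma> = {v, x, y}" if "\<sigma> \<in> K" "v \<in> \<sigma>" for \<sigma>
  proof -
    have "card (\<sigma> - {v}) = 2" using that card_triangle[of \<sigma>] by (simp add: card_Diff_singleton_if)
    then obtain x y where "\<sigma> - {v} = {x, y}" by (auto simp: card_2_iff)
    then show ?thesis using that by blast
  qed
  obtain x0 y0 where 0: "\<tau>0 = {v, x0, y0}" using flag[of \<tau>0] \<tau>0 L by blast
  obtain x y where xy: "\<tau> = {v, x, y}" using flag[OF \<tau>] by blast
  have f0: "(x0, y0) \<in> link_flags v" and f: "(x, y) \<in> link_flags v"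
    using 0 xy \<tau>0 \<tau> L by (auto simp: link_flags_def)
  have inL: "insert v {fst ((turn v ^^ i) (x0, y0)), snd ((turn v ^^ i) (x0, y0))} \<in> L" for i
  proof (induction i)
    case (Suc i)
    obtain p q where pq: "(turn v ^^ i) (x0, y0) = (p, q)" by (cases "(turn v ^^ i) (x0, y0)")
    then have "hinge v q p (across v q p)" using turn_hinge turn_pow_in[OF f0, of i] by metis
    moreover have "{v, q, p} \<in> L" using Suc pq by (simp add: insert_commute)
    ultimately have "{v, q, across v q p} \<in> L" using closed by blast
    then show ?case using pq by (simp add: turn_def)
  qed (use 0 \<tau>0 in simp)
  obtain i where "(x, y) = (turn v ^^ i) (x0, y0) \<or> (x, y) = prod.swap ((turn v ^^ i) (x0, y0))"
    using link_flags_orbit[OF f0 f] .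
  then show ?thesis using inL[of i] xy by (cases "(turn v ^^ i) (x0, y0)") (auto simp: insert_commute)
qed

text \<open>
  Six consecutive triangles around \<open>v\<close> determine the seventh.
\<close>

lemma link_closes:
  assumes "hinge v c1 c0 c2" "hinge v c2 c1 c3" "hinge v c3 c2 c4" "hinge v c4 c3 c5" "hinge v c5 c4 c6"
  shows "hinge v c6 c5 c0" "hinge v c0 c6 c1"
proof -
  let ?z = "across v c6 c5"
  have z: "hinge v c6 c5 ?z" "hinge v ?z c6 (across v ?z c6)"
    using assms(5) hinge_across[of v c6 c5] hinge_across[of v ?z c6]
    by (auto simp: hinge_def insert_commute)
  have "(turn v ^^ 7) (c0, c1) = (?z, across v ?z c6)"
    using assms by (simp add: eval_nat_numeral turn_def across_eq)
  moreover have "(c0, c1) \<in> link_flags v" using assms by (auto simp: hinge_def link_flags_def insert_commute)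
  ultimately show "hinge v c6 c5 c0" "hinge v c0 c6 c1" using turn_pow_7 z by auto
qed

primrec zigzag_flag :: "'v \<times> 'v \<times> 'v \<Rightarrow> nat \<Rightarrow> 'v \<times> 'v \<times> 'v" where
  "zigzag_flag f 0 = f"
| "zigzag_flag f (Suc n) = (case zigzag_flag f n of (x, y, z) \<Rightarrow> (y, z, across y z x))"

text \<open>
  Six consecutive triangles of a Petrie polygon determine the remaining two of the eight.
\<close>

lemma petrie_octagon:
  assumes h: "hinge p1 p2 p0 p3" "hinge p2 p3 p1 p4" "hinge p3 p4 p2 p5" "hinge p4 p5 p3 p6" "hinge p5 p6 p4 p7"
  shows "hinge p6 p7 p5 p0" "hinge p7 p0 p6 p1" "hinge p0 p1 p7 p2"
proof -
  let ?z = "zigzag_flag (p0, p1, p2)"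
  define p where "p i = fst (?z i)" for i
  have inv: "?z i = (p i, p (i+1), p (i+2)) \<and> {p i, p (i+1), p (i+2)} \<in> K \<and> hinge (p (i+1)) (p (i+2)) (p i) (p (i+3))" for i
  proof (induction i)
    case 0
    then show ?case using h(1) across_eq[OF h(1)]
      by (auto simp: p_def eval_nat_numeral hinge_def insert_commute)
  next
    case (Suc i)
    then have "?z (Suc i) = (p (i+1), p (i+2), across (p (i+1)) (p (i+2)) (p i))"
      and *: "across (p (i+1)) (p (i+2)) (p i) = p (i+3)" using across_eq by auto
    then have 1: "?z (Suc i) = (p (i+1), p (i+2), p (i+3))" by simp
    have 2: "{p (i+1), p (i+2), p (i+3)} \<in> K" using Suc by (auto simp: hinge_def)
    have "?z (Suc (Suc (Suc (Suc i)))) = (p (i+4), across (p (i+3)) (across (p (i+2)) (p (i+3)) (p (i+1))) (p (i+2)),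
       across (across (p (i+2)) (p (i+3)) (p (i+1))) (across (p (i+3)) (across (p (i+2)) (p (i+3)) (p (i+1))) (p (i+2))) (p (i+3)))"
      using 1 by (simp add: p_def eval_nat_numeral split: prod.splits)
    then have "p (i+4) = across (p (i+2)) (p (i+3)) (p (i+1))"
      using 1 by (simp add: p_def eval_nat_numeral split: prod.splits)
    then have "hinge (p (i+2)) (p (i+3)) (p (i+1)) (p (i+4))"
      using hinge_across[of "p (i+2)" "p (i+3)" "p (i+1)"] 2 by (simp add: insert_commute)
    then show ?case using 1 2 by (simp add: eval_nat_numeral)
  qed
  have p012: "p 0 = p0" "p 1 = p1" "p 2 = p2" using inv[of 0] by (simp_all add: numeral_2_eq_2)
  have hp: "hinge (p (i+1)) (p (i+2)) (p i) (p (i+3))" for i using inv by blast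
  have p3: "p 3 = p3" using hp[of 0] h(1) p012 hinge_unique by (auto simp: eval_nat_numeral)
  have p4: "p 4 = p4" using hp[of 1] h(2) p012 p3 hinge_unique by (auto simp: eval_nat_numeral)
  have p5: "p 5 = p5" using hp[of 2] h(3) p012 p3 p4 hinge_unique by (auto simp: eval_nat_numeral)
  have p6: "p 6 = p6" using hp[of 3] h(4) p5 p3 p4 hinge_unique by (auto simp: eval_nat_numeral)
  have p7: "p 7 = p7" using hp[of 4] h(5) p5 p6 p4 hinge_unique by (auto simp: eval_nat_numeral)
  have "p 8 = p 0 \<and> p 9 = p 1 \<and> p 10 = p 2"
    by (rule petrie_closes) (use inv hinge_def in blast)+
  then show "hinge p6 p7 p5 p0" "hinge p7 p0 p6 p1" "hinge p0 p1 p7 p2"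
    using hp[of 5] hp[of 6] hp[of 7] p012 p5 p6 p7 by simp_all
qed

text \<open>
  The vertices are \<open>s\<close>, its neighbours \<open>a i\<close>, the vertices \<open>b i\<close> across the edges \<open>a i\<close>, \<open>a (i+1)\<close> of the link
  of \<open>s\<close>, the vertices \<open>c i\<close> across the edges \<open>a i\<close>, \<open>b i\<close>, and two more vertices \<open>p\<close> and \<open>q\<close>.  The twelve families of
  hinges, indices being read modulo 7, are the 84 edges of the Klein map.
\<close>

theorem klein_map_labelling:
  assumes "{s, x, y} \<in> K"
  obtains a b c :: "nat \<Rightarrow> 'v" and p q where
    "\<And>i. a (i+7) = a i" "\<And>i. b (i+7) = b i" "\<And>i. c (i+7) = c i"
    "\<And>i. hinge s (a (i+1)) (a i) (a (i+2))"
    "\<And>i. hinge (a i) (a (i+1)) s (b i)"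
    "\<And>i. hinge (a i) (b i) (a (i+1)) (c i)"
    "\<And>i. hinge (a (i+3)) (b (i+2)) (a (i+2)) (c i)"
    "\<And>i. hinge (b (i+2)) (c i) (a (i+3)) (b i)"
    "\<And>i. hinge (c i) (b i) (b (i+2)) (a i)"
    "\<And>i. hinge (a (i+3)) (c i) (b (i+2)) (c (i+3))"
    "\<And>i. hinge (a (i+3)) (c (i+3)) (c i) (b (i+3))"
    "\<And>i. hinge (b i) (b (i+2)) (c i) q"
    "\<And>i. hinge (b (i+2)) q (b i) (b (i+4))"
    "\<And>i. hinge (c i) (c (i+4)) (a i) p"
    "\<And>i. hinge (c (i+4)) p (c (i+1)) (c i)"
proof -
  define a where "a i = fst ((turn s ^^ i) (x, y))" for i
  have xy: "(x, y) \<in> link_flags s" using assms by (simp add: link_flags_def)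
  have a7: "a (i+7) = a i" for i
    unfolding a_def using turn_pow_7[OF xy] by (simp add: funpow_add)
  have snd: "snd ((turn s ^^ i) (x, y)) = a (i+1)" for i
    unfolding a_def by (simp add: turn_def split: prod.splits)
  have flag: "(turn s ^^ i) (x, y) = (a i, a (i+1))" for i
    using snd[of i] by (metis a_def prod.collapse)
  have oa: "{s, a i, a (i+1)} \<in> K" for i using turn_pow_in[OF xy, of i] flag by (simp add: link_flags_def)
  have H1: "hinge s (a (i+1)) (a i) (a (i+2))" for i
  proof -
    have "a (i+2) = across s (a (i+1)) (a i)" using flag[of i] flag[of "i+1"] by (simp add: turn_def)
    then show ?thesis using hinge_across[of s "a (i+1)" "a i"] oa[of i] by (simp add: insert_commute)
  qed
  define b where "b i = across (a i) (a (i+1)) s" for i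
  have H2: "hinge (a i) (a (i+1)) s (b i)" for i
    unfolding b_def by (rule hinge_across) (use oa[of i] in \<open>simp add: insert_commute\<close>)
  define c where "c i = across (a i) (b i) (a (i+1))" for i
  have H3: "hinge (a i) (b i) (a (i+1)) (c i)" for i
    unfolding c_def by (rule hinge_across) (use H2[of i] in \<open>simp add: insert_commute hinge_def\<close>)
  have b7: "b (i+7) = b i" for i using a7[of i] a7[of "i+1"] by (simp add: b_def)
  have c7: "c (i+7) = c i" for i using a7[of i] a7[of "i+1"] b7[of i] by (simp add: c_def)
  note sw = hinge_swap_ends and ss = hinge_swap_sides
  have H1': "hinge s (a (i+2)) (a (i+1)) (a (i+3))" for i using H1[of "i+1"] by (simp add: eval_nat_numeral)
  have H2': "hinge (a (i+2)) (a (i+3)) s (b (i+2))" for i using H2[of "i+2"] by (simp add: eval_nat_numeral)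
  note P = petrie_octagon[OF sw[OF ss[OF H3]] ss[OF H2] sw[OF H1] H1' H2']
  have L: "hinge (a (i+3)) (c i) (b (i+2)) (c (i+3))" "hinge (a (i+3)) (c (i+3)) (c i) (b (i+3))" for i
  proof -
    have "hinge (a (i+3)) (a (i+4)) (b (i+3)) s" "hinge (a (i+3)) s (a (i+4)) (a (i+2))"
      using ss[OF H2[of "i+3"]] sw[OF ss[OF H1[of "i+2"]]] by (simp_all add: eval_nat_numeral)
    moreover have "hinge (a (i+3)) (b (i+3)) (c (i+3)) (a (i+4))"
      using ss[OF H3[of "i+3"]] by (simp add: eval_nat_numeral)
    moreover note sw[OF H2'[of i]]  P(1)[of i]
    ultimately show "hinge (a (i+3)) (c i) (b (i+2)) (c (i+3))" "hinge (a (i+3)) (c (i+3)) (c i) (b (i+3))"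
      using link_closes[of "a (i+3)" "b (i+3)" "c (i+3)" "a (i+4)" s "a (i+2)" "b (i+2)" "c i"] by blast+
  qed
  define q where "q i = across (b i) (b (i+2)) (c i)" for i
  have Q: "hinge (b i) (b (i+2)) (c i) (q i)" for i
    unfolding q_def by (rule hinge_across) (use P(2)[of i] in \<open>simp add: insert_commute hinge_def\<close>)
  have Q2: "hinge (b (i+2)) (b i) (c i) (q (i+2))" "hinge (b (i+2)) (q (i+2)) (b i) (b (i+4))" for i
  proof -
    have "hinge (b (i+2)) (b (i+4)) (q (i+2)) (c (i+2))" "hinge (b (i+2)) (c (i+2)) (b (i+4)) (a (i+2))"
      "hinge (b (i+2)) (a (i+2)) (c (i+2)) (a (i+3))"
      using ss[OF Q[of "i+2"]] sw[OF P(3)[of "i+2"]] sw[OF ss[OF H3[of "i+2"]]] by (simp_all add: eval_nat_numeral)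
    note h = this sw[OF P(1)[of i]] P(2)[of i]
    show "hinge (b (i+2)) (b i) (c i) (q (i+2))" "hinge (b (i+2)) (q (i+2)) (b i) (b (i+4))"
      using link_closes[OF h] by blast+
  qed
  from Q2(1) have q2: "q (i+2) = q i" for i using Q hinge_unique hinge_swap_ends by blast
  have q7: "q (i+7) = q i" for i using b7[of i] b7[of "i+2"] c7[of i] by (simp add: q_def)
  \<comment> \<open>Both periods used below, 2 and 4, are invertible modulo 7.\<close>
  have const: "g i = g 0" if g7: "\<And>i. g (i+7) = g i" and gm: "\<And>i. g (i+m) = g i" and m: "k * m = 7 * l + 1"
    for g :: "nat \<Rightarrow> 'v" and i k m l
  proof -
    have mult: "g (j + n * d) = g j" if "\<And>i. g (i+d) = g i" for j n d
    proof (induction n)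
      case (Suc n)
      have "g (j + n * d + d) = g (j + n * d)" using that .
      then show ?case using Suc by (simp add: algebra_simps)
    qed simp
    have "0 + (i * k) * m = i * (k * m)" by simp
    also have "\<dots> = i + (i * l) * 7" unfolding m by (simp add: algebra_simps)
    finally have "0 + (i * k) * m = i + (i * l) * 7" .
    then show ?thesis using mult[OF gm, of 0 "i * k"] mult[OF g7, of i "i * l"] by metis
  qed
  have qq: "q i = q 0" for i by (rule const[OF q7 q2, of 4 1]) simp
  define r where "r i = across (c i) (c (i+4)) (a i)" for i
  have acc: "{a i, c i, c (i+4)} \<in> K" for i
    using L(2)[of "i+4"] a7[of i] c7[of i] by (auto simp: hinge_def insert_commute eval_nat_numeral)
  have R: "hinge (c i) (c (i+4)) (a i) (r i)" for i
    unfolding r_def by (rule hinge_across) (use acc[of i] in \<open>simp add: insert_commute\<close>)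
  have R2: "hinge (c (i+4)) (c (i+8)) (a (i+4)) (r i)" "hinge (c (i+4)) (r i) (c (i+8)) (c i)" for i
  proof -
    have 1: "hinge (c (i+4)) (c i) (r i) (a i)" using sw[OF ss[OF R[of i]]] .
    have 2: "hinge (c (i+4)) (a i) (c i) (b (i+6))"
      using ss[OF sw[OF L(1)[of "i+4"]]] a7[of i] c7[of i] by (simp add: eval_nat_numeral)
    have 3: "hinge (c (i+4)) (b (i+6)) (a i) (b (i+4))"
      using sw[OF P(2)[of "i+4"]] a7[of i] by (simp add: eval_nat_numeral)
    have 4: "hinge (c (i+4)) (b (i+4)) (b (i+6)) (a (i+4))"
      using P(3)[of "i+4"] by (simp add: eval_nat_numeral)
    have 5: "hinge (c (i+4)) (a (i+4)) (b (i+4)) (c (i+8))"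
      using sw[OF ss[OF L(2)[of "i+1"]]] c7[of "i+1"] by (simp add: eval_nat_numeral)
    show "hinge (c (i+4)) (c (i+8)) (a (i+4)) (r i)" "hinge (c (i+4)) (r i) (c (i+8)) (c i)"
      using link_closes[OF 1 2 3 4 5] by blast+
  qed
  from R2(1) have r4: "r (i+4) = r i" for i using R[of "i+4"] hinge_unique by (simp add: eval_nat_numeral)
  have r7: "r (i+7) = r i" for i using a7[of i] c7[of "i+4"] c7[of i] by (simp add: r_def)
  have rr: "r i = r 0" for i by (rule const[OF r7 r4, of 2 1]) simp
  show ?thesis
  proof (rule that[of a b c "q 0" "r 0"])
    fix i
    show "hinge (b i) (b (i+2)) (c i) (q 0)" "hinge (b (i+2)) (q 0) (b i) (b (i+4))"
      using Q[of i] Q2(2)[of i] qq[of i] qq[of "i+2"] by simp_all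
    show "hinge (c i) (c (i+4)) (a i) (r 0)" "hinge (c (i+4)) (r 0) (c (i+1)) (c i)"
      using R[of i] R2(2)[of i] rr[of i] c7[of "i+1"] by (simp_all add: eval_nat_numeral)
  qed (fact a7 b7 c7 H1 H2 H3 P L)+
qed

end

section \<open>The face-centred cubic lattice\<close>

definition fcc_roots :: "(int \<times> int \<times> int) list" where
  "fcc_roots = [(1, 1, 0), (1, -1, 0), (-1, 1, 0), (-1, -1, 0), (1, 0, 1), (1, 0, -1),
     (-1, 0, 1), (-1, 0, -1), (0, 1, 1), (0, 1, -1), (0, -1, 1), (0, -1, -1)]"

definition lattice_pt :: "int \<times> int \<times> int \<Rightarrow> real^3" where
  "lattice_pt = (\<lambda>(a, b, c). vector [real_of_int a, real_of_int b, real_of_int c])"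

lemma lattice_pt_add: "lattice_pt (x + y) = lattice_pt x + lattice_pt y"
  by (cases x; cases y) (simp add: lattice_pt_def vec_eq_iff forall_3 plus_vec_def vector_3)

lemma norm_root: "d \<in> set fcc_roots \<Longrightarrow> norm (lattice_pt d) = sqrt 2"
  by (auto simp: fcc_roots_def lattice_pt_def norm_eq_sqrt_inner inner_vec_def sum_3 vector_3)

text \<open>
  For a point \<open>P\<close> in a cone over an edge of the cuboctahedron, the coefficient of \<open>P\<close> at the vertex \<open>(a, b, c)\<close>;
  it vanishes unless that vertex is an end of the edge.  If \<open>c = 0\<close>, say, and the signs agree, it is
  \<open>(\<bar>x\<bar> + \<bar>y\<bar> - \<bar>z\<bar>) / 2\<close>.  Since it depends on \<open>P\<close> alone, different edge cones meet only in common faces.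
\<close>

definition root_coord :: "int \<times> int \<times> int \<Rightarrow> real \<Rightarrow> real \<Rightarrow> real \<Rightarrow> real" where
  "root_coord = (\<lambda>(a, b, c) x y z.
     if of_int a * x \<ge> 0 \<and> of_int b * y \<ge> 0 \<and> of_int c * z \<ge> 0
     then ((2 * of_int \<bar>a\<bar> - 1) * \<bar>x\<bar> + (2 * of_int \<bar>b\<bar> - 1) * \<bar>y\<bar> + (2 * of_int \<bar>c\<bar> - 1) * \<bar>z\<bar>) / 2 else 0)"

lemma fcc_roots_cases:
  assumes "d \<in> set fcc_roots"
  obtains "d = (1, 1, 0)"
    | "d = (1, -1, 0)"
    | "d = (-1, 1, 0)"
    | "d = (-1, -1, 0)"
    | "d = (1, 0, 1)"
    | "d = (1, 0, -1)"
    | "d = (-1, 0, 1)"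
    | "d = (-1, 0, -1)"
    | "d = (0, 1, 1)"
    | "d = (0, 1, -1)"
    | "d = (0, -1, 1)"
    | "d = (0, -1, -1)"
  using assms unfolding fcc_roots_def by (simp only: list.set insert_iff empty_iff simp_thms) blast

definition root_coord_correct :: "real \<Rightarrow> real \<Rightarrow> int \<times> int \<times> int \<Rightarrow> int \<times> int \<times> int \<Rightarrow> int \<times> int \<times> int \<Rightarrow> bool" where
  "root_coord_correct s t = (\<lambda>(x, y, z) (x', y', z') d.
     root_coord d (s * of_int x + t * of_int x') (s * of_int y + t * of_int y') (s * of_int z + t * of_int z')
      = (if d = (x, y, z) then s else if d = (x', y', z') then t else 0))"

text \<open>
  There are 48 ordered pairs of adjacent vertices of the cuboctahedron and 12 choices of \<open>d\<close>.
\<close>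

lemma root_coord_correct:
  assumes d: "d1 \<in> set fcc_roots" "d2 \<in> set fcc_roots" and adj: "d2 - d1 \<in> set fcc_roots"
    and e: "d \<in> set fcc_roots" and st: "s \<ge> 0" "t \<ge> 0"
  shows "root_coord_correct s t d1 d2 d"
  by (rule fcc_roots_cases[OF d(1)]; rule fcc_roots_cases[OF d(2)];
      ((use adj in \<open>simp add: fcc_roots_def zero_prod_def\<close>; fail) |
       (rule fcc_roots_cases[OF e]; use st in \<open>simp add: root_coord_correct_def root_coord_def abs_if\<close>)))

lemma root_coord_combination:
  assumes "d1 \<in> set fcc_roots" "d2 \<in> set fcc_roots" "d2 - d1 \<in> set fcc_roots" "d \<in> set fcc_roots"
    and "s \<ge> 0" "t \<ge> 0" and P: "P = s *\<^sub>R lattice_pt d1 + t *\<^sub>R lattice_pt d2"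
  shows "root_coord d (vec_nth P 1) (vec_nth P 2) (vec_nth P 3) = (if d = d1 then s else if d = d2 then t else 0)"
  using root_coord_correct[OF assms(1-6)]
  by (cases d1; cases d2) (simp add: root_coord_correct_def P lattice_pt_def vector_3)

lemma zero_not_root: "(0 :: int \<times> int \<times> int) \<notin> set fcc_roots"
  by (simp add: fcc_roots_def zero_prod_def)

lemma triple_through:
  assumes "card \<tau> = 3" "i \<in> \<tau>" obtains j k where "\<tau> = {i, j, k}" "distinct [i, j, k]"
proof -
  have "card (\<tau> - {i}) = 2" using assms by (simp add: card_Diff_singleton_if)
  then obtain j k where "\<tau> - {i} = {j, k}" "j \<noteq> k" by (auto simp: card_2_iff)
  then show ?thesis using that[of j k] assms(2) by auto
qed

section \<open>Coverings developed into the lattice\<close>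

text \<open>
  Shortest vectors as values make the developed triangles equilateral, and distinct values at a vertex make
  the development locally injective there.  The last condition makes the complex connected.
\<close>

locale fcc_cocycle =
  fixes K :: "nat set set" and e :: "nat \<Rightarrow> nat \<Rightarrow> int \<times> int \<times> int"
  assumes card_triangle: "\<tau> \<in> K \<Longrightarrow> card \<tau> = 3"
    and cocycle: "\<lbrakk>\<tau> \<in> K; i \<in> \<tau>; j \<in> \<tau>; k \<in> \<tau>\<rbrakk> \<Longrightarrow> e i j + e j k = e i k"
    and root: "\<lbrakk>\<tau> \<in> K; i \<in> \<tau>; j \<in> \<tau>; i \<noteq> j\<rbrakk> \<Longrightarrow> e i j \<in> set fcc_roots"
    and inj_link: "\<lbrakk>\<tau> \<in> K; \<tau>' \<in> K; {i, j} \<subseteq> \<tau>; {i, k} \<subseteq> \<tau>'; i \<noteq> j; i \<noteq> k; e i j = e i k\<rbrakk> \<Longrightarrow> j = k"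
    and card_star: "i \<in> \<Union>K \<Longrightarrow> card {\<tau> \<in> K. i \<in> \<tau>} = 7"
    and base: "0 \<in> \<Union>K"
    and connected: "i \<in> \<Union>K \<Longrightarrow> i \<noteq> 0 \<Longrightarrow> \<exists>j<i. \<exists>\<tau>\<in>K. {i, j} \<subseteq> \<tau>"
begin

lemma e_self: "i \<in> \<Union>K \<Longrightarrow> e i i = 0"
  using cocycle[of _ i i i] by (metis UnionE add_cancel_right_right)

text \<open>
  The vertices of the component of \<open>(0, 0)\<close> in the covering defined by the cocycle.
\<close>

inductive_set reach :: "(nat \<times> int \<times> int \<times> int) set" where
  reach_base: "(0, 0) \<in> reach"
| reach_step: "\<lbrakk>(i, x) \<in> reach; \<tau> \<in> K; i \<in> \<tau>; j \<in> \<tau>\<rbrakk> \<Longrightarrow> (j, x + e i j) \<in> reach"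

definition site :: "nat \<times> int \<times> int \<times> int \<Rightarrow> nat" where "site = to_nat"
definition label :: "nat \<Rightarrow> nat" where "label v = fst (from_nat v :: nat \<times> int \<times> int \<times> int)"
definition place :: "nat \<Rightarrow> int \<times> int \<times> int" where "place v = snd (from_nat v :: nat \<times> int \<times> int \<times> int)"

lemma label_site [simp]: "label (site (i, x)) = i"
  and place_site [simp]: "place (site (i, x)) = x"
  by (simp_all add: label_def place_def site_def)

lemma site_inject [simp]: "site z = site z' \<longleftrightarrow> z = z'"
  by (simp add: site_def)

text \<open>
  The triangle above \<open>\<tau>\<close> that has \<open>(i, x)\<close> as a vertex.
\<close>

definition lift :: "nat set \<Rightarrow> nat \<Rightarrow> int \<times> int \<times> int \<Rightarrow> nat set" where
  "lift \<tau> i x = (\<lambda>j. site (j, x + e i j)) ` \<tau>"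

definition cover :: "nat set set" where
  "cover = {lift \<tau> i x | \<tau> i x. \<tau> \<in> K \<and> i \<in> \<tau> \<and> (i, x) \<in> reach}"

lemma lift_in_cover: "\<tau> \<in> K \<Longrightarrow> i \<in> \<tau> \<Longrightarrow> (i, x) \<in> reach \<Longrightarrow> lift \<tau> i x \<in> cover"
  unfolding cover_def by blast

text \<open>
  Here the cocycle condition enters: a lifted triangle may be based at any of its vertices.
\<close>

lemma lift_change_base:
  assumes "\<tau> \<in> K" "i \<in> \<tau>" "j \<in> \<tau>" shows "lift \<tau> j (x + e i j) = lift \<tau> i x"
  unfolding lift_def using cocycle[OF assms] by (intro image_cong) (auto simp: add.assoc)

lemma label_image_lift: "label ` lift \<tau> i x = \<tau>"
  by (simp add: lift_def image_image)

lemma site_in_lift: "\<tau> \<in> K \<Longrightarrow> i \<in> \<tau> \<Longrightarrow> site (i, x) \<in> lift \<tau> i x"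
  using e_self[of i] by (force simp: lift_def)

lemma card_lift: "\<tau> \<in> K \<Longrightarrow> card (lift \<tau> i x) = 3"
  using card_triangle card_image[of "\<lambda>j. site (j, x + e i j)" \<tau>] by (simp add: lift_def inj_on_def)

lemma vertex_of_cover:
  assumes "v \<in> \<Union>cover" obtains i x where "v = site (i, x)" "(i, x) \<in> reach" "i \<in> \<Union>K"
proof -
  obtain \<tau> i x where \<tau>: "\<tau> \<in> K" "i \<in> \<tau>" "(i, x) \<in> reach" "v \<in> lift \<tau> i x" using assms by (auto simp: cover_def)
  then obtain j where "j \<in> \<tau>" "v = site (j, x + e i j)" by (auto simp: lift_def)
  then show ?thesis using that reach_step[OF \<tau>(3,1,2)] \<tau>(1) by blast
qed

text \<open>
  All lifted triangles at \<open>(i, x)\<close> can be based there, so the star of \<open>(i, x)\<close> is a copy of the star of \<open>i\<close>.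
\<close>

lemma star_of_site:
  assumes "i \<in> \<Union>K" "(i, x) \<in> reach"
  shows "{t \<in> cover. site (i, x) \<in> t} = (\<lambda>\<tau>. lift \<tau> i x) ` {\<tau> \<in> K. i \<in> \<tau>}"
proof
  show "{t \<in> cover. site (i, x) \<in> t} \<subseteq> (\<lambda>\<tau>. lift \<tau> i x) ` {\<tau> \<in> K. i \<in> \<tau>}"
  proof
    fix t assume "t \<in> {t \<in> cover. site (i, x) \<in> t}"
    then obtain \<tau> j y where t: "t = lift \<tau> j y" "\<tau> \<in> K" "j \<in> \<tau>" "site (i, x) \<in> t" by (auto simp: cover_def)
    then have ix: "i \<in> \<tau>" "x = y + e j i" by (auto simp: lift_def)
    have "t = lift \<tau> i x" using lift_change_base[OF t(2,3) ix(1), of y] t(1) ix(2) by simp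
    then show "t \<in> (\<lambda>\<tau>. lift \<tau> i x) ` {\<tau> \<in> K. i \<in> \<tau>}" using t(2) ix(1) by blast
  qed
  show "(\<lambda>\<tau>. lift \<tau> i x) ` {\<tau> \<in> K. i \<in> \<tau>} \<subseteq> {t \<in> cover. site (i, x) \<in> t}"
    using assms site_in_lift lift_in_cover by blast
qed

lemma closed_star_of_site:
  assumes "i \<in> \<Union>K" "(i, x) \<in> reach" "w \<in> \<Union>{t \<in> cover. site (i, x) \<in> t}"
  shows "w = site (label w, x + e i (label w))"
proof -
  obtain \<tau> where "w \<in> lift \<tau> i x" using assms(3) unfolding star_of_site[OF assms(1,2)] by blast
  then show ?thesis by (auto simp: lift_def)
qed

lemma reach_all_labels: "i \<in> \<Union>K \<Longrightarrow> \<exists>x. (i, x) \<in> reach"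
proof (induction i rule: less_induct)
  case (less i)
  show ?case
  proof (cases "i = 0")
    case False
    then obtain j \<tau> where j: "j < i" "\<tau> \<in> K" "i \<in> \<tau>" "j \<in> \<tau>" using connected[OF less.prems] by blast
    then obtain x where "(j, x) \<in> reach" using less.IH[of j] by blast
    then show ?thesis using reach_step[of j x \<tau> i] j by blast
  qed (use reach_base in blast)
qed

lemma star_bijective: "star_bijective_map label cover K"
proof
  show "finite t" if "t \<in> cover" for t
    using that card_lift by (auto simp: cover_def intro!: card_ge_0_finite)
  show "finite \<tau>" if "\<tau> \<in> K" for \<tau> using card_triangle[OF that] by (intro card_ge_0_finite) simp
  show "label ` t \<in> K" if "t \<in> cover" for t
    using that by (auto simp: cover_def label_image_lift)
  show "inj_on label (\<Union>{t \<in> cover. v \<in> t})" if v: "v \<in> \<Union>cover" for v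
  proof -
    obtain i x where ix: "v = site (i, x)" "(i, x) \<in> reach" "i \<in> \<Union>K" using vertex_of_cover[OF v] .
    show ?thesis unfolding ix(1) by (rule inj_onI) (metis closed_star_of_site[OF ix(3,2)])
  qed
  show "\<exists>t\<in>cover. v \<in> t \<and> label ` t = \<tau>" if v: "v \<in> \<Union>cover" and \<tau>: "\<tau> \<in> K" "label v \<in> \<tau>" for v \<tau>
  proof -
    obtain i x where ix: "v = site (i, x)" "(i, x) \<in> reach" "i \<in> \<Union>K" using vertex_of_cover[OF v] .
    then have "lift \<tau> i x \<in> cover" "v \<in> lift \<tau> i x"
      using \<tau> site_in_lift[of \<tau> i x] lift_in_cover[of \<tau> i x] by simp_all
    then show ?thesis using label_image_lift by blast
  qed
  show "label ` \<Union>cover = \<Union>K"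
  proof
    show "label ` \<Union>cover \<subseteq> \<Union>K"
    proof
      fix i assume "i \<in> label ` \<Union>cover"
      then obtain v where "v \<in> \<Union>cover" "i = label v" by blast
      then show "i \<in> \<Union>K" using vertex_of_cover by (metis label_site)
    qed
    show "\<Union>K \<subseteq> label ` \<Union>cover"
    proof
      fix i assume i: "i \<in> \<Union>K"
      then obtain \<tau> x where "\<tau> \<in> K" "i \<in> \<tau>" "(i, x) \<in> reach" using reach_all_labels by blast
      then have "lift \<tau> i x \<in> cover" "site (i, x) \<in> lift \<tau> i x" using site_in_lift lift_in_cover by blast+
      then show "i \<in> label ` \<Union>cover" by (metis UnionI image_eqI label_site)
    qed
  qed
qed

sublocale star_bijective_map label cover K by (rule star_bijective)

lemma cover_degree: "triangle_degree_seven cover"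
  unfolding triangle_degree_seven_def
proof
  fix v assume "v \<in> \<Union>cover"
  then obtain i x where ix: "v = site (i, x)" "(i, x) \<in> reach" "i \<in> \<Union>K" using vertex_of_cover by blast
  have "inj_on (\<lambda>\<tau>. lift \<tau> i x) {\<tau> \<in> K. i \<in> \<tau>}" by (rule inj_onI) (metis label_image_lift)
  then show "card {t \<in> cover. v \<in> t} = 7"
    unfolding ix(1) star_of_site[OF ix(3,2)] using card_star[OF ix(3)] by (simp add: card_image)
qed

lemma finite_star: "finite {t \<in> cover. v \<in> t}"
proof (cases "v \<in> \<Union>cover")
  case True
  then have "card {t \<in> cover. v \<in> t} = 7" using cover_degree unfolding triangle_degree_seven_def by blast
  then show ?thesis by (intro card_ge_0_finite) simp
next
  case False
  then have "{t \<in> cover. v \<in> t} = {}" by blast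
  then show ?thesis by (simp only: finite.emptyI)
qed

lemma card_cover_triangle: "t \<in> cover \<Longrightarrow> card t = 3"
  using card_lift by (auto simp: cover_def)

lemma reach_translate:
  assumes "(0, h) \<in> reach" "(i, x) \<in> reach" shows "(i, h + x) \<in> reach"
  using assms(2)
proof (induction rule: reach.induct)
  case (reach_step i x \<tau> j)
  then show ?case using reach.reach_step[of i "h + x" \<tau> j] by (simp add: add.assoc)
qed (use assms(1) in simp)

text \<open>
  The translates of \<open>(0, 0)\<close> by all multiples of a nonzero period \<open>h\<close> lie in the component.
\<close>

lemma infinite_cover:
  assumes h: "(0, h) \<in> reach" "h \<noteq> 0"
  shows "infinite cover"
proof
  assume fin: "finite cover"
  \<comment> \<open>\<open>m n\<close> is the multiple \<open>n h\<close>.\<close>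
  define m where "m n = (int n * fst h, int n * fst (snd h), int n * snd (snd h))" for n
  have m: "(0, m n) \<in> reach" for n
  proof (induction n)
    case 0
    show ?case using reach_base by (simp add: m_def zero_prod_def)
  next
    case (Suc n)
    have "m (Suc n) = h + m n" by (cases h) (simp add: m_def algebra_simps)
    then show ?case using reach_translate[OF h(1) Suc] by simp
  qed
  have "inj m" using h(2) by (cases h) (auto simp: inj_def m_def zero_prod_def)
  then have "infinite (range (\<lambda>n. site (0, m n)))" by (intro range_inj_infinite) (auto simp: inj_def)
  moreover have "range (\<lambda>n. site (0, m n)) \<subseteq> \<Union>cover"
    using base m site_in_lift unfolding cover_def by blast
  moreover have "finite (\<Union>cover)" using fin star_bijective_map.fin[OF star_bijective] by blast
  ultimately show False using finite_subset by blast
qed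

lemma connected_realization_cover: "connected (realization cover)"
proof -
  let ?X = "realization cover" and ?b = "vertex_pt (site (0, 0))"
  have tri: "connected_component ?X y z" if "t \<in> cover" "y \<in> simplex_of t" "z \<in> simplex_of t" for t y z
    unfolding connected_component_def
    using that simplex_of_triangle_compact_connected(2)[OF card_cover_triangle] by (auto simp: realization_def)
  have vert: "connected_component ?X ?b (vertex_pt (site (i, x)))" if "(i, x) \<in> reach" for i x
    using that
  proof (induction rule: reach.induct)
    case reach_base
    obtain \<tau> where "\<tau> \<in> K" "0 \<in> \<tau>" using base by blast
    then have "lift \<tau> 0 0 \<in> cover" "site (0, 0) \<in> lift \<tau> 0 0"
      using reach.reach_base site_in_lift lift_in_cover by blast+
    then show ?case using tri vertex_pt_in_simplex fin by blast
  next
    case (reach_step i x \<tau> j)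
    have "lift \<tau> i x \<in> cover" "site (i, x) \<in> lift \<tau> i x" "site (j, x + e i j) \<in> lift \<tau> i x"
      using lift_in_cover[OF reach_step.hyps(2,3,1)] site_in_lift[OF reach_step.hyps(2,3)] reach_step.hyps(4)
      by (auto simp: lift_def)
    then show ?case using tri vertex_pt_in_simplex fin reach_step.IH by (meson connected_component_trans)
  qed
  have "connected_component ?X ?b y" if "y \<in> ?X" for y
  proof -
    obtain t where t: "t \<in> cover" "y \<in> simplex_of t" using \<open>y \<in> ?X\<close> by (auto simp: realization_def)
    then obtain v where v: "v \<in> t" using simplex_of_pos by blast
    then obtain i x where "v = site (i, x)" "(i, x) \<in> reach" using vertex_of_cover t by (metis UnionI)
    then show ?thesis using vert tri[OF t(1)] vertex_pt_in_simplex[OF fin[OF t(1)] v] t(2)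
      by (metis connected_component_trans)
  qed
  then show ?thesis
    unfolding connected_iff_connected_component by (meson connected_component_sym connected_component_trans)
qed

definition develop :: "(nat \<Rightarrow> real) \<Rightarrow> real^3" where
  "develop x = (\<Sum>v | x v \<noteq> 0. x v *\<^sub>R lattice_pt (place v))"

lemma develop_simplex:
  assumes "finite s" "x \<in> simplex_of s"
  shows "develop x = (\<Sum>v\<in>s. x v *\<^sub>R lattice_pt (place v))"
  unfolding develop_def
  by (rule sum.mono_neutral_left) (use assms simplex_of_support in auto)

lemma develop_vertex: "develop (vertex_pt v) = lattice_pt (place v)"
  using develop_simplex[of "{v}" "vertex_pt v"] by (simp add: simplex_of_singleton vertex_pt_def)

lemma develop_continuous: "continuous_on (realization cover) develop"
proof (rule continuous_on_relative_open_cover)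
  fix x assume "x \<in> realization cover"
  then obtain v where v: "x \<in> open_star v" using realization_open_star by blast
  have fs: "finite (star v)" unfolding star_def using finite_star fin by blast
  have "continuous_on (open_star v) develop"
  proof (rule continuous_on_eq)
    show "continuous_on (open_star v) (\<lambda>x. \<Sum>w\<in>star v. x w *\<^sub>R lattice_pt (place w))"
      by (intro continuous_intros)
    fix y assume y: "y \<in> open_star v"
    then obtain t where t: "t \<in> cover" "v \<in> t" "y \<in> simplex_of t" using open_star_simplex by blast
    then have "t \<subseteq> star v" by (auto simp: star_def)
    then have "y \<in> simplex_of (star v)" using simplex_of_mono[OF fs] t by blast
    then show "(\<Sum>w\<in>star v. y w *\<^sub>R lattice_pt (place w)) = develop y"
      using develop_simplex[OF fs] by simp
  qed
  then show "\<exists>G. open G \<and> x \<in> G \<and> continuous_on (realization cover \<inter> G) develop"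
    using v open_coordinate_pos[of v] unfolding open_star_def by blast
qed

text \<open>
  The coordinates of a point of the closed star of \<open>v\<close>, except the one at \<open>v\<close>, are recovered from its image
  by \<open>root_coord\<close>, since the vectors from \<open>v\<close> to its neighbours are distinct; the coordinate at \<open>v\<close> is determined
  by the sum.
\<close>

lemma develop_inj_on_star:
  assumes t: "t \<in> cover" "v \<in> t" "x \<in> simplex_of t" and t': "t' \<in> cover" "v \<in> t'" "y \<in> simplex_of t'"
    and eq: "develop x = develop y"
  shows "x = y"
proof -
  have "v \<in> \<Union>cover" using t by blast
  then obtain i p where ip: "v = site (i, p)" "(i, p) \<in> reach" "i \<in> \<Union>K" using vertex_of_cover by blast
  define P where "P = develop x - lattice_pt p"
  have coord: "z (site (l, p + e i l)) = root_coord (e i l) (vec_nth P 1) (vec_nth P 2) (vec_nth P 3)"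
    if s: "s \<in> cover" "v \<in> s" "z \<in> simplex_of s" and z: "develop z = develop x" and l: "\<sigma> \<in> K" "{i, l} \<subseteq> \<sigma>" "l \<noteq> i"
    for s z l \<sigma>
  proof -
    have "s \<in> {t \<in> cover. site (i, p) \<in> t}" using s ip(1) by blast
    then obtain \<tau> where \<tau>: "\<tau> \<in> K" "i \<in> \<tau>" "s = lift \<tau> i p" unfolding star_of_site[OF ip(3,2)] by blast
    obtain j k where jk: "\<tau> = {i, j, k}" "distinct [i, j, k]" using triple_through[OF card_triangle[OF \<tau>(1)] \<tau>(2)] .
    have sjk: "s = {site (i, p), site (j, p + e i j), site (k, p + e i k)}"
      using \<tau>(3) jk(1) e_self[OF ip(3)] by (simp add: lift_def)
    have sum: "z (site (i, p)) + z (site (j, p + e i j)) + z (site (k, p + e i k)) = 1"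
      using simplex_of_sum[OF s(3)] jk(2) unfolding sjk by (simp add: add.assoc)
    have "develop z = (\<Sum>w\<in>s. z w *\<^sub>R lattice_pt (place w))" using develop_simplex[OF fin s(3)] s(1) by blast
    also have "\<dots> = z (site (i, p)) *\<^sub>R lattice_pt p + z (site (j, p + e i j)) *\<^sub>R (lattice_pt p + lattice_pt (e i j))
        + z (site (k, p + e i k)) *\<^sub>R (lattice_pt p + lattice_pt (e i k))"
      unfolding sjk using jk(2) by (simp add: lattice_pt_add add.assoc)
    also have "\<dots> = (z (site (i, p)) + z (site (j, p + e i j)) + z (site (k, p + e i k))) *\<^sub>R lattice_pt p +
        (z (site (j, p + e i j)) *\<^sub>R lattice_pt (e i j) + z (site (k, p + e i k)) *\<^sub>R lattice_pt (e i k))"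
      by (simp add: algebra_simps)
    finally have P: "P = z (site (j, p + e i j)) *\<^sub>R lattice_pt (e i j) + z (site (k, p + e i k)) *\<^sub>R lattice_pt (e i k)"
      unfolding P_def using sum z by simp
    have r: "e i j \<in> set fcc_roots" "e i k \<in> set fcc_roots" "e j k \<in> set fcc_roots" "e i l \<in> set fcc_roots"
      using root[OF \<tau>(1)] root[OF l(1)] jk l by auto
    have "e i k - e i j = e j k" using cocycle[OF \<tau>(1), of i j k] jk(1) by (simp add: algebra_simps)
    then have rc: "root_coord (e i l) (vec_nth P 1) (vec_nth P 2) (vec_nth P 3) =
       (if e i l = e i j then z (site (j, p + e i j)) else if e i l = e i k then z (site (k, p + e i k)) else 0)"
      using root_coord_combination[OF r(1,2) _ r(4) _ _ P] r(3) simplex_of_nonneg[OF s(3)] by simp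
    have jl: "e i l = e i j \<longleftrightarrow> l = j" "e i l = e i k \<longleftrightarrow> l = k"
      using inj_link[OF l(1) \<tau>(1), of i l] l jk by auto
    show ?thesis
    proof (cases "l = j \<or> l = k")
      case True
      then show ?thesis using rc jl by auto
    next
      case False
      then have "site (l, p + e i l) \<notin> s" using l(3) unfolding sjk by simp
      then show ?thesis using rc jl False simplex_of_support[OF s(3)] by auto
    qed
  qed
  have other: "x w = y w" if w: "w \<noteq> v" for w
  proof (cases "w \<in> t \<union> t'")
    case True
    then have ws: "w \<in> \<Union>{t \<in> cover. site (i, p) \<in> t}" using t t' ip(1) by blast
    then have we: "w = site (label w, p + e i (label w))" by (rule closed_star_of_site[OF ip(3,2)])
    from ws obtain \<sigma> where \<sigma>: "\<sigma> \<in> K" "i \<in> \<sigma>" "w \<in> lift \<sigma> i p" unfolding star_of_site[OF ip(3,2)] by blast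
    then have "label w \<in> \<sigma>" using label_image_lift by blast
    moreover have "label w \<noteq> i" using we w ip(1) e_self[OF ip(3)] by auto
    ultimately show ?thesis
      using coord[OF t refl \<sigma>(1), of "label w"] coord[OF t' eq[symmetric] \<sigma>(1), of "label w"] \<sigma>(2) we by simp
  next
    case False
    then show ?thesis using t(3) t'(3) by (simp add: simplex_of_def)
  qed
  have "x v = y v"
  proof -
    have ft: "finite t" "finite t'" using t t' fin by auto
    have "x v + sum x (t - {v}) = 1" "y v + sum y (t' - {v}) = 1"
      using simplex_of_sum[OF t(3)] simplex_of_sum[OF t'(3)] t(2) t'(2) ft by (simp_all add: sum.remove)
    moreover have "sum x (t - {v}) = sum y (t' - {v})"
    proof -
      have "sum x (t - {v}) = sum x ((t \<union> t') - {v})"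
        by (rule sum.mono_neutral_left) (use ft simplex_of_support[OF t(3)] in blast)+
      also have "\<dots> = sum y ((t \<union> t') - {v})" by (rule sum.cong) (use other in auto)
      also have "\<dots> = sum y (t' - {v})"
        by (rule sum.mono_neutral_right) (use ft simplex_of_support[OF t'(3)] in blast)+
      finally show ?thesis .
    qed
    ultimately show ?thesis by linarith
  qed
  then show ?thesis using other by (metis ext)
qed

lemma immersion_develop: "immersion3 cover develop"
  unfolding immersion3_def
proof (intro conjI ballI)
  show "continuous_on (realization cover) develop" by (rule develop_continuous)
  fix t assume t: "t \<in> cover"
  show "develop x = (\<Sum>v\<in>t. x v *\<^sub>R develop (vertex_pt v))" if "x \<in> simplex_of t" for x
    using develop_simplex[OF fin[OF t] that] by (simp add: develop_vertex)
  show "inj_on develop (simplex_of t)"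
  proof -
    obtain v where "v \<in> t" using card_cover_triangle[OF t] by fastforce
    then show ?thesis using develop_inj_on_star[OF t _ _ t] by (blast intro: inj_onI)
  qed
next
  fix x assume "x \<in> realization cover"
  then obtain v where v: "x \<in> open_star v" using realization_open_star by blast
  have "openin (top_of_set (realization cover)) (open_star v)"
    by (simp add: open_star_def openin_open_Int open_coordinate_pos)
  moreover have "inj_on develop (open_star v)"
    by (rule inj_onI) (metis develop_inj_on_star open_star_simplex)
  ultimately show "\<exists>U. x \<in> U \<and> openin (top_of_set (realization cover)) U \<and> inj_on develop U" using v by blast
qed

lemma equilateral_develop: "equilateral_faces cover develop"
  unfolding equilateral_faces_def
proof (intro exI[of _ "sqrt 2"] conjI ballI)
  fix t assume t: "t \<in> cover"
  let ?P = "(\<lambda>v. lattice_pt (place v)) ` t"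
  obtain \<tau> i x where \<tau>: "t = lift \<tau> i x" "\<tau> \<in> K" "i \<in> \<tau>" "(i, x) \<in> reach" using t by (auto simp: cover_def)
  have d: "dist (lattice_pt (place v)) (lattice_pt (place w)) = sqrt 2" if "v \<in> t" "w \<in> t" "v \<noteq> w" for v w
  proof -
    obtain j k where jk: "j \<in> \<tau>" "k \<in> \<tau>" "v = site (j, x + e i j)" "w = site (k, x + e i k)"
      using \<open>v \<in> t\<close> \<open>w \<in> t\<close> \<tau>(1) by (auto simp: lift_def)
    have "x + e i j = (x + e i k) + e k j" using cocycle[OF \<tau>(2,3) jk(2,1)] by (simp add: add.assoc)
    then have "lattice_pt (place v) = lattice_pt (place w) + lattice_pt (e k j)"
      unfolding jk(3,4) place_site lattice_pt_add[symmetric] by (simp add: add.assoc)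
    moreover have "e k j \<in> set fcc_roots" using root[OF \<tau>(2) jk(2,1)] jk \<open>v \<noteq> w\<close> by auto
    ultimately show ?thesis using norm_root by (simp add: dist_norm)
  qed
  have inj: "inj_on (\<lambda>v. lattice_pt (place v)) t"
    by (rule inj_onI) (metis d dist_self real_sqrt_eq_zero_cancel_iff zero_neq_numeral)
  have "develop ` simplex_of t = (\<lambda>x. \<Sum>v\<in>t. x v *\<^sub>R lattice_pt (place v)) ` simplex_of t"
    using develop_simplex[OF fin[OF t]] by (rule image_cong[OF refl])
  also have "\<dots> = convex hull ?P" by (rule barycentric_image[OF fin[OF t] inj])
  finally have "develop ` simplex_of t = convex hull ?P" .
  moreover have "card ?P = 3" using card_image[OF inj] card_cover_triangle[OF t] by simp
  moreover have "dist p q = sqrt 2" if "p \<in> ?P" "q \<in> ?P" "p \<noteq> q" for p q using that d by blast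
  ultimately show "\<exists>P. card P = 3 \<and> (\<forall>p\<in>P. \<forall>q\<in>P. p \<noteq> q \<longrightarrow> dist p q = sqrt 2) \<and> develop ` simplex_of t = convex hull P"
    by blast
qed simp

end

section \<open>A lattice-valued cocycle on the Klein map\<close>

text \<open>
  The vertices are numbered \<open>s = 0\<close>, \<open>a i = 1 + i\<close>, \<open>b i = 8 + i\<close>, \<open>c i = 15 + i\<close> for \<open>i < 7\<close>, \<open>p = 22\<close> and \<open>q = 23\<close>
  in the notation of \<open>klein_map_labelling\<close>.  The eight families of triangles are the orbits of the rotation of
  order 7 about \<open>s\<close>.
\<close>

definition klein_triples :: "(nat \<times> nat \<times> nat) list" where
  "klein_triples = concat (map (\<lambda>i.
     [(0, 1 + i, 1 + (i + 1) mod 7),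
      (1 + i, 1 + (i + 1) mod 7, 8 + i),
      (1 + i, 8 + i, 15 + i),
      (1 + i, 15 + i, 15 + (i + 4) mod 7),
      (1 + (i + 1) mod 7, 15 + (i + 5) mod 7, 8 + i),
      (8 + i, 15 + i, 8 + (i + 2) mod 7),
      (22, 15 + i, 15 + (i + 4) mod 7),
      (23, 8 + i, 8 + (i + 2) mod 7)]) [0, 1, 2, 3, 4, 5, 6])"

definition klein_complex :: "nat set set" where
  "klein_complex = (\<lambda>(i, j, k). {i, j, k}) ` set klein_triples"

text \<open>
  The neighbours \<open>j\<close> of the vertex \<open>i\<close> in cyclic order, each with the vector of the edge \<open>i j\<close>.  The table is a
  solution of a finite constraint problem: shortest vectors as values, sum zero around the 56 triangles, and
  distinct values at each of the 24 vertices.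
\<close>

definition edge_row :: "nat \<Rightarrow> (nat \<times> int \<times> int \<times> int) list" where
  "edge_row i = (
     if i = 0 then [(1, (0, -1, 1)), (2, (1, 0, 1)), (3, (0, 1, 1)), (4, (-1, 1, 0)), (5, (0, 1, -1)), (6, (1, 0, -1)), (7, (1, -1, 0))] else
     if i = 1 then [(0, (0, 1, -1)), (2, (1, 1, 0)), (8, (1, 0, 1)), (15, (0, -1, 1)), (19, (-1, -1, 0)), (14, (0, -1, -1)), (7, (1, 0, -1))] else
     if i = 2 then [(0, (-1, 0, -1)), (1, (-1, -1, 0)), (8, (0, -1, 1)), (20, (1, -1, 0)), (16, (1, 0, -1)), (9, (0, 1, -1)), (3, (-1, 1, 0))] else
     if i = 3 then [(0, (0, -1, -1)), (2, (1, -1, 0)), (9, (1, 0, -1)), (21, (1, 1, 0)), (17, (0, 1, 1)), (10, (-1, 1, 0)), (4, (-1, 0, -1))] else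
     if i = 4 then [(0, (1, -1, 0)), (3, (1, 0, 1)), (10, (0, 1, 1)), (15, (-1, 1, 0)), (18, (-1, 0, -1)), (11, (0, 1, -1)), (5, (1, 0, -1))] else
     if i = 5 then [(0, (0, -1, 1)), (4, (-1, 0, 1)), (11, (-1, 1, 0)), (16, (0, 1, 1)), (19, (1, 1, 0)), (12, (1, 0, -1)), (6, (1, -1, 0))] else
     if i = 6 then [(0, (-1, 0, 1)), (5, (-1, 1, 0)), (12, (0, 1, -1)), (17, (1, 0, -1)), (20, (1, 1, 0)), (13, (1, 0, 1)), (7, (0, -1, 1))] else
     if i = 7 then [(0, (-1, 1, 0)), (1, (-1, 0, 1)), (14, (-1, -1, 0)), (21, (0, -1, 1)), (18, (1, 0, 1)), (13, (1, 1, 0)), (6, (0, 1, -1))] else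
     if i = 8 then [(1, (-1, 0, -1)), (2, (0, 1, -1)), (20, (1, 0, -1)), (13, (1, -1, 0)), (23, (1, 0, 1)), (10, (0, -1, 1)), (15, (-1, -1, 0))] else
     if i = 9 then [(2, (0, -1, 1)), (3, (-1, 0, 1)), (21, (0, 1, 1)), (14, (-1, 1, 0)), (23, (-1, 0, -1)), (11, (0, -1, -1)), (16, (1, -1, 0))] else
     if i = 10 then [(3, (1, -1, 0)), (4, (0, -1, -1)), (15, (-1, 0, -1)), (8, (0, 1, -1)), (23, (1, 1, 0)), (12, (0, 1, 1)), (17, (1, 0, 1))] else
     if i = 11 then [(4, (0, -1, 1)), (5, (1, -1, 0)), (16, (1, 0, 1)), (9, (0, 1, 1)), (23, (-1, 1, 0)), (13, (-1, 0, -1)), (18, (-1, -1, 0))] else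
     if i = 12 then [(5, (-1, 0, 1)), (6, (0, -1, 1)), (17, (1, -1, 0)), (10, (0, -1, -1)), (23, (1, 0, -1)), (14, (1, 1, 0)), (19, (0, 1, 1))] else
     if i = 13 then [(6, (-1, 0, -1)), (7, (-1, -1, 0)), (18, (0, -1, 1)), (11, (1, 0, 1)), (23, (0, 1, 1)), (8, (-1, 1, 0)), (20, (0, 1, -1))] else
     if i = 14 then [(1, (0, 1, 1)), (7, (1, 1, 0)), (21, (1, 0, 1)), (9, (1, -1, 0)), (23, (0, -1, -1)), (12, (-1, -1, 0)), (19, (-1, 0, 1))] else
     if i = 15 then [(1, (0, 1, -1)), (8, (1, 1, 0)), (10, (1, 0, 1)), (4, (1, -1, 0)), (18, (0, -1, -1)), (22, (-1, -1, 0)), (19, (-1, 0, -1))] else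
     if i = 16 then [(2, (-1, 0, 1)), (9, (-1, 1, 0)), (11, (-1, 0, -1)), (5, (0, -1, -1)), (19, (1, 0, -1)), (22, (1, -1, 0)), (20, (0, -1, 1))] else
     if i = 17 then [(3, (0, -1, -1)), (10, (-1, 0, -1)), (12, (-1, 1, 0)), (6, (-1, 0, 1)), (20, (0, 1, 1)), (22, (1, 1, 0)), (21, (1, 0, -1))] else
     if i = 18 then [(4, (1, 0, 1)), (11, (1, 1, 0)), (13, (0, 1, -1)), (7, (-1, 0, -1)), (21, (-1, -1, 0)), (22, (-1, 0, 1)), (15, (0, 1, 1))] else
     if i = 19 then [(1, (1, 1, 0)), (14, (1, 0, -1)), (12, (0, -1, -1)), (5, (-1, -1, 0)), (16, (-1, 0, 1)), (22, (0, -1, 1)), (15, (1, 0, 1))] else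
     if i = 20 then [(2, (-1, 1, 0)), (8, (-1, 0, 1)), (13, (0, -1, 1)), (6, (-1, -1, 0)), (17, (0, -1, -1)), (22, (1, 0, -1)), (16, (0, 1, -1))] else
     if i = 21 then [(3, (-1, -1, 0)), (9, (0, -1, -1)), (14, (-1, 0, -1)), (7, (0, 1, -1)), (18, (1, 1, 0)), (22, (0, 1, 1)), (17, (-1, 0, 1))] else
     if i = 22 then [(15, (1, 1, 0)), (18, (1, 0, -1)), (21, (0, -1, -1)), (17, (-1, -1, 0)), (20, (-1, 0, 1)), (16, (-1, 1, 0)), (19, (0, 1, -1))] else
     if i = 23 then [(8, (-1, 0, -1)), (10, (-1, -1, 0)), (12, (-1, 0, 1)), (14, (0, 1, 1)), (9, (1, 0, 1)), (11, (1, -1, 0)), (13, (0, -1, -1))] else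
     [])"

text \<open>
  These rules decide the equations between vertex numbers and leave the entries of the table alone.
\<close>

lemmas literal_simps = if_True if_False simp_thms numeral_eq_iff num.inject num.distinct zero_neq_numeral
  numeral_neq_zero one_neq_zero zero_neq_one numeral_eq_one_iff one_eq_numeral_iff

definition edge_vector :: "nat \<Rightarrow> nat \<Rightarrow> int \<times> int \<times> int" where
  "edge_vector i j = (case map_of (edge_row i) j of None \<Rightarrow> (0, 0, 0) | Some v \<Rightarrow> v)"

lemmas edge_row_simps =
  edge_row_def[of 0, simplified literal_simps]
  edge_row_def[of 1, simplified literal_simps]
  edge_row_def[of 2, simplified literal_simps]
  edge_row_def[of 3, simplified literal_simps]
  edge_row_def[of 4, simplified literal_simps]
  edge_row_def[of 5, simplified literal_simps]
  edge_row_def[of 6, simplified literal_simps]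
  edge_row_def[of 7, simplified literal_simps]
  edge_row_def[of 8, simplified literal_simps]
  edge_row_def[of 9, simplified literal_simps]
  edge_row_def[of 10, simplified literal_simps]
  edge_row_def[of 11, simplified literal_simps]
  edge_row_def[of 12, simplified literal_simps]
  edge_row_def[of 13, simplified literal_simps]
  edge_row_def[of 14, simplified literal_simps]
  edge_row_def[of 15, simplified literal_simps]
  edge_row_def[of 16, simplified literal_simps]
  edge_row_def[of 17, simplified literal_simps]
  edge_row_def[of 18, simplified literal_simps]
  edge_row_def[of 19, simplified literal_simps]
  edge_row_def[of 20, simplified literal_simps]
  edge_row_def[of 21, simplified literal_simps]
  edge_row_def[of 22, simplified literal_simps]
  edge_row_def[of 23, simplified literal_simps]

lemma klein_triples_range:
  "list_all (\<lambda>(i, j, k). distinct [i, j, k] \<and> i < 24 \<and> j < 24 \<and> k < 24) klein_triples"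
  by (simp add: klein_triples_def del: One_nat_def)

definition cocycle_on :: "nat \<Rightarrow> nat \<Rightarrow> nat \<Rightarrow> bool" where
  "cocycle_on i j k \<longleftrightarrow>
     edge_vector i j \<in> set fcc_roots \<and> edge_vector i k \<in> set fcc_roots \<and> edge_vector j k \<in> set fcc_roots \<and>
     edge_vector i i = 0 \<and> edge_vector j j = 0 \<and> edge_vector k k = 0 \<and>
     edge_vector j i = - edge_vector i j \<and> edge_vector k j = - edge_vector j k \<and>
     edge_vector k i = - edge_vector i k \<and> edge_vector i j + edge_vector j k = edge_vector i k"

lemma klein_triples_cocycle: "list_all (\<lambda>(i, j, k). cocycle_on i j k) klein_triples"
  (* The predicate stays folded until the list is expanded: under the binder the simplifier would
     work on symbolic vertex numbers. *)
  unfolding klein_triples_def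
  by (simp del: One_nat_def) (intro conjI; simp add: cocycle_on_def edge_vector_def edge_row_simps fcc_roots_def zero_prod_def del: One_nat_def)

lemma edge_row_distinct: assumes "i < 24" shows "distinct (map snd (edge_row i))"
proof -
  have "i = 0 \<or> i = 1 \<or> i = 2 \<or> i = 3 \<or> i = 4 \<or> i = 5 \<or> i = 6 \<or> i = 7 \<or> i = 8 \<or> i = 9 \<or> i = 10 \<or> i = 11 \<or> i = 12 \<or> i = 13 \<or> i = 14 \<or> i = 15 \<or> i = 16 \<or> i = 17 \<or> i = 18 \<or> i = 19 \<or> i = 20 \<or> i = 21 \<or> i = 22 \<or> i = 23"
    using assms by arith
  then show ?thesis by (elim disjE; hypsubst; simp add: edge_row_simps del: One_nat_def)
qed

lemma smaller_neighbour: "\<forall>j\<in>{1..<24}. \<exists>(x, y, z)\<in>set klein_triples. \<exists>i\<in>{x, y, z}. i < j \<and> j \<in> {x, y, z}"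
  by code_simp

lemma klein_degree: "\<forall>v<24. card {t \<in> klein_complex. v \<in> t} = 7"
  unfolding klein_complex_def by code_simp

lemma card_klein_complex: "card klein_complex = 56"
  unfolding klein_complex_def by code_simp

lemma klein_complexI: "(x, y, z) \<in> set klein_triples \<Longrightarrow> {x, y, z} \<in> klein_complex"
  unfolding klein_complex_def by (rule image_eqI[of _ _ "(x, y, z)"]) simp_all

lemma klein_triangle:
  assumes "\<tau> \<in> klein_complex"
  obtains i j k where "\<tau> = {i, j, k}" "distinct [i, j, k]" "\<tau> \<subseteq> {..<24}" "cocycle_on i j k"
proof -
  obtain i j k where ijk: "(i, j, k) \<in> set klein_triples" "\<tau> = {i, j, k}"
    using assms unfolding klein_complex_def by auto
  have "distinct [i, j, k]" "i < 24 \<and> j < 24 \<and> k < 24"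
    using bspec[OF klein_triples_range[unfolded list_all_iff] ijk(1)] by simp_all
  moreover have "cocycle_on i j k" using bspec[OF klein_triples_cocycle[unfolded list_all_iff] ijk(1)] by simp
  ultimately show ?thesis using that[OF ijk(2)] ijk(2) by simp
qed

lemma klein_vertices: "\<Union>klein_complex = {..<24}"
proof
  show "\<Union>klein_complex \<subseteq> {..<24}" using klein_triangle by blast
  show "{..<24} \<subseteq> \<Union>klein_complex"
  proof
    fix v :: nat assume "v \<in> {..<24}"
    then have "{t \<in> klein_complex. v \<in> t} \<noteq> {}" using klein_degree by (metis card.empty lessThan_iff zero_neq_numeral)
    then show "v \<in> \<Union>klein_complex" by blast
  qed
qed

lemma edge_vector_in_row:
  assumes "edge_vector i j \<noteq> 0" shows "(j, edge_vector i j) \<in> set (edge_row i)"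
  using assms by (auto simp: edge_vector_def zero_prod_def split: option.splits dest: map_of_SomeD)

lemma neg_root: "d \<in> set fcc_roots \<Longrightarrow> - d \<in> set fcc_roots"
  by (auto simp: fcc_roots_def)

lemma edge_vector_root:
  assumes "\<tau> \<in> klein_complex" "i \<in> \<tau>" "j \<in> \<tau>" "i \<noteq> j" shows "edge_vector i j \<in> set fcc_roots"
proof -
  obtain a b c where "\<tau> = {a, b, c}" "cocycle_on a b c" using klein_triangle[OF assms(1)] by metis
  then show ?thesis
    using assms(2-4) neg_root[of "edge_vector a b"] neg_root[of "edge_vector b c"] neg_root[of "edge_vector a c"]
    by (auto simp: cocycle_on_def)
qed

lemma edge_vector_inject:
  assumes "\<tau> \<in> klein_complex" "\<tau>' \<in> klein_complex" "{i, j} \<subseteq> \<tau>" "{i, k} \<subseteq> \<tau>'" "i \<noteq> j" "i \<noteq> k"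
    and eq: "edge_vector i j = edge_vector i k"
  shows "j = k"
proof -
  have "edge_vector i j \<noteq> 0" "edge_vector i k \<noteq> 0"
    using edge_vector_root[OF assms(1), of i j] edge_vector_root[OF assms(2), of i k] assms zero_not_root by auto
  then have jk: "(j, edge_vector i j) \<in> set (edge_row i)" "(k, edge_vector i j) \<in> set (edge_row i)"
    using edge_vector_in_row eq by metis+
  have "i < 24" using assms klein_vertices by blast
  then have "inj_on snd (set (edge_row i))" using edge_row_distinct by (simp add: distinct_map)
  from inj_onD[OF this _ jk] show ?thesis by simp
qed

interpretation klein_cover: fcc_cocycle klein_complex edge_vector
proof
  fix \<tau> assume \<tau>: "\<tau> \<in> klein_complex"
  obtain a b c where abc: "\<tau> = {a, b, c}" "distinct [a, b, c]" "cocycle_on a b c" using klein_triangle[OF \<tau>] by metis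
  show "card \<tau> = 3" using abc by simp
  show "edge_vector i j + edge_vector j k = edge_vector i k" if "i \<in> \<tau>" "j \<in> \<tau>" "k \<in> \<tau>" for i j k
  proof -
    have "edge_vector x y = edge_vector a y - edge_vector a x" if xy: "x \<in> \<tau>" "y \<in> \<tau>" for x y
    proof -
      from abc(3) have *: "edge_vector a c = edge_vector a b + edge_vector b c" "edge_vector b a = - edge_vector a b"
        "edge_vector c b = - edge_vector b c" "edge_vector c a = - edge_vector a c"
        "edge_vector a a = 0" "edge_vector b b = 0" "edge_vector c c = 0"
        unfolding cocycle_on_def by metis+
      from xy(1) consider "x = a" | "x = b" | "x = c" unfolding abc(1) by blast
      then show ?thesis
      proof cases
        case 1
        then show ?thesis using * by simp
      next
        case 2
        then show ?thesis using xy(2) * unfolding abc(1) by (elim insertE emptyE) simp_all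
      next
        case 3
        then show ?thesis using xy(2) * unfolding abc(1) by (elim insertE emptyE) simp_all
      qed
    qed
    from this[OF that(1,2)] this[OF that(2,3)] this[OF that(1,3)] show ?thesis by simp
  qed
  show "edge_vector i j \<in> set fcc_roots" if "i \<in> \<tau>" "j \<in> \<tau>" "i \<noteq> j" for i j
    using edge_vector_root[OF \<tau> that] .
next
  show "j = k" if "\<tau> \<in> klein_complex" "\<tau>' \<in> klein_complex" "{i, j} \<subseteq> \<tau>" "{i, k} \<subseteq> \<tau>'" "i \<noteq> j" "i \<noteq> k"
    "edge_vector i j = edge_vector i k" for \<tau> \<tau>' i j k
    using edge_vector_inject that by blast
  show "card {\<tau> \<in> klein_complex. i \<in> \<tau>} = 7" if "i \<in> \<Union>klein_complex" for i
    using klein_degree that klein_vertices by blast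
  show "0 \<in> \<Union>klein_complex" by (simp add: klein_vertices)
  show "\<exists>j<i. \<exists>\<tau>\<in>klein_complex. {i, j} \<subseteq> \<tau>" if "i \<in> \<Union>klein_complex" "i \<noteq> 0" for i
  proof -
    have "i \<in> {1..<24}" using that klein_vertices by auto
    then obtain x y z j where "(x, y, z) \<in> set klein_triples" "j \<in> {x, y, z}" "j < i" "i \<in> {x, y, z}"
      using smaller_neighbour by blast
    then have "j < i" "{x, y, z} \<in> klein_complex" "{i, j} \<subseteq> {x, y, z}" using klein_complexI by simp_all
    then show ?thesis by (intro exI[of _ j] conjI bexI[of _ "{x, y, z}"])
  qed
qed

text \<open>
  The closed path through the vertices 0, 2, 16, 5 has the period \<open>(2, -2, 0)\<close>.
\<close>

lemma klein_cover_infinite: "infinite klein_cover.cover"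
proof (rule klein_cover.infinite_cover)
  have "(0, 2, 3) \<in> set klein_triples" "(2, 16, 20) \<in> set klein_triples"
    "(5, 19, 16) \<in> set klein_triples" "(0, 4, 5) \<in> set klein_triples"
    by (simp_all add: klein_triples_def del: One_nat_def)
  then have tri: "{0, 2, 3} \<in> klein_complex" "{2, 16, 20} \<in> klein_complex" "{5, 19, 16} \<in> klein_complex" "{0, 4, 5} \<in> klein_complex"
    by (auto intro: klein_complexI)
  have "(2, 0 + edge_vector 0 2) \<in> klein_cover.reach"
    by (rule klein_cover.reach_step[OF klein_cover.reach_base tri(1)]) auto
  then have "(16, 0 + edge_vector 0 2 + edge_vector 2 16) \<in> klein_cover.reach"
    by (rule klein_cover.reach_step[OF _ tri(2)]) auto
  then have "(5, 0 + edge_vector 0 2 + edge_vector 2 16 + edge_vector 16 5) \<in> klein_cover.reach"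
    by (rule klein_cover.reach_step[OF _ tri(3)]) auto
  then have "(0, 0 + edge_vector 0 2 + edge_vector 2 16 + edge_vector 16 5 + edge_vector 5 0) \<in> klein_cover.reach"
    by (rule klein_cover.reach_step[OF _ tri(4)]) auto
  also have "0 + edge_vector 0 2 + edge_vector 2 16 + edge_vector 16 5 + edge_vector 5 0 = (2, -2, 0)"
    by (simp add: edge_vector_def edge_row_simps)
  finally show "(0, (2, -2, 0)) \<in> klein_cover.reach" .
qed (simp add: zero_prod_def)

section \<open>Labelling by the Klein map\<close>

text \<open>
  The twelve families of hinges in \<open>klein_map_labelling\<close>, in the numbering of \<open>klein_triples\<close>.
\<close>

definition klein_hinges :: "(nat \<times> nat \<times> nat \<times> nat) list" where
  "klein_hinges = concat (map (\<lambda>i.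
     [(0, 1 + (i + 1) mod 7, 1 + i, 1 + (i + 2) mod 7),
      (1 + i, 1 + (i + 1) mod 7, 0, 8 + i),
      (1 + i, 8 + i, 1 + (i + 1) mod 7, 15 + i),
      (1 + (i + 3) mod 7, 8 + (i + 2) mod 7, 1 + (i + 2) mod 7, 15 + i),
      (8 + (i + 2) mod 7, 15 + i, 1 + (i + 3) mod 7, 8 + i),
      (15 + i, 8 + i, 8 + (i + 2) mod 7, 1 + i),
      (1 + (i + 3) mod 7, 15 + i, 8 + (i + 2) mod 7, 15 + (i + 3) mod 7),
      (1 + (i + 3) mod 7, 15 + (i + 3) mod 7, 15 + i, 8 + (i + 3) mod 7),
      (8 + i, 8 + (i + 2) mod 7, 15 + i, 23),
      (8 + (i + 2) mod 7, 23, 8 + i, 8 + (i + 4) mod 7),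
      (15 + i, 15 + (i + 4) mod 7, 1 + i, 22),
      (15 + (i + 4) mod 7, 22, 15 + (i + 1) mod 7, 15 + i)]) [0, 1, 2, 3, 4, 5, 6])"

text \<open>
  Each side of each triangle is the edge of a listed hinge that has this triangle on one of its sides.
\<close>

lemma hinges_cover_edges:
  "\<forall>(x, y, z)\<in>set klein_triples. \<forall>(x', y', z')\<in>set [(x, y, z), (y, z, x), (z, x, y)].
     \<exists>(i, j, k, l)\<in>set klein_hinges. (i = x' \<and> j = y' \<or> i = y' \<and> j = x') \<and> (k = z' \<or> l = z')"
  by code_simp

lemma hinges_in_complex:
  "\<forall>(i, j, k, l)\<in>set klein_hinges. {i, j, k} \<in> klein_complex \<and> {i, j, l} \<in> klein_complex"
  unfolding klein_complex_def by code_simp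

lemma periodic_mod:
  assumes "\<And>i. f (i + 7) = f i" shows "f (n mod 7) = f (n :: nat)"
proof -
  have "f (m + k * 7) = f m" for m k
  proof (induction k)
    case (Suc k)
    have "f (m + k * 7 + 7) = f (m + k * 7)" by (rule assms)
    then show ?case using Suc by (simp add: algebra_simps)
  qed simp
  from this[of "n mod 7" "n div 7"] show ?thesis by simp
qed

context flag_transitive_37_complex
begin

lemma hinge_labelling:
  assumes "{s, x, y} \<in> K"
  obtains lab where "\<And>i j k l. (i, j, k, l) \<in> set klein_hinges \<Longrightarrow> hinge (lab i) (lab j) (lab k) (lab l)"
proof -
  obtain a b c :: "nat \<Rightarrow> 'v" and p q where per: "\<And>i. a (i+7) = a i" "\<And>i. b (i+7) = b i" "\<And>i. c (i+7) = c i"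
    and H: "\<And>i. hinge s (a (i+1)) (a i) (a (i+2))"
    "\<And>i. hinge (a i) (a (i+1)) s (b i)"
    "\<And>i. hinge (a i) (b i) (a (i+1)) (c i)"
    "\<And>i. hinge (a (i+3)) (b (i+2)) (a (i+2)) (c i)"
    "\<And>i. hinge (b (i+2)) (c i) (a (i+3)) (b i)"
    "\<And>i. hinge (c i) (b i) (b (i+2)) (a i)"
    "\<And>i. hinge (a (i+3)) (c i) (b (i+2)) (c (i+3))"
    "\<And>i. hinge (a (i+3)) (c (i+3)) (c i) (b (i+3))"
    "\<And>i. hinge (b i) (b (i+2)) (c i) q"
    "\<And>i. hinge (b (i+2)) q (b i) (b (i+4))"
    "\<And>i. hinge (c i) (c (i+4)) (a i) p"
    "\<And>i. hinge (c (i+4)) p (c (i+1)) (c i)"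
    by (rule klein_map_labelling[OF assms]) blast
  define lab where "lab n = (if n = 0 then s else if n < 8 then a (n - 1) else if n < 15 then b (n - 8)
    else if n < 22 then c (n - 15) else if n = 22 then p else q)" for n :: nat
  have lab0: "lab 0 = s" "lab 22 = p" "lab 23 = q" by (simp_all add: lab_def)
  have laba: "lab (1 + m) = a m" and labb: "lab (8 + m) = b m" and labc: "lab (15 + m) = c m" if "m < 7" for m
    using that by (simp_all add: lab_def)
  have labm: "lab (1 + n mod 7) = a n" "lab (8 + n mod 7) = b n" "lab (15 + n mod 7) = c n" for n
    using laba[of "n mod 7"] labb[of "n mod 7"] labc[of "n mod 7"]
      periodic_mod[of a, OF per(1)] periodic_mod[of b, OF per(2)] periodic_mod[of c, OF per(3)] by simp_all
  show ?thesis
  proof (rule that)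
    fix i j k l assume "(i, j, k, l) \<in> set klein_hinges"
    then obtain m where m: "m \<in> set [0, 1, 2, 3, 4, 5, 6]" "(i, j, k, l) \<in> set [
      (0, 1 + (m + 1) mod 7, 1 + m, 1 + (m + 2) mod 7),
      (1 + m, 1 + (m + 1) mod 7, 0, 8 + m),
      (1 + m, 8 + m, 1 + (m + 1) mod 7, 15 + m),
      (1 + (m + 3) mod 7, 8 + (m + 2) mod 7, 1 + (m + 2) mod 7, 15 + m),
      (8 + (m + 2) mod 7, 15 + m, 1 + (m + 3) mod 7, 8 + m),
      (15 + m, 8 + m, 8 + (m + 2) mod 7, 1 + m),
      (1 + (m + 3) mod 7, 15 + m, 8 + (m + 2) mod 7, 15 + (m + 3) mod 7),
      (1 + (m + 3) mod 7, 15 + (m + 3) mod 7, 15 + m, 8 + (m + 3) mod 7),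
      (8 + m, 8 + (m + 2) mod 7, 15 + m, 23),
      (8 + (m + 2) mod 7, 23, 8 + m, 8 + (m + 4) mod 7),
      (15 + m, 15 + (m + 4) mod 7, 1 + m, 22),
      (15 + (m + 4) mod 7, 22, 15 + (m + 1) mod 7, 15 + m)]"
      unfolding klein_hinges_def set_concat set_map by blast
    have "m < 7" using m(1) by auto
    note lm = laba[OF this] labb[OF this] labc[OF this] labm lab0
    have pick: "P i j k l" if "(i, j, k, l) \<in> set xs" "list_all (\<lambda>(i, j, k, l). P i j k l) xs" for P and xs :: "(nat \<times> nat \<times> nat \<times> nat) list"
      using that by (auto simp: list_all_iff)
    show "hinge (lab i) (lab j) (lab k) (lab l)"
      by (rule pick[OF m(2), of "\<lambda>i j k l. hinge (lab i) (lab j) (lab k) (lab l)"])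
        (simp only: list.pred_inject prod.case lm H simp_thms)
  qed
qed

text \<open>
  The image of the Klein map is closed under crossing edges, because the two triangles of \<open>klein_complex\<close> at
  an edge go to the two ends of a hinge.  Therefore it contains every triangle at each of its vertices.
\<close>

theorem klein_labelling:
  assumes "{s, x, y} \<in> K"
  obtains lab where "(`) lab ` klein_complex \<subseteq> K"
    "\<And>\<tau> v. \<tau> \<in> K \<Longrightarrow> v \<in> \<tau> \<Longrightarrow> v \<in> lab ` {..<24} \<Longrightarrow> \<tau> \<in> (`) lab ` klein_complex"
proof -
  obtain lab where lab: "\<And>i j k l. (i, j, k, l) \<in> set klein_hinges \<Longrightarrow> hinge (lab i) (lab j) (lab k) (lab l)"
    using hinge_labelling[OF assms] by blast
  let ?L = "(`) lab ` klein_complex"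
  have edge: "\<exists>w. hinge (lab x) (lab y) (lab z) (lab w) \<and> {x, y, w} \<in> klein_complex"
    if t: "(x', y', z') \<in> set klein_triples" "(x, y, z) \<in> set [(x', y', z'), (y', z', x'), (z', x', y')]" for x y z x' y' z'
  proof -
    obtain i j k l where h: "(i, j, k, l) \<in> set klein_hinges" "i = x \<and> j = y \<or> i = y \<and> j = x" "k = z \<or> l = z"
      using bspec[OF bspec[OF hinges_cover_edges t(1), unfolded prod.case] t(2)] by auto
    have hh: "hinge (lab x) (lab y) (lab k) (lab l)" using lab[OF h(1)] h(2) hinge_swap_ends by blast
    have kl: "{x, y, k} \<in> klein_complex" "{x, y, l} \<in> klein_complex"
      using bspec[OF hinges_in_complex h(1)] h(2) by (auto simp: insert_commute)
    show ?thesis using h(3)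
    proof
      assume "k = z" then show ?thesis using hh kl(2) by blast
    next
      assume "l = z" then show ?thesis using hinge_swap_sides[OF hh] kl(1) by blast
    qed
  qed
  have LK: "?L \<subseteq> K"
  proof clarify
    fix \<tau> assume "\<tau> \<in> klein_complex"
    then obtain x y z where xyz: "(x, y, z) \<in> set klein_triples" "\<tau> = {x, y, z}" unfolding klein_complex_def by auto
    then have "{lab x, lab y, lab z} \<in> K" using edge[OF xyz(1), of x y z] by (auto simp: hinge_def)
    then show "lab ` \<tau> \<in> K" using xyz by simp
  qed
  have closed: "{X, Y, W} \<in> ?L" if L: "{X, Y, Z} \<in> ?L" and h: "hinge X Y Z W" for X Y Z W
  proof -
    obtain \<tau> where \<tau>: "\<tau> \<in> klein_complex" "{X, Y, Z} = lab ` \<tau>" using L by blast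
    then obtain x y z where xyz: "(x, y, z) \<in> set klein_triples" "\<tau> = {x, y, z}" unfolding klein_complex_def by auto
    have d: "distinct [X, Y, Z]" using h triangle_distinct by (auto simp: hinge_def)
    have go: "{X, Y, W} \<in> ?L" if r: "(x', y', z') \<in> set [(x, y, z), (y, z, x), (z, x, y)]" and e: "{X, Y} = {lab x', lab y'}" "Z = lab z'" for x' y' z'
    proof -
      obtain w where w: "hinge (lab x') (lab y') (lab z') (lab w)" "{x', y', w} \<in> klein_complex"
        using edge[OF xyz(1) r] by blast
      have "hinge X Y Z (lab w)" using w(1) e hinge_swap_ends by (metis doubleton_eq_iff)
      then have "W = lab w" using h hinge_unique by blast
      then have "{X, Y, W} = lab ` {x', y', w}" using e(1) by auto
      then show ?thesis using w(2) by blast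
    qed
    have eq: "{X, Y, Z} = {lab x, lab y, lab z}" using \<tau>(2) xyz(2) by simp
    then consider "Z = lab x" | "Z = lab y" | "Z = lab z" by blast
    moreover have dl: "distinct [lab x, lab y, lab z]"
    proof -
      have "card {X, Y, Z} = 3" using d by simp
      then have "card {lab x, lab y, lab z} = 3" using eq by simp
      then show ?thesis by (auto simp: card_insert_if split: if_splits)
    qed
    have rest: "{X, Y} = {X, Y, Z} - {Z}" using d by auto
    show ?thesis
    proof (cases rule: calculation)
      case 1
      then have "{X, Y} = {lab y, lab z}" unfolding rest eq using dl by auto
      then show ?thesis using go[of y z x] 1 by simp
    next
      case 2
      then have "{X, Y} = {lab z, lab x}" unfolding rest eq using dl by auto
      then show ?thesis using go[of z x y] 2 by simp
    next
      case 3
      then have "{X, Y} = {lab x, lab y}" unfolding rest eq using dl by auto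
      then show ?thesis using go[of x y z] 3 by simp
    qed
  qed
  show ?thesis
  proof (rule that[OF LK])
    fix \<tau> v assume \<tau>: "\<tau> \<in> K" "v \<in> \<tau>" and v: "v \<in> lab ` {..<24}"
    then obtain i where i: "i < 24" "v = lab i" by blast
    then obtain \<tau>0 where "\<tau>0 \<in> klein_complex" "i \<in> \<tau>0" using klein_vertices by blast
    then have 0: "lab ` \<tau>0 \<in> ?L" "v \<in> lab ` \<tau>0" using i by auto
    show "\<tau> \<in> ?L"
      by (rule closed_under_hinges_star[OF LK _ 0 \<tau>]) (rule closed)
  qed
qed

end

section \<open>The complex projective plane is Hausdorff\<close>

lemma proj_pt_eq_iff: "v \<noteq> 0 \<Longrightarrow> w \<noteq> 0 \<Longrightarrow> proj_pt v = proj_pt w \<longleftrightarrow> (\<exists>c. w = c *s v)"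
proof -
  assume "v \<noteq> 0" "w \<noteq> 0"
  moreover have "proj_rel z z" if "z \<noteq> 0" for z using that by (auto simp: proj_rel_def intro: exI[of _ 1])
  ultimately show ?thesis using Quotient_rel[OF Quotient_cp2, of v w] by (auto simp: proj_rel_def)
qed

lemma proj_pt_surj: obtains v where "v \<noteq> 0" "x = proj_pt v"
proof -
  have "proj_rel (rep_cp2 x) (rep_cp2 x)" "x = proj_pt (rep_cp2 x)"
    using Quotient_rep_reflp[OF Quotient_cp2, of x] Quotient_abs_rep[OF Quotient_cp2, of x] by simp_all
  then show ?thesis using that[of "rep_cp2 x"] unfolding proj_rel_def by blast
qed

text \<open>
  A norm of \<open>v \<and> z\<close>; it vanishes exactly if \<open>v\<close> and \<open>z\<close> are proportional and scales with \<open>z\<close>, so that the points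
  closer to \<open>v\<close> than to \<open>w\<close> in this sense form an open set of the projective plane.
\<close>

definition wedge_norm :: "complex^3 \<Rightarrow> complex^3 \<Rightarrow> real" where
  "wedge_norm v z = (\<Sum>i\<in>UNIV. \<Sum>j\<in>UNIV. cmod (vec_nth v i * vec_nth z j - vec_nth v j * vec_nth z i))"

lemma wedge_norm_scale: "wedge_norm v (c *s z) = cmod c * wedge_norm v z"
proof -
  have "vec_nth v i * vec_nth (c *s z) j - vec_nth v j * vec_nth (c *s z) i = c * (vec_nth v i * vec_nth z j - vec_nth v j * vec_nth z i)" for i j
    by (simp add: algebra_simps)
  then show ?thesis by (simp add: wedge_norm_def norm_mult sum_distrib_left)
qed

lemma wedge_norm_self: "wedge_norm v v = 0"
  by (simp add: wedge_norm_def mult.commute)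

lemma wedge_norm_pos:
  assumes "v \<noteq> 0" "\<nexists>c. w = c *s v" shows "wedge_norm v w > 0"
proof -
  have "wedge_norm v w \<noteq> 0"
  proof
    assume "wedge_norm v w = 0"
    then have "\<forall>i j. cmod (vec_nth v i * vec_nth w j - vec_nth v j * vec_nth w i) = 0"
      by (simp add: wedge_norm_def sum_nonneg_eq_0_iff sum_nonneg)
    then have eq: "vec_nth v i * vec_nth w j = vec_nth v j * vec_nth w i" for i j by simp
    obtain k where "vec_nth v k \<noteq> 0" using assms(1) by (metis vec_eq_iff zero_index)
    then have "w = (vec_nth w k / vec_nth v k) *s v"
      using eq[of k] by (simp add: vec_eq_iff nonzero_eq_divide_eq mult.commute)
    then show False using assms(2) by blast
  qed
  then show ?thesis unfolding wedge_norm_def by (simp add: less_le sum_nonneg)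
qed

instance cp2 :: t2_space
proof
  fix x y :: cp2 assume "x \<noteq> y"
  obtain v where v: "v \<noteq> 0" "x = proj_pt v" by (rule proj_pt_surj)
  obtain w where w: "w \<noteq> 0" "y = proj_pt w" by (rule proj_pt_surj)
  have np: "\<nexists>c. w = c *s v" "\<nexists>c. v = c *s w"
    using \<open>x \<noteq> y\<close> proj_pt_eq_iff[OF v(1) w(1)] proj_pt_eq_iff[OF w(1) v(1)] v(2) w(2) by metis+
  \<comment> \<open>The points closer to \<open>a\<close> than to \<open>b\<close>.\<close>
  define N where "N a b = {proj_pt z | z. z \<noteq> 0 \<and> wedge_norm a z < wedge_norm b z}" for a b
  have pre: "z \<noteq> 0 \<and> proj_pt z \<in> N a b \<longleftrightarrow> z \<noteq> 0 \<and> wedge_norm a z < wedge_norm b z" for a b z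
  proof
    assume z: "z \<noteq> 0 \<and> proj_pt z \<in> N a b"
    then obtain z' where z': "proj_pt z = proj_pt z'" "z' \<noteq> 0" "wedge_norm a z' < wedge_norm b z'" by (auto simp: N_def)
    then obtain c where "z' = c *s z" using proj_pt_eq_iff z by metis
    moreover from this have "cmod c > 0" using z'(2) by auto
    ultimately show "z \<noteq> 0 \<and> wedge_norm a z < wedge_norm b z" using z z'(3) by (simp add: wedge_norm_scale)
  qed (auto simp: N_def)
  have open_N: "open (N a b)" for a b
  proof -
    have "{z. z \<noteq> 0 \<and> proj_pt z \<in> N a b} = (- {0}) \<inter> {z. wedge_norm a z < wedge_norm b z}"
      unfolding pre by auto
    moreover have "open ((- {0}) \<inter> {z. wedge_norm a z < wedge_norm b z})"
      unfolding wedge_norm_def by (intro open_Int open_Collect_less continuous_intros)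
    ultimately show ?thesis unfolding open_cp2_def by simp
  qed
  have "N v w \<inter> N w v = {}"
  proof (rule ccontr)
    assume "N v w \<inter> N w v \<noteq> {}"
    then obtain p where "p \<in> N v w" "p \<in> N w v" by blast
    moreover obtain z where "z \<noteq> 0" "p = proj_pt z" by (rule proj_pt_surj)
    ultimately show False using pre[of z v w] pre[of z w v] by auto
  qed
  moreover have "x \<in> N v w" "y \<in> N w v"
    using v w np wedge_norm_self wedge_norm_pos by (auto simp: N_def)
  ultimately show "\<exists>U V. open U \<and> open V \<and> x \<in> U \<and> y \<in> V \<and> U \<inter> V = {}"
    by (intro exI[of _ "N v w"] exI[of _ "N w v"] conjI open_N)
qed

section \<open>Gluing parametrized triangles\<close>

text \<open>
  Moves points of a triangle parallel to the side \<open>a b\<close>, changing the ratio of the two coordinates by \<open>\<beta>\<close>.  The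
  other two sides are fixed pointwise if \<open>\<beta>\<close> fixes 0 and 1.
\<close>

definition edge_shift :: "(real \<Rightarrow> real) \<Rightarrow> nat \<Rightarrow> nat \<Rightarrow> (nat \<Rightarrow> real) \<Rightarrow> nat \<Rightarrow> real" where
  "edge_shift \<beta> a b x = x(a := (x a + x b) * (1 - \<beta> (x b / (x a + x b))), b := (x a + x b) * \<beta> (x b / (x a + x b)))"

locale interval_map =
  fixes \<beta> :: "real \<Rightarrow> real"
  assumes range: "r \<in> {0..1} \<Longrightarrow> \<beta> r \<in> {0..1}" and zero: "\<beta> 0 = 0" and one: "\<beta> 1 = 1"
begin

lemma ratio: "x \<in> simplex_of s \<Longrightarrow> x b / (x a + x b) \<in> {0..1}"
  using simplex_of_nonneg[of x s a] simplex_of_nonneg[of x s b] by (auto simp: divide_le_eq_1)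

lemma edge_shift_simps:
  assumes "a \<noteq> b"
  shows "edge_shift \<beta> a b x a = (x a + x b) * (1 - \<beta> (x b / (x a + x b)))"
    "edge_shift \<beta> a b x b = (x a + x b) * \<beta> (x b / (x a + x b))"
    "v \<noteq> a \<Longrightarrow> v \<noteq> b \<Longrightarrow> edge_shift \<beta> a b x v = x v"
    "edge_shift \<beta> a b x a + edge_shift \<beta> a b x b = x a + x b"
  using assms by (simp_all add: edge_shift_def algebra_simps)

lemma edge_shift_trivial:
  assumes "a \<noteq> b" "x a = 0 \<or> x b = 0" shows "edge_shift \<beta> a b x = x"
  using assms zero one by (auto simp: edge_shift_def fun_eq_iff)

lemma edge_shift_in:
  assumes ab: "a \<noteq> b" and s: "finite s" and x: "x \<in> simplex_of s"
  shows "edge_shift \<beta> a b x \<in> simplex_of s"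
proof (cases "a \<in> s \<and> b \<in> s")
  case False
  then have "x a = 0 \<or> x b = 0" using simplex_of_support[OF x] by blast
  then show ?thesis using edge_shift_trivial[OF ab] x by simp
next
  case True
  let ?y = "edge_shift \<beta> a b x"
  have r: "\<beta> (x b / (x a + x b)) \<in> {0..1}" by (rule range[OF ratio[OF x]])
  have nn: "?y v \<ge> 0" for v
    using r simplex_of_nonneg[OF x] edge_shift_simps(1,2)[OF ab, of x] edge_shift_simps(3)[OF ab, of v x]
    by (cases "v = a"; cases "v = b") auto
  have "sum ?y s = sum ?y (s - {a, b}) + (?y a + ?y b)"
    using sum.subset_diff[of "{a, b}" s ?y] True s ab by simp
  also have "\<dots> = sum x (s - {a, b}) + (x a + x b)"
    using edge_shift_simps[OF ab] by (auto intro!: arg_cong2[of _ _ _ _ "(+)"] sum.cong)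
  also have "\<dots> = sum x s"
    using sum.subset_diff[of "{a, b}" s x] True s ab by simp
  finally have "sum ?y s = 1" using simplex_of_sum[OF x] by simp
  moreover have "?y v = 0" if "v \<notin> s" for v
  proof -
    have "v \<noteq> a" "v \<noteq> b" using that True by auto
    then show ?thesis using edge_shift_simps(3)[OF ab] simplex_of_support[OF x, of v] that by metis
  qed
  ultimately show ?thesis using nn unfolding simplex_of_def by blast
qed

text \<open>
  The ratio has no limit at the corner opposite to the side, but there the product with \<open>x a + x b\<close> tends to 0.
\<close>

lemma edge_shift_continuous:
  assumes \<beta>: "continuous_on {0..1} \<beta>" and ab: "a \<noteq> b"
  shows "continuous_on (simplex_of s) (edge_shift \<beta> a b)"
proof -
  let ?m = "\<lambda>x. (x a + x b) * \<beta> (x b / (x a + x b))"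
  have m: "continuous_on (simplex_of s) ?m"
  proof -
    have "(?m \<longlongrightarrow> ?m x0) (at x0 within simplex_of s)" if x0: "x0 \<in> simplex_of s" for x0
    proof (cases "x0 a + x0 b = 0")
      case True
      have "((\<lambda>x. x a + x b) \<longlongrightarrow> x0 a + x0 b) (at x0 within simplex_of s)"
        by (intro tendsto_add continuous_coordinate[of "simplex_of s", unfolded continuous_on_def, rule_format] x0)
      then have "((\<lambda>x. x a + x b) \<longlongrightarrow> 0) (at x0 within simplex_of s)" using True by simp
      moreover have "\<forall>\<^sub>F x in at x0 within simplex_of s. norm (?m x) \<le> (x a + x b)"
      proof (rule eventually_at_topological[THEN iffD2], intro exI[of _ UNIV] conjI ballI impI open_UNIV UNIV_I)
        fix x assume x: "x \<in> simplex_of s"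
        have "\<beta> (x b / (x a + x b)) \<in> {0..1}" by (rule range[OF ratio[OF x]])
        moreover have "x a + x b \<ge> 0" using simplex_of_nonneg[OF x] by simp
        ultimately show "norm (?m x) \<le> (x a + x b)" by (simp add: abs_mult mult_left_le)
      qed
      ultimately have "(?m \<longlongrightarrow> 0) (at x0 within simplex_of s)" by (rule Lim_null_comparison[rotated])
      then show ?thesis using True by simp
    next
      case False
      let ?G = "{x. x a + x b > (0::real)}"
      have G: "open ?G" "x0 \<in> ?G"
        using False simplex_of_nonneg[OF x0, of a] simplex_of_nonneg[OF x0, of b]
        by (auto intro!: open_Collect_less continuous_intros)
      have "continuous_on (simplex_of s \<inter> ?G) ?m"
      proof (intro continuous_intros continuous_on_compose2[OF \<beta>])
        show "(\<lambda>x. x b / (x a + x b)) ` (simplex_of s \<inter> ?G) \<subseteq> {0..1}" using ratio by blast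
      qed auto
      then have "(?m \<longlongrightarrow> ?m x0) (at x0 within simplex_of s \<inter> ?G)" using x0 G(2) by (simp add: continuous_on_def)
      moreover have "at x0 within simplex_of s = at x0 within (simplex_of s \<inter> ?G)" by (rule at_within_nhd[OF G(2,1)]) auto
      ultimately show ?thesis by simp
    qed
    then show ?thesis by (simp add: continuous_on_def)
  qed
  show ?thesis
  proof (rule continuous_on_coordinatewise_then_product)
    fix v
    have "continuous_on (simplex_of s) (\<lambda>x. (x a + x b) - ?m x)" by (intro continuous_intros m)
    moreover have "edge_shift \<beta> a b x a = (x a + x b) - ?m x" for x
      using ab by (simp add: edge_shift_def algebra_simps)
    moreover have "edge_shift \<beta> a b x b = ?m x" for x by (simp add: edge_shift_def)
    moreover have "edge_shift \<beta> a b x v = x v" if "v \<noteq> a" "v \<noteq> b" for x using that by (simp add: edge_shift_def)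
    ultimately show "continuous_on (simplex_of s) (\<lambda>x. edge_shift \<beta> a b x v)"
      using m by (cases "v = a"; cases "v = b") (simp_all add: continuous_coordinate)
  qed
qed

end

lemma edge_shift_inverse:
  assumes \<beta>: "interval_map \<beta>" and \<gamma>: "interval_map \<gamma>" and inv: "\<And>r. r \<in> {0..1} \<Longrightarrow> \<gamma> (\<beta> r) = r"
    and ab: "a \<noteq> b" and x: "x \<in> simplex_of s"
  shows "edge_shift \<gamma> a b (edge_shift \<beta> a b x) = x"
proof (cases "x a + x b = 0")
  case True
  then have "x a = 0" using simplex_of_nonneg[OF x, of a] simplex_of_nonneg[OF x, of b] by simp
  then show ?thesis using interval_map.edge_shift_trivial[OF \<beta> ab, of x] interval_map.edge_shift_trivial[OF \<gamma> ab, of x] by simp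
next
  case False
  let ?y = "edge_shift \<beta> a b x"
  have s: "?y a + ?y b = x a + x b" and b: "?y b = (x a + x b) * \<beta> (x b / (x a + x b))"
    using interval_map.edge_shift_simps(2,4)[OF \<beta> ab] by auto
  have "?y b / (?y a + ?y b) = ?y b / (x a + x b)" by (simp only: s)
  also have "\<dots> = \<beta> (x b / (x a + x b))" unfolding b using False by simp
  finally have "?y b / (?y a + ?y b) = \<beta> (x b / (x a + x b))" .
  then have "\<gamma> (?y b / (?y a + ?y b)) = x b / (x a + x b)" using inv interval_map.ratio[OF \<beta> x] by simp
  then have "edge_shift \<gamma> a b ?y = ?y(a := (x a + x b) * (1 - x b / (x a + x b)), b := (x a + x b) * (x b / (x a + x b)))"
    unfolding edge_shift_def[of \<gamma>] s by simp
  also have "\<dots> = x" using False ab by (auto simp: fun_eq_iff edge_shift_def[of \<beta>] field_simps)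
  finally show ?thesis .
qed

lemma simplex_of_edge:
  assumes "a \<noteq> b" shows "x \<in> simplex_of {a, b} \<longleftrightarrow> x b \<in> {0..1} \<and> x = (\<lambda>v. if v = a then 1 - x b else if v = b then x b else 0)"
proof
  assume x: "x \<in> simplex_of {a, b}"
  then have "x a + x b = 1" "x a \<ge> 0" "x b \<ge> 0" using simplex_of_sum[OF x] simplex_of_nonneg[OF x] assms by auto
  moreover have "x v = 0" if "v \<noteq> a" "v \<noteq> b" for v using simplex_of_support[OF x, of v] that by blast
  ultimately show "x b \<in> {0..1} \<and> x = (\<lambda>v. if v = a then 1 - x b else if v = b then x b else 0)"
    by (auto simp: fun_eq_iff)
next
  assume R: "x b \<in> {0..1} \<and> x = (\<lambda>v. if v = a then 1 - x b else if v = b then x b else 0)"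
  have "(\<lambda>v. if v = a then 1 - r else if v = b then r else 0) \<in> simplex_of {a, b}" if "r \<in> {0..1}" for r :: real
    using that assms by (auto simp: simplex_of_def)
  from this[of "x b"] R show "x \<in> simplex_of {a, b}" by metis
qed

text \<open>
  Comparing \<open>g\<close> with \<open>h\<close> on the side \<open>a b\<close> gives a homeomorphism \<open>\<beta>\<close> of the unit interval that fixes its ends;
  \<open>edge_shift \<beta>\<close> extends it over the triangle without moving the other sides.
\<close>

lemma reparametrize_edge:
  fixes h g :: "(nat \<Rightarrow> real) \<Rightarrow> 'b::t2_space"
  assumes \<tau>: "card \<tau> = 3" "{a, b} \<subseteq> \<tau>" "a \<noteq> b"
    and h: "continuous_on (simplex_of \<tau>) h" "inj_on h (simplex_of \<tau>)"
    and g: "continuous_on (simplex_of {a, b}) g" "inj_on g (simplex_of {a, b})"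
    and img: "g ` simplex_of {a, b} = h ` simplex_of {a, b}"
    and ends: "g (vertex_pt a) = h (vertex_pt a)" "g (vertex_pt b) = h (vertex_pt b)"
  obtains h' where "continuous_on (simplex_of \<tau>) h'" "inj_on h' (simplex_of \<tau>)"
    "\<And>x. x \<in> simplex_of {a, b} \<Longrightarrow> h' x = g x"
    "\<And>s x. s \<subseteq> \<tau> \<Longrightarrow> \<not> {a, b} \<subseteq> s \<Longrightarrow> x \<in> simplex_of s \<Longrightarrow> h' x = h x"
    "\<And>s. s \<subseteq> \<tau> \<Longrightarrow> h' ` simplex_of s = h ` simplex_of s"
proof -
  have ft: "finite \<tau>" using \<tau>(1) by (intro card_ge_0_finite) simp
  let ?e = "\<lambda>r v. if v = a then 1 - r else if v = b then r else (0::real)"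
  let ?E = "simplex_of {a, b}"
  have E\<tau>: "?E \<subseteq> simplex_of \<tau>" using simplex_of_mono[OF ft \<tau>(2)] .
  have eE: "?e r \<in> ?E" if "r \<in> {0..1}" for r using that \<tau>(3) by (auto simp: simplex_of_def)
  have E_eq: "x = ?e (x b)" "x b \<in> {0..1}" if "x \<in> ?E" for x using simplex_of_edge[OF \<tau>(3), of x] that by auto
  have e01: "?e 0 = vertex_pt a" "?e 1 = vertex_pt b" using \<tau>(3) by (auto simp: vertex_pt_def fun_eq_iff)
  have ce: "continuous_on {0..1} ?e"
  proof (rule continuous_on_coordinatewise_then_product)
    fix v show "continuous_on {0..1} (\<lambda>r. ?e r v)" by (cases "v = a"; cases "v = b") (auto intro: continuous_intros)
  qed
  have cpE: "compact ?E"
  proof -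
    have "?E = ?e ` {0..1}" using eE E_eq by blast
    then show ?thesis using compact_continuous_image[OF ce] by simp
  qed
  obtain hi where hi: "homeomorphism ?E (h ` ?E) h hi"
    using homeomorphism_compact[OF cpE continuous_on_subset[OF h(1) E\<tau>] refl inj_on_subset[OF h(2) E\<tau>]] by blast
  obtain gi where gi: "homeomorphism ?E (h ` ?E) g gi"
    using homeomorphism_compact[OF cpE g(1) img g(2)] by blast
  \<comment> \<open>Both \<open>\<beta>\<close> and its inverse \<open>\<gamma>\<close> are read off in the coordinate at \<open>b\<close>.\<close>
  define \<beta> where "\<beta> r = hi (g (?e r)) b" for r
  define \<gamma> where "\<gamma> r = gi (h (?e r)) b" for r
  have hiE: "hi (g x) \<in> ?E" if "x \<in> ?E" for x
    using that img homeomorphism_image2[OF hi] by blast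
  have giE: "gi (h x) \<in> ?E" if "x \<in> ?E" for x
    using that homeomorphism_image2[OF gi] by blast
  have e\<beta>: "?e (\<beta> r) = hi (g (?e r))" if "r \<in> {0..1}" for r
    using E_eq(1)[OF hiE[OF eE[OF that]]] unfolding \<beta>_def by simp
  have e\<gamma>: "?e (\<gamma> r) = gi (h (?e r))" if "r \<in> {0..1}" for r
    using E_eq(1)[OF giE[OF eE[OF that]]] unfolding \<gamma>_def by simp
  have eb: "?e r b = r" for r using \<tau>(3) by simp
  have vE: "vertex_pt a \<in> ?E" "vertex_pt b \<in> ?E" by (auto intro: vertex_pt_in_simplex)
  have \<beta>m: "interval_map \<beta>"
  proof
    show "\<beta> r \<in> {0..1}" if "r \<in> {0..1}" for r unfolding \<beta>_def using E_eq(2)[OF hiE[OF eE[OF that]]] .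
    show "\<beta> 0 = 0" "\<beta> 1 = 1"
      unfolding \<beta>_def e01 ends using homeomorphism_apply1[OF hi] vE \<tau>(3) by (simp_all add: vertex_pt_def)
  qed
  have \<gamma>m: "interval_map \<gamma>"
  proof
    show "\<gamma> r \<in> {0..1}" if "r \<in> {0..1}" for r unfolding \<gamma>_def using E_eq(2)[OF giE[OF eE[OF that]]] .
    show "\<gamma> 0 = 0" "\<gamma> 1 = 1"
      unfolding \<gamma>_def e01 ends[symmetric] using homeomorphism_apply1[OF gi] vE \<tau>(3) by (simp_all add: vertex_pt_def)
  qed
  have \<gamma>\<beta>: "\<gamma> (\<beta> r) = r" if r: "r \<in> {0..1}" for r
  proof -
    have "h (?e (\<beta> r)) = g (?e r)"
      unfolding e\<beta>[OF r] using homeomorphism_apply2[OF hi] img eE[OF r] by blast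
    then have "\<gamma> (\<beta> r) = gi (g (?e r)) b" unfolding \<gamma>_def by simp
    then show ?thesis using homeomorphism_apply1[OF gi eE[OF r]] eb by simp
  qed
  have \<beta>\<gamma>: "\<beta> (\<gamma> r) = r" if r: "r \<in> {0..1}" for r
  proof -
    have "g (?e (\<gamma> r)) = h (?e r)"
      unfolding e\<gamma>[OF r] using homeomorphism_apply2[OF gi] eE[OF r] by blast
    then have "\<beta> (\<gamma> r) = hi (h (?e r)) b" unfolding \<beta>_def by simp
    then show ?thesis using homeomorphism_apply1[OF hi eE[OF r]] eb by simp
  qed
  have c\<beta>: "continuous_on {0..1} \<beta>"
  proof -
    have "continuous_on {0..1} (\<lambda>r. hi (g (?e r)))"
      by (rule continuous_on_compose2[OF homeomorphism_cont2[OF hi]])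
        (use continuous_on_compose2[OF g(1) ce image_subsetI[OF eE]] eE img in blast)+
    then show ?thesis unfolding \<beta>_def by (rule continuous_on_product_then_coordinatewise)
  qed
  let ?\<Phi> = "edge_shift \<beta> a b" and ?\<Psi> = "edge_shift \<gamma> a b"
  have fs: "finite s" if "s \<subseteq> \<tau>" for s using that ft finite_subset by blast
  have \<Phi>in: "?\<Phi> x \<in> simplex_of s" if "s \<subseteq> \<tau>" "x \<in> simplex_of s" for s x
    using interval_map.edge_shift_in[OF \<beta>m \<tau>(3) fs[OF that(1)] that(2)] .
  have \<Psi>in: "?\<Psi> x \<in> simplex_of s" if "s \<subseteq> \<tau>" "x \<in> simplex_of s" for s x
    using interval_map.edge_shift_in[OF \<gamma>m \<tau>(3) fs[OF that(1)] that(2)] .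
  have \<Psi>\<Phi>: "?\<Psi> (?\<Phi> x) = x" if "x \<in> simplex_of s" for s x
    using edge_shift_inverse[OF \<beta>m \<gamma>m \<gamma>\<beta> \<tau>(3) that] .
  have \<Phi>\<Psi>: "?\<Phi> (?\<Psi> x) = x" if "x \<in> simplex_of s" for s x
    using edge_shift_inverse[OF \<gamma>m \<beta>m \<beta>\<gamma> \<tau>(3) that] .
  have \<Phi>img: "?\<Phi> ` simplex_of s = simplex_of s" if "s \<subseteq> \<tau>" for s
    using \<Phi>in[OF that] \<Psi>in[OF that] \<Phi>\<Psi> by (metis image_eqI image_subsetI subsetI subset_antisym)
  show ?thesis
  proof (rule that[of "h \<circ> ?\<Phi>"])
    show "continuous_on (simplex_of \<tau>) (h \<circ> ?\<Phi>)"
      by (rule continuous_on_compose[OF interval_map.edge_shift_continuous[OF \<beta>m c\<beta> \<tau>(3)]])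
        (simp add: \<Phi>img h(1))
    show "inj_on (h \<circ> ?\<Phi>) (simplex_of \<tau>)"
      by (rule comp_inj_on) (use \<Psi>\<Phi> h(2) \<Phi>img in \<open>auto intro: inj_on_inverseI\<close>)
    show "(h \<circ> ?\<Phi>) x = g x" if x: "x \<in> simplex_of {a, b}" for x
    proof -
      have s: "x a + x b = 1" using simplex_of_sum[OF x] \<tau>(3) by simp
      have "?\<Phi> x = ?e (\<beta> (x b))"
      proof
        fix v show "?\<Phi> x v = ?e (\<beta> (x b)) v"
          using s simplex_of_support[OF x, of v] \<tau>(3) by (auto simp: edge_shift_def)
      qed
      also have "\<dots> = hi (g x)" using e\<beta>[OF E_eq(2)[OF x]] E_eq(1)[OF x] by simp
      finally show ?thesis using homeomorphism_apply2[OF hi, of "g x"] img x by auto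
    qed
    show "(h \<circ> ?\<Phi>) x = h x" if "s \<subseteq> \<tau>" "\<not> {a, b} \<subseteq> s" "x \<in> simplex_of s" for s x
    proof -
      have "x a = 0 \<or> x b = 0" using that simplex_of_support by blast
      then show ?thesis using interval_map.edge_shift_trivial[OF \<beta>m \<tau>(3)] by simp
    qed
    show "(h \<circ> ?\<Phi>) ` simplex_of s = h ` simplex_of s" if "s \<subseteq> \<tau>" for s
      using \<Phi>img[OF that] by (simp flip: image_image image_comp)
  qed
qed

text \<open>
  The union of the maps is a continuous bijection from a compact space onto a Hausdorff space.
\<close>

lemma glue_simplices:
  fixes H :: "nat set \<Rightarrow> (nat \<Rightarrow> real) \<Rightarrow> 'b::t2_space"
  assumes K: "finite K" "\<And>\<tau>. \<tau> \<in> K \<Longrightarrow> card \<tau> = 3"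
    and cont: "\<And>\<tau>. \<tau> \<in> K \<Longrightarrow> continuous_on (simplex_of \<tau>) (H \<tau>)"
    and inj: "\<And>\<tau>. \<tau> \<in> K \<Longrightarrow> inj_on (H \<tau>) (simplex_of \<tau>)"
    and agree: "\<And>\<tau> \<tau>' x. \<tau> \<in> K \<Longrightarrow> \<tau>' \<in> K \<Longrightarrow> x \<in> simplex_of (\<tau> \<inter> \<tau>') \<Longrightarrow> H \<tau> x = H \<tau>' x"
    and meet: "\<And>\<tau> \<tau>'. \<tau> \<in> K \<Longrightarrow> \<tau>' \<in> K \<Longrightarrow>
      H \<tau> ` simplex_of \<tau> \<inter> H \<tau>' ` simplex_of \<tau>' \<subseteq> H \<tau> ` simplex_of (\<tau> \<inter> \<tau>')"
  obtains f g where "homeomorphism (realization K) (\<Union>\<tau>\<in>K. H \<tau> ` simplex_of \<tau>) f g"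
    "\<And>\<tau> x. \<tau> \<in> K \<Longrightarrow> x \<in> simplex_of \<tau> \<Longrightarrow> f x = H \<tau> x"
proof -
  have fin: "finite \<tau>" if "\<tau> \<in> K" for \<tau> using K(2)[OF that] by (intro card_ge_0_finite) simp
  define f where "f x = H (SOME \<tau>. \<tau> \<in> K \<and> x \<in> simplex_of \<tau>) x" for x
  have f: "f x = H \<tau> x" if "\<tau> \<in> K" "x \<in> simplex_of \<tau>" for \<tau> x
  proof -
    let ?\<sigma> = "SOME \<tau>. \<tau> \<in> K \<and> x \<in> simplex_of \<tau>"
    have \<sigma>: "?\<sigma> \<in> K \<and> x \<in> simplex_of ?\<sigma>" by (rule someI[of _ \<tau>]) (use that in simp)
    then have "x \<in> simplex_of (?\<sigma> \<inter> \<tau>)" using simplex_of_Int[OF fin fin, of ?\<sigma> \<tau>] that by blast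
    then show ?thesis unfolding f_def using agree[of ?\<sigma> \<tau> x] \<sigma> that(1) by blast
  qed
  have comp: "compact (simplex_of \<tau>)" if "\<tau> \<in> K" for \<tau>
    using simplex_of_triangle_compact_connected(1)[OF K(2)[OF that]] .
  have "continuous_on (realization K) f"
    unfolding realization_def
  proof (rule continuous_on_closed_Union[OF K(1)])
    fix \<tau> assume \<tau>: "\<tau> \<in> K"
    show "closed (simplex_of \<tau>)" using compact_imp_closed[OF comp[OF \<tau>]] .
    show "continuous_on (simplex_of \<tau>) f" using cont[OF \<tau>] by (rule continuous_on_eq) (simp add: f[OF \<tau>])
  qed
  moreover have "compact (realization K)" unfolding realization_def using K(1) comp by (intro compact_UN) auto
  moreover have "f ` realization K = (\<Union>\<tau>\<in>K. H \<tau> ` simplex_of \<tau>)"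
    unfolding realization_def image_UN using f by (intro SUP_cong refl image_cong) auto
  moreover have "inj_on f (realization K)"
  proof (rule inj_onI)
    fix x y assume "x \<in> realization K" "y \<in> realization K" and eq: "f x = f y"
    then obtain \<tau> \<tau>' where \<tau>: "\<tau> \<in> K" "x \<in> simplex_of \<tau>" "\<tau>' \<in> K" "y \<in> simplex_of \<tau>'"
      by (auto simp: realization_def)
    have e: "H \<tau> x = H \<tau>' y" using eq f \<tau> by simp
    have "H \<tau> x \<in> H \<tau> ` simplex_of \<tau> \<inter> H \<tau>' ` simplex_of \<tau>'"
      using imageI[OF \<tau>(2), of "H \<tau>"] imageI[OF \<tau>(4), of "H \<tau>'"] e by simp
    then have "H \<tau> x \<in> H \<tau> ` simplex_of (\<tau> \<inter> \<tau>')" using meet \<tau> by blast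
    then have "x \<in> simplex_of (\<tau> \<inter> \<tau>')"
      using inj_on_image_mem_iff[OF inj[OF \<tau>(1)] \<tau>(2), of "simplex_of (\<tau> \<inter> \<tau>')"] simplex_of_mono[OF fin[OF \<tau>(1)], of "\<tau> \<inter> \<tau>'"] by blast
    moreover from this have "x \<in> simplex_of \<tau>'" using simplex_of_mono[OF fin[OF \<tau>(3)], of "\<tau> \<inter> \<tau>'"] by blast
    ultimately show "x = y" using agree[OF \<tau>(1,3)] e inj_onD[OF inj[OF \<tau>(3)] _ _ \<tau>(4)] by metis
  qed
  ultimately obtain g where "homeomorphism (realization K) (\<Union>\<tau>\<in>K. H \<tau> ` simplex_of \<tau>) f g"
    using homeomorphism_compact by metis
  then show ?thesis using that f by blast
qed

text \<open>
  The three sides can be treated one after the other, as each change leaves the other sides alone.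
\<close>

lemma reparametrize_boundary:
  fixes h :: "(nat \<Rightarrow> real) \<Rightarrow> 'b::t2_space" and g :: "nat set \<Rightarrow> (nat \<Rightarrow> real) \<Rightarrow> 'b"
  assumes \<tau>: "card \<tau> = 3"
    and h: "continuous_on (simplex_of \<tau>) h" "inj_on h (simplex_of \<tau>)"
    and g: "\<And>e. e \<subseteq> \<tau> \<Longrightarrow> card e = 2 \<Longrightarrow> continuous_on (simplex_of e) (g e)"
      "\<And>e. e \<subseteq> \<tau> \<Longrightarrow> card e = 2 \<Longrightarrow> inj_on (g e) (simplex_of e)"
      "\<And>e. e \<subseteq> \<tau> \<Longrightarrow> card e = 2 \<Longrightarrow> g e ` simplex_of e = h ` simplex_of e"
      "\<And>e i. e \<subseteq> \<tau> \<Longrightarrow> card e = 2 \<Longrightarrow> i \<in> e \<Longrightarrow> g e (vertex_pt i) = h (vertex_pt i)"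
  shows "\<exists>H. continuous_on (simplex_of \<tau>) H \<and> inj_on H (simplex_of \<tau>) \<and>
    (\<forall>s\<subseteq>\<tau>. H ` simplex_of s = h ` simplex_of s) \<and>
    (\<forall>e\<subseteq>\<tau>. card e = 2 \<longrightarrow> (\<forall>x\<in>simplex_of e. H x = g e x))"
proof -
  obtain a b c where abc: "\<tau> = {a, b, c}" "a \<noteq> b" "b \<noteq> c" "a \<noteq> c" using \<tau> by (auto simp: card_3_iff)
  have sub: "{a, b} \<subseteq> \<tau>" "{b, c} \<subseteq> \<tau>" "{a, c} \<subseteq> \<tau>" using abc by auto
  have c2: "card {a, b} = 2" "card {b, c} = 2" "card {a, c} = 2" using abc by auto
  have v: "vertex_pt i \<in> simplex_of {i}" for i by (simp add: simplex_of_singleton)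
  have s1: "{a} \<subseteq> \<tau>" "{b} \<subseteq> \<tau>" "{c} \<subseteq> \<tau>" using abc by auto
  obtain h1 where h1: "continuous_on (simplex_of \<tau>) h1" "inj_on h1 (simplex_of \<tau>)"
    "\<And>x. x \<in> simplex_of {a, b} \<Longrightarrow> h1 x = g {a, b} x"
    "\<And>s x. s \<subseteq> \<tau> \<Longrightarrow> \<not> {a, b} \<subseteq> s \<Longrightarrow> x \<in> simplex_of s \<Longrightarrow> h1 x = h x"
    "\<And>s. s \<subseteq> \<tau> \<Longrightarrow> h1 ` simplex_of s = h ` simplex_of s"
    using reparametrize_edge[OF \<tau> sub(1) abc(2) h g(1-3)[OF sub(1) c2(1)] g(4)[OF sub(1) c2(1)] g(4)[OF sub(1) c2(1)]] by auto
  have h1v: "h1 (vertex_pt i) = h (vertex_pt i)" if "i \<in> \<tau>" for i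
    using h1(4)[of "{i}" "vertex_pt i"] that abc(2) v by auto
  obtain h2 where h2: "continuous_on (simplex_of \<tau>) h2" "inj_on h2 (simplex_of \<tau>)"
    "\<And>x. x \<in> simplex_of {b, c} \<Longrightarrow> h2 x = g {b, c} x"
    "\<And>s x. s \<subseteq> \<tau> \<Longrightarrow> \<not> {b, c} \<subseteq> s \<Longrightarrow> x \<in> simplex_of s \<Longrightarrow> h2 x = h1 x"
    "\<And>s. s \<subseteq> \<tau> \<Longrightarrow> h2 ` simplex_of s = h1 ` simplex_of s"
    using reparametrize_edge[OF \<tau> sub(2) abc(3) h1(1,2) g(1,2)[OF sub(2) c2(2)]]
      g(3)[OF sub(2) c2(2)] h1(5)[OF sub(2)] g(4)[OF sub(2) c2(2)] h1v sub(2) by auto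
  have h2v: "h2 (vertex_pt i) = h (vertex_pt i)" if "i \<in> \<tau>" for i
    using h2(4)[of "{i}" "vertex_pt i"] that abc(3) v h1v by auto
  obtain h3 where h3: "continuous_on (simplex_of \<tau>) h3" "inj_on h3 (simplex_of \<tau>)"
    "\<And>x. x \<in> simplex_of {a, c} \<Longrightarrow> h3 x = g {a, c} x"
    "\<And>s x. s \<subseteq> \<tau> \<Longrightarrow> \<not> {a, c} \<subseteq> s \<Longrightarrow> x \<in> simplex_of s \<Longrightarrow> h3 x = h2 x"
    "\<And>s. s \<subseteq> \<tau> \<Longrightarrow> h3 ` simplex_of s = h2 ` simplex_of s"
    using reparametrize_edge[OF \<tau> sub(3) abc(4) h2(1,2) g(1,2)[OF sub(3) c2(3)]]
      g(3)[OF sub(3) c2(3)] h2(5)[OF sub(3)] h1(5)[OF sub(3)] g(4)[OF sub(3) c2(3)] h2v sub(3) by auto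
  have edge: "e = {a, b} \<or> e = {b, c} \<or> e = {a, c}" if e: "e \<subseteq> \<tau>" "card e = 2" for e
  proof -
    obtain p q where "e = {p, q}" "p \<noteq> q" using e(2) by (auto simp: card_2_iff)
    then show ?thesis using e(1) unfolding abc(1) by auto
  qed
  have "h3 x = g {a, b} x" if "x \<in> simplex_of {a, b}" for x
    using h3(4)[OF sub(1) _ that] h2(4)[OF sub(1) _ that] h1(3)[OF that] abc by auto
  moreover have "h3 x = g {b, c} x" if "x \<in> simplex_of {b, c}" for x
    using h3(4)[OF sub(2) _ that] h2(3)[OF that] abc by auto
  ultimately have "\<forall>e\<subseteq>\<tau>. card e = 2 \<longrightarrow> (\<forall>x\<in>simplex_of e. h3 x = g e x)" using edge h3(3) by metis
  then show ?thesis using h3(1,2,5) h2(5) h1(5) by (intro exI[of _ h3]) simp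
qed

section \<open>The tiling of the quartic\<close>

text \<open>
  The barycentric parametrization of a geodesic triangle, taken in the Klein model.
\<close>

definition tile_point :: "(nat \<Rightarrow> complex) \<Rightarrow> nat set \<Rightarrow> (nat \<Rightarrow> real) \<Rightarrow> complex" where
  "tile_point l \<tau> x = poincare_disc (\<Sum>i\<in>\<tau>. x i *\<^sub>R klein_disc (l i))"

lemma tile_point:
  assumes eq: "equilateral_htriangle \<alpha> t" and l: "bij_betw l \<tau> t"
  shows tile_point_image: "\<And>s. s \<subseteq> \<tau> \<Longrightarrow> tile_point l \<tau> ` simplex_of s = hconvex hull (l ` s)"
    and tile_point_inj: "inj_on (tile_point l \<tau>) (simplex_of \<tau>)"
    and tile_point_continuous: "continuous_on (simplex_of \<tau>) (tile_point l \<tau>)"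
proof -
  note t = equilateral_htriangle_affine_independent[OF eq]
  let ?k = "\<lambda>i. klein_disc (l i)"
  let ?b = "\<lambda>x. \<Sum>i\<in>\<tau>. x i *\<^sub>R ?k i"
  have lt: "l ` \<tau> = t" "inj_on l \<tau>" using l by (auto simp: bij_betw_def)
  have ft: "finite \<tau>" using l t(2) bij_betw_finite by blast
  have kinj: "inj_on ?k \<tau>" using comp_inj_on[of l \<tau> klein_disc] lt t(4) by (simp add: comp_def)
  have ki: "?k ` \<tau> = klein_disc ` t" using lt by (simp add: image_image[symmetric])
  have bs: "?b ` simplex_of s = convex hull (?k ` s)" if s: "s \<subseteq> \<tau>" for s
  proof -
    have "?b x = (\<Sum>i\<in>s. x i *\<^sub>R ?k i)" if x: "x \<in> simplex_of s" for x
      by (rule sum.mono_neutral_right[OF ft s]) (use simplex_of_support[OF x] in auto)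
    then have "?b ` simplex_of s = (\<lambda>x. \<Sum>i\<in>s. x i *\<^sub>R ?k i) ` simplex_of s" by simp
    then show ?thesis using barycentric_image[of s ?k] finite_subset[OF s ft] inj_on_subset[OF kinj s] by simp
  qed
  have sub: "?b ` simplex_of \<tau> \<subseteq> hdisc"
    unfolding bs[OF order_refl] ki using t(1) klein_disc_in by (intro hull_minimal) auto
  show "tile_point l \<tau> ` simplex_of s = hconvex hull (l ` s)" if s: "s \<subseteq> \<tau>" for s
  proof -
    have "tile_point l \<tau> ` simplex_of s = poincare_disc ` (?b ` simplex_of s)"
      by (simp add: tile_point_def image_image)
    also have "\<dots> = poincare_disc ` (convex hull (klein_disc ` (l ` s)))" unfolding bs[OF s] by (simp add: image_image)
    also have "\<dots> = hconvex hull (l ` s)" by (rule hconvex_hull_eq[symmetric]) (use s lt t(1) in auto)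
    finally show ?thesis .
  qed
  show "inj_on (tile_point l \<tau>) (simplex_of \<tau>)"
  proof (rule inj_onI)
    fix x y assume x: "x \<in> simplex_of \<tau>" and y: "y \<in> simplex_of \<tau>" and xy: "tile_point l \<tau> x = tile_point l \<tau> y"
    have "?b x \<in> hdisc" "?b y \<in> hdisc" using sub x y by blast+
    then have "?b x = ?b y" using xy klein_poincare_disc(1) unfolding tile_point_def by metis
    then have z: "(\<Sum>i\<in>\<tau>. (x i - y i) *\<^sub>R ?k i) = 0" by (simp add: scaleR_left_diff_distrib sum_subtractf)
    define U where "U p = x (the_inv_into \<tau> ?k p) - y (the_inv_into \<tau> ?k p)" for p
    have U: "U (?k i) = x i - y i" if "i \<in> \<tau>" for i using the_inv_into_f_f[OF kinj that] by (simp add: U_def)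
    have "(\<Sum>p\<in>?k ` \<tau>. U p *\<^sub>R p) = 0" using z U by (simp add: sum.reindex[OF kinj])
    moreover have "sum U (?k ` \<tau>) = 0"
      using U simplex_of_sum[OF x] simplex_of_sum[OF y] by (simp add: sum.reindex[OF kinj] sum_subtractf)
    ultimately have "\<forall>p\<in>?k ` \<tau>. U p = 0"
      using t(5) affine_dependent_explicit_finite[of "klein_disc ` t"] t(2) unfolding ki by auto
    then have "x i = y i" if "i \<in> \<tau>" for i using U that by force
    then show "x = y" using simplex_of_support[OF x] simplex_of_support[OF y] by (metis ext)
  qed
  have "continuous_on (simplex_of \<tau>) ?b" by (intro continuous_intros)
  then show "continuous_on (simplex_of \<tau>) (tile_point l \<tau>)"
    unfolding tile_point_def by (rule continuous_on_compose2[OF continuous_on_poincare_disc]) (use sub in auto)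
qed

lemma card_image_cong_kernel:
  assumes "\<And>s t. s \<in> A \<Longrightarrow> t \<in> A \<Longrightarrow> f s = f t \<longleftrightarrow> g s = g t"
  shows "card (f ` A) = card (g ` A)"
proof -
  define h where "h y = g (inv_into A f y)" for y
  have h: "h (f s) = g s" if "s \<in> A" for s
  proof -
    have "inv_into A f (f s) \<in> A" "f (inv_into A f (f s)) = f s"
      using inv_into_into[of "f s" f A] f_inv_into_f[of "f s" f A] that by auto
    then show ?thesis using assms that unfolding h_def by blast
  qed
  have "bij_betw h (f ` A) (g ` A)"
    unfolding bij_betw_def
  proof
    show "inj_on h (f ` A)" using h assms by (auto intro!: inj_onI)
    show "h ` f ` A = g ` A" using h by (auto simp: image_image)
  qed
  then show ?thesis by (rule bij_betw_same_card)
qed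

text \<open>
  In this context \<open>cell s\<close> is the cell of the tiling that has the points \<open>u ` s\<close> as corners, and \<open>tri\<close> is the
  abstract complex formed by the corner sets of the tiles.
\<close>

locale tiled_quartic =
  fixes u :: "complex \<Rightarrow> cp2" and A :: "complex set set"
  assumes tiling: "klein_tiling u A"
begin

definition cell :: "complex set \<Rightarrow> cp2 set" where "cell s = u ` (hconvex hull s)"
definition tri :: "cp2 set set" where "tri = (`) u ` A"

lemma uniformization: "covering_space hdisc u klein_quartic"
  and hyp: "hyperbolic_37_tiling u A" and inv: "automorphism_invariant u A" and flag: "flag_transitive u A"
  and petrie: "petrie_zigzag u A p \<Longrightarrow> p (i+8) = p i"
  using tiling by (auto simp: klein_tiling_def klein_uniformization_def)

lemma tile_equilateral: "t \<in> A \<Longrightarrow> equilateral_htriangle (2 * pi / 7) t"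
  using hyp unfolding hyperbolic_37_tiling_def by simp

lemma inj_hull: "t \<in> A \<Longrightarrow> inj_on u (hconvex hull t)"
  using hyp unfolding hyperbolic_37_tiling_def by simp

lemma tile_disc: "t \<in> A \<Longrightarrow> t \<subseteq> hdisc"
  using equilateral_htriangle_affine_independent(1)[OF tile_equilateral] .

lemma tile_card: "t \<in> A \<Longrightarrow> card t = 3"
  using equilateral_htriangle_affine_independent(3)[OF tile_equilateral] .

lemma tile_finite: "t \<in> A \<Longrightarrow> finite t"
  using equilateral_htriangle_affine_independent(2)[OF tile_equilateral] .

lemma cell_mono: "s \<subseteq> t \<Longrightarrow> cell s \<subseteq> cell t"
  unfolding cell_def by (rule image_mono[OF hull_mono])

lemma tile_param:
  assumes "t \<in> A" obtains l \<tau> where "bij_betw l \<tau> t" "\<tau> = {0..<3::nat}"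
  using ex_bij_betw_nat_finite[OF tile_finite[OF assms]] tile_card[OF assms] by metis

lemma cell_param:
  assumes "t \<in> A" "bij_betw l \<tau> t"
  shows "\<And>s. s \<subseteq> \<tau> \<Longrightarrow> (u \<circ> tile_point l \<tau>) ` simplex_of s = cell (l ` s)"
    "inj_on (u \<circ> tile_point l \<tau>) (simplex_of \<tau>)" "continuous_on (simplex_of \<tau>) (u \<circ> tile_point l \<tau>)"
proof -
  note tp = tile_point[OF tile_equilateral[OF assms(1)] assms(2)]
  have lt: "l ` \<tau> = t" using assms(2) by (auto simp: bij_betw_def)
  have full: "tile_point l \<tau> ` simplex_of \<tau> = hconvex hull t" using tp(1)[OF order_refl] lt by simp
  show "(u \<circ> tile_point l \<tau>) ` simplex_of s = cell (l ` s)" if "s \<subseteq> \<tau>" for s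
    using tp(1)[OF that] unfolding cell_def image_comp[symmetric] by simp
  show "inj_on (u \<circ> tile_point l \<tau>) (simplex_of \<tau>)"
    by (rule comp_inj_on[OF tp(2)]) (simp add: full inj_hull[OF assms(1)])
  have "hconvex hdisc" by (auto simp: hconvex_def hsegment_def)
  then have "hconvex hull t \<subseteq> hdisc" by (rule hull_minimal[where S = hconvex, OF tile_disc[OF assms(1)]])
  then show "continuous_on (simplex_of \<tau>) (u \<circ> tile_point l \<tau>)"
    using covering_space_imp_continuous[OF uniformization] full
    by (intro continuous_on_compose[OF tp(3)]) (auto intro: continuous_on_subset)
qed

lemma cell_Int:
  assumes t: "t \<in> A" and s: "s \<subseteq> t" "s' \<subseteq> t"
  shows "cell s \<inter> cell s' = cell (s \<inter> s')"
proof -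
  obtain l \<tau> where l: "bij_betw l \<tau> t" "\<tau> = {0..<3::nat}" using tile_param[OF t] .
  note cp = cell_param[OF t l(1)]
  let ?p = "\<lambda>s. {i \<in> \<tau>. l i \<in> s}"
  have lp: "l ` ?p r = r" if "r \<subseteq> t" for r using l(1) that by (auto simp: bij_betw_def)
  have ft: "finite \<tau>" using l(2) by simp
  have c: "cell r = (u \<circ> tile_point l \<tau>) ` simplex_of (?p r)" if "r \<subseteq> t" for r
    using cp(1)[of "?p r"] lp[OF that] by auto
  have sub: "simplex_of (?p r) \<subseteq> simplex_of \<tau>" for r by (rule simplex_of_mono[OF ft]) auto
  have "cell s \<inter> cell s' = (u \<circ> tile_point l \<tau>) ` (simplex_of (?p s) \<inter> simplex_of (?p s'))"
    unfolding c[OF s(1)] c[OF s(2)] using inj_on_image_Int[OF cp(2) sub sub] by simp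
  also have "simplex_of (?p s) \<inter> simplex_of (?p s') = simplex_of (?p s \<inter> ?p s')"
    by (rule simplex_of_Int) (use ft in auto)
  also have "?p s \<inter> ?p s' = ?p (s \<inter> s')" by auto
  also have "(u \<circ> tile_point l \<tau>) ` simplex_of (?p (s \<inter> s')) = cell (s \<inter> s')" using c[of "s \<inter> s'"] s by auto
  finally show ?thesis .
qed

lemma cell_singleton: assumes "t \<in> A" "a \<in> t" shows "cell {a} = {u a}"
proof -
  have a: "a \<in> hdisc" using assms tile_disc by blast
  have "hconvex hull {a} = poincare_disc ` (convex hull (klein_disc ` {a}))" by (rule hconvex_hull_eq) (use a in auto)
  also have "\<dots> = {a}" using poincare_klein_disc[OF a] by simp
  finally show ?thesis by (simp add: cell_def)
qed

lemma cell_empty: "cell {} = {}"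
  using hconvex_hull_eq[of "{}"] by (simp add: cell_def)

lemma corner_in_cell: assumes "t \<in> A" "a \<in> t" "s \<subseteq> t" shows "u a \<in> cell s \<longleftrightarrow> a \<in> s"
proof
  assume "u a \<in> cell s"
  then have "cell ({a} \<inter> s) \<noteq> {}" using cell_Int[OF assms(1), of "{a}" s] assms cell_singleton by auto
  then show "a \<in> s" using cell_empty by (cases "a \<in> s") auto
next
  assume "a \<in> s"
  then show "u a \<in> cell s" unfolding cell_def by (intro imageI hull_inc)
qed

lemma inj_corners: assumes "t \<in> A" shows "inj_on u t"
  by (rule inj_on_subset[OF inj_hull[OF assms] hull_subset])

lemma card_corners: "t \<in> A \<Longrightarrow> card (u ` t) = 3"
  using card_image[OF inj_corners] tile_card by simp

text \<open>
  The common face of two tiles is spanned by all of their common corners, because a corner of a tile lies in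
  one of its faces only if it is a corner of that face.
\<close>

lemma tiles_meet:
  assumes "s \<in> A" "t \<in> A"
  obtains s' t' where "s' \<subseteq> s" "t' \<subseteq> t" "u ` s' = u ` s \<inter> u ` t" "u ` t' = u ` s \<inter> u ` t"
    "cell s \<inter> cell t = cell s'" "cell s \<inter> cell t = cell t'"
proof -
  obtain s' t' where m: "s' \<subseteq> s" "t' \<subseteq> t" "u ` s' = u ` t'" "cell s \<inter> cell t = cell s'" "cell s \<inter> cell t = cell t'"
    using hyp assms unfolding hyperbolic_37_tiling_def cell_def by meson
  have "u ` s' = u ` s \<inter> u ` t"
  proof
    show "u ` s' \<subseteq> u ` s \<inter> u ` t" using m(1,2,3) by blast
    show "u ` s \<inter> u ` t \<subseteq> u ` s'"
    proof
      fix p assume "p \<in> u ` s \<inter> u ` t"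
      then obtain a b where ab: "a \<in> s" "p = u a" "b \<in> t" "p = u b" by blast
      then have "p \<in> cell s'" using m(4) corner_in_cell[OF assms(1) ab(1) order_refl] corner_in_cell[OF assms(2) ab(3) order_refl] by auto
      then show "p \<in> u ` s'" using corner_in_cell[OF assms(1) ab(1) m(1)] ab(2) by blast
    qed
  qed
  then show ?thesis using that m by metis
qed

lemma tile_eq_iff: assumes "s \<in> A" "t \<in> A" shows "cell s = cell t \<longleftrightarrow> u ` s = u ` t"
proof -
  obtain s' t' where m: "s' \<subseteq> s" "t' \<subseteq> t" "u ` s' = u ` s \<inter> u ` t" "u ` t' = u ` s \<inter> u ` t"
    "cell s \<inter> cell t = cell s'" "cell s \<inter> cell t = cell t'" using tiles_meet[OF assms] .
  have full: "r' = r" if "r \<in> A" "r' \<subseteq> r" "u ` r' = u ` r" for r r'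
    using inj_on_image_eq_iff[OF inj_corners[OF that(1)] that(2) order_refl] that(3) by simp
  show ?thesis
  proof
    assume "u ` s = u ` t"
    then have "s' = s" "t' = t" using full[OF assms(1) m(1)] full[OF assms(2) m(2)] m(3,4) by auto
    then show "cell s = cell t" using m(5,6) by blast
  next
    assume eq: "cell s = cell t"
    have "a \<in> s'" if "a \<in> s" for a
      using corner_in_cell[OF assms(1) that order_refl] corner_in_cell[OF assms(1) that m(1)] that eq m(5) by auto
    moreover have "a \<in> t'" if "a \<in> t" for a
      using corner_in_cell[OF assms(2) that order_refl] corner_in_cell[OF assms(2) that m(2)] that eq m(6) by auto
    ultimately have "s' = s" "t' = t" using m(1,2) by auto
    then show "u ` s = u ` t" using m(3,4) by simp
  qed
qed

lemma vertex_in_tile: assumes "s \<in> A" "t \<in> A" "a \<in> s" shows "u a \<in> cell t \<longleftrightarrow> u a \<in> u ` t"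
proof
  obtain s' t' where m: "s' \<subseteq> s" "u ` s' = u ` s \<inter> u ` t" "cell s \<inter> cell t = cell s'" using tiles_meet[OF assms(1,2)] by metis
  assume "u a \<in> cell t"
  then have "u a \<in> cell s'" using m(3) corner_in_cell[OF assms(1,3) order_refl] assms(3) by blast
  then show "u a \<in> u ` t" using corner_in_cell[OF assms(1,3) m(1)] m(2) by blast
next
  assume "u a \<in> u ` t"
  then show "u a \<in> cell t" using corner_in_cell[OF assms(2) _ order_refl] by force
qed

lemma tiling_cells_3: "tiling_cells u A 3 = cell ` A"
proof
  show "tiling_cells u A 3 \<subseteq> cell ` A"
  proof
    fix F assume "F \<in> tiling_cells u A 3"
    then obtain s t where "F = cell s" "t \<in> A" "s \<subseteq> t" "card s = 3" by (auto simp: tiling_cells_def cell_def)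
    moreover from this have "s = t" using card_subset_eq[OF tile_finite] tile_card by metis
    ultimately show "F \<in> cell ` A" by blast
  qed
  show "cell ` A \<subseteq> tiling_cells u A 3" using tile_card by (auto simp: tiling_cells_def cell_def)
qed

lemma tile_cell_kernel: "s \<in> A \<Longrightarrow> t \<in> A \<Longrightarrow> u ` s = u ` t \<longleftrightarrow> cell s = cell t"
  using tile_eq_iff by blast

lemma card_tri: "card tri = 56"
proof -
  have "card tri = card (cell ` A)" unfolding tri_def by (rule card_image_cong_kernel) (rule tile_cell_kernel)
  then show ?thesis using hyp tiling_cells_3 by (simp add: hyperbolic_37_tiling_def)
qed

lemma card_filter_tri:
  assumes "\<And>t. t \<in> A \<Longrightarrow> P (u ` t) \<longleftrightarrow> Q (cell t)"
  shows "card {\<tau> \<in> tri. P \<tau>} = card {F \<in> cell ` A. Q F}"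
proof -
  have "{\<tau> \<in> tri. P \<tau>} = (`) u ` {t \<in> A. P (u ` t)}" "{F \<in> cell ` A. Q F} = cell ` {t \<in> A. P (u ` t)}"
    using assms by (auto simp: tri_def)
  then show ?thesis using card_image_cong_kernel[of "{t \<in> A. P (u ` t)}" "(`) u" cell] tile_cell_kernel by simp
qed

lemma card_star_tri: assumes "v \<in> \<Union>tri" shows "card {\<tau> \<in> tri. v \<in> \<tau>} = 7"
proof -
  obtain s a where a: "s \<in> A" "a \<in> s" "v = u a" using assms by (auto simp: tri_def)
  have "card {\<tau> \<in> tri. v \<in> \<tau>} = card {F \<in> cell ` A. v \<in> F}"
    by (rule card_filter_tri) (use vertex_in_tile[OF a(1) _ a(2)] a(3) in simp)
  also have "\<dots> = 7" using hyp a unfolding tiling_cells_3[symmetric] by (auto simp: hyperbolic_37_tiling_def)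
  finally show ?thesis .
qed

lemma card_vertices: "card (\<Union>tri) = 24"
proof -
  have "tiling_cells u A 1 = (\<lambda>v. {v}) ` \<Union>tri"
  proof
    show "tiling_cells u A 1 \<subseteq> (\<lambda>v. {v}) ` \<Union>tri"
    proof
      fix F assume "F \<in> tiling_cells u A 1"
      then obtain s t where "F = cell s" "t \<in> A" "s \<subseteq> t" "card s = 1" by (auto simp: tiling_cells_def cell_def)
      moreover from this obtain a where "s = {a}" by (auto simp: card_1_singleton_iff)
      ultimately show "F \<in> (\<lambda>v. {v}) ` \<Union>tri" using cell_singleton by (force simp: tri_def)
    qed
    show "(\<lambda>v. {v}) ` \<Union>tri \<subseteq> tiling_cells u A 1"
    proof clarify
      fix v \<tau> assume "v \<in> \<tau>" "\<tau> \<in> tri"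
      then obtain t a where "t \<in> A" "a \<in> t" "v = u a" by (auto simp: tri_def)
      then have "{v} = cell {a}" "{a} \<subseteq> t" "card {a} = 1" "t \<in> A" using cell_singleton by auto
      then show "{v} \<in> tiling_cells u A 1" unfolding tiling_cells_def cell_def by blast
    qed
  qed
  then have "card (tiling_cells u A 1) = card (\<Union>tri)" by (simp add: card_image)
  then show ?thesis using hyp by (simp add: hyperbolic_37_tiling_def)
qed

lemma tri_cases:
  assumes "\<tau> \<in> tri" obtains t where "t \<in> A" "\<tau> = u ` t"
  using assms by (auto simp: tri_def)

lemma finite_tri: "finite tri" using card_tri by (intro card_ge_0_finite) simp

lemma card_tri_member: "\<tau> \<in> tri \<Longrightarrow> card \<tau> = 3"
  using card_corners by (auto simp: tri_def)

text \<open>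
  This turns the combinatorial incidence of edges and tiles into an inclusion of sets, which every
  bijection of the quartic respects.
\<close>

lemma edge_in_tile_iff:
  assumes "s \<in> A" "t \<in> A" "{a, b} \<subseteq> s"
  shows "cell {a, b} \<subseteq> cell t \<longleftrightarrow> {u a, u b} \<subseteq> u ` t"
proof
  assume "cell {a, b} \<subseteq> cell t"
  moreover have "u a \<in> cell {a, b}" "u b \<in> cell {a, b}" using corner_in_cell[OF assms(1) _ assms(3)] assms(3) by auto
  ultimately show "{u a, u b} \<subseteq> u ` t" using vertex_in_tile[OF assms(1,2)] assms(3) by auto
next
  assume R: "{u a, u b} \<subseteq> u ` t"
  obtain s' where m: "s' \<subseteq> s" "u ` s' = u ` s \<inter> u ` t" "cell s \<inter> cell t = cell s'" using tiles_meet[OF assms(1,2)] by metis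
  have "u a \<in> u ` s'" "u b \<in> u ` s'" using R assms(3) m(2) by auto
  then have "a \<in> s'" "b \<in> s'" using inj_on_image_mem_iff[OF inj_corners[OF assms(1)] _ m(1)] assms(3) by auto
  then show "cell {a, b} \<subseteq> cell t" using cell_mono[of "{a, b}" s'] m(3) by auto
qed

lemma vertices_of_cell:
  assumes "t \<in> A" "s \<subseteq> t" shows "\<Union>tri \<inter> cell s = u ` s"
proof
  show "\<Union>tri \<inter> cell s \<subseteq> u ` s"
  proof
    fix v assume v: "v \<in> \<Union>tri \<inter> cell s"
    then obtain r b where "r \<in> A" "b \<in> r" "v = u b" by (auto simp: tri_def)
    then have "v \<in> u ` t" using v cell_mono[OF assms(2)] vertex_in_tile[of r t b] assms(1) by blast
    then obtain a where a: "a \<in> t" "v = u a" by blast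
    then have "a \<in> s" using corner_in_cell[OF assms(1) a(1) assms(2)] v by simp
    then show "v \<in> u ` s" using a(2) by simp
  qed
  show "u ` s \<subseteq> \<Union>tri \<inter> cell s" using assms corner_in_cell[OF assms(1) _ assms(2)] by (auto simp: tri_def)
qed

lemma automorphism_bij: "\<phi> \<in> klein_automorphisms u \<Longrightarrow> bij_betw \<phi> klein_quartic klein_quartic"
  by (simp add: klein_automorphisms_def)

lemma automorphism_tile: "\<phi> \<in> klein_automorphisms u \<Longrightarrow> F \<in> cell ` A \<Longrightarrow> \<phi> ` F \<in> cell ` A"
  using inv unfolding automorphism_invariant_def tiling_cells_3 by blast

lemma flag_automorphism_exists:
  assumes "{a, b, c} \<in> A" "{a', b', c'} \<in> A"
  shows "\<exists>\<phi>\<in>klein_automorphisms u. \<phi> (u a) = u a' \<and> \<phi> ` cell {a, b} = cell {a', b'} \<and>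
    \<phi> ` cell {a, b, c} = cell {a', b', c'}"
  using flag[unfolded flag_transitive_def, rule_format, OF conjI[OF assms]] unfolding cell_def .

lemma tile_subset: "F \<in> cell ` A \<Longrightarrow> F \<subseteq> klein_quartic"
  using hyp tiling_cells_3 by (auto simp: hyperbolic_37_tiling_def)

lemma finite_tiles: "finite (cell ` A)"
proof -
  have "card (cell ` A) = 56" using hyp tiling_cells_3 by (simp add: hyperbolic_37_tiling_def)
  then show ?thesis by (intro card_ge_0_finite) simp
qed

lemma tiles_containing_le:
  assumes \<phi>: "\<phi> \<in> klein_automorphisms u" and E: "E \<subseteq> klein_quartic"
  shows "card {F \<in> cell ` A. E \<subseteq> F} \<le> card {F \<in> cell ` A. \<phi> ` E \<subseteq> F}"
proof (rule card_inj_on_le)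
  have "inj_on \<phi> klein_quartic" using automorphism_bij[OF \<phi>] by (simp add: bij_betw_def)
  then show "inj_on ((`) \<phi>) {F \<in> cell ` A. E \<subseteq> F}"
    using tile_subset by (intro inj_onI) (metis (no_types, lifting) inj_on_image_eq_iff mem_Collect_eq)
  show "(`) \<phi> ` {F \<in> cell ` A. E \<subseteq> F} \<subseteq> {F \<in> cell ` A. \<phi> ` E \<subseteq> F}"
    using automorphism_tile[OF \<phi>] by blast
  show "finite {F \<in> cell ` A. \<phi> ` E \<subseteq> F}" using finite_tiles by simp
qed

definition edge_degree :: "cp2 set \<Rightarrow> nat" where "edge_degree \<sigma> = card {\<tau> \<in> tri. \<sigma> \<subseteq> \<tau>}"

lemma edge_degree_eq:
  assumes "s \<in> A" "{a, b} \<subseteq> s" shows "edge_degree {u a, u b} = card {F \<in> cell ` A. cell {a, b} \<subseteq> F}"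
  unfolding edge_degree_def by (rule card_filter_tri) (use edge_in_tile_iff[OF assms(1) _ assms(2)] in simp)

text \<open>
  An automorphism that takes one edge to another one maps the tiles containing the first injectively to
  the tiles containing the second.
\<close>

lemma edge_degree_const:
  assumes "{a, b, c} \<in> A" "{a', b', c'} \<in> A" shows "edge_degree {u a, u b} = edge_degree {u a', u b'}"
proof -
  have le: "edge_degree {u a, u b} \<le> edge_degree {u a', u b'}" if abc: "{a, b, c} \<in> A" "{a', b', c'} \<in> A" for a b c a' b' c'
  proof -
    obtain \<phi> where \<phi>: "\<phi> \<in> klein_automorphisms u" "\<phi> ` cell {a, b} = cell {a', b'}"
      using flag_automorphism_exists[OF abc] by blast
    have "cell {a, b} \<subseteq> klein_quartic" using cell_mono[of "{a, b}" "{a, b, c}"] tile_subset that(1) by blast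
    from tiles_containing_le[OF \<phi>(1) this] show ?thesis
      using edge_degree_eq[OF that(1), of a b] edge_degree_eq[OF that(2), of a' b'] \<phi>(2) by auto
  qed
  show ?thesis using le[OF assms] le[OF assms(2,1)] by simp
qed

definition edges :: "cp2 set set" where "edges = {\<sigma>. card \<sigma> = 2 \<and> (\<exists>\<tau>\<in>tri. \<sigma> \<subseteq> \<tau>)}"

lemma edge_lift:
  assumes "\<tau> \<in> tri" "\<sigma> \<subseteq> \<tau>" "card \<sigma> = 2"
  obtains a b c where "{a, b, c} \<in> A" "distinct [a, b, c]" "\<sigma> = {u a, u b}" "\<tau> = u ` {a, b, c}"
proof -
  obtain t where t: "t \<in> A" "\<tau> = u ` t" using tri_cases[OF assms(1)] .
  then obtain s where s: "s \<subseteq> t" "\<sigma> = u ` s" using assms(2) by (metis subset_imageE)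
  have "card s = 2" using card_image[OF inj_on_subset[OF inj_corners[OF t(1)] s(1)]] s(2) assms(3) by simp
  then obtain a b where ab: "s = {a, b}" "a \<noteq> b" by (auto simp: card_2_iff)
  have "card (t - {a, b}) = 1" using tile_card[OF t(1)] s(1) ab tile_finite[OF t(1)] by (simp add: card_Diff_subset)
  then obtain c where "t - {a, b} = {c}" by (auto simp: card_1_singleton_iff)
  then have "t = {a, b, c}" "c \<noteq> a" "c \<noteq> b" using s(1) ab by auto
  then show ?thesis using that t s ab by auto
qed

lemma finite_edges: "finite edges"
proof -
  have "edges \<subseteq> Pow (\<Union>tri)" by (auto simp: edges_def)
  moreover have "finite (\<Union>tri)" using card_vertices by (intro card_ge_0_finite) simp
  ultimately show ?thesis using finite_subset by blast
qed

lemma edge_degree_const_edges: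
  assumes "\<sigma> \<in> edges" "\<sigma>' \<in> edges" shows "edge_degree \<sigma> = edge_degree \<sigma>'"
proof -
  obtain \<tau> \<tau>' where "\<tau> \<in> tri" "\<sigma> \<subseteq> \<tau>" "card \<sigma> = 2" "\<tau>' \<in> tri" "\<sigma>' \<subseteq> \<tau>'" "card \<sigma>' = 2"
    using assms by (auto simp: edges_def)
  then show ?thesis using edge_lift edge_degree_const by metis
qed

lemma sum_edge_degree: "(\<Sum>\<sigma>\<in>edges. edge_degree \<sigma>) = 168"
proof -
  have "(\<Sum>\<tau>\<in>tri. card {\<sigma> \<in> edges. \<sigma> \<subseteq> \<tau>}) = (\<Sum>\<sigma>\<in>edges. edge_degree \<sigma>)"
    by (rule sum_multicount_gen[OF finite_tri finite_edges]) (simp add: edge_degree_def)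
  moreover have "card {\<sigma> \<in> edges. \<sigma> \<subseteq> \<tau>} = 3" if "\<tau> \<in> tri" for \<tau>
  proof -
    have f: "finite \<tau>" "card \<tau> = 3" using card_tri_member[OF that] by (auto intro!: card_ge_0_finite)
    have "{\<sigma> \<in> edges. \<sigma> \<subseteq> \<tau>} = {\<sigma>. \<sigma> \<subseteq> \<tau> \<and> card \<sigma> = 2}" using that by (auto simp: edges_def)
    then show ?thesis using n_subsets[OF f(1), of 2] f(2) by (simp add: choose_two)
  qed
  ultimately show ?thesis using card_tri by simp
qed

definition edge_cells :: "cp2 set set" where "edge_cells = tiling_cells u A 2"

lemma edge_cells_cases:
  assumes "E \<in> edge_cells" obtains a b c where "{a, b, c} \<in> A" "distinct [a, b, c]" "E = cell {a, b}"
proof -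
  obtain s t where s: "E = cell s" "t \<in> A" "s \<subseteq> t" "card s = 2"
    using assms by (auto simp: edge_cells_def tiling_cells_def cell_def)
  then obtain a b where ab: "s = {a, b}" "a \<noteq> b" by (auto simp: card_2_iff)
  have "card (t - {a, b}) = 1" using tile_card[OF s(2)] s ab tile_finite[OF s(2)] by (simp add: card_Diff_subset)
  then obtain c where "t - {a, b} = {c}" by (auto simp: card_1_singleton_iff)
  then have "t = {a, b, c}" "c \<noteq> a" "c \<noteq> b" using s ab by auto
  then show ?thesis using that s ab by auto
qed

lemma edge_cells_corners: "(\<lambda>E. \<Union>tri \<inter> E) ` edge_cells = edges"
proof
  show "(\<lambda>E. \<Union>tri \<inter> E) ` edge_cells \<subseteq> edges"
  proof clarify
    fix E assume "E \<in> edge_cells"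
    then obtain a b c where abc: "{a, b, c} \<in> A" "distinct [a, b, c]" "E = cell {a, b}" by (rule edge_cells_cases)
    have eq: "\<Union>tri \<inter> E = u ` {a, b}" unfolding abc(3) by (rule vertices_of_cell[OF abc(1)]) simp
    have 2: "card (u ` {a, b}) = 2"
      using card_image[OF inj_on_subset[OF inj_corners[OF abc(1)], of "{a, b}"]] abc(2) by auto
    have tri: "u ` {a, b, c} \<in> tri" unfolding tri_def using abc(1) by (rule imageI)
    show "\<Union>tri \<inter> E \<in> edges" unfolding edges_def eq using 2
      by (intro CollectI conjI bexI[OF _ tri] image_mono) auto
  qed
  show "edges \<subseteq> (\<lambda>E. \<Union>tri \<inter> E) ` edge_cells"
  proof
    fix \<sigma> assume "\<sigma> \<in> edges"
    then obtain \<tau> where "\<tau> \<in> tri" "\<sigma> \<subseteq> \<tau>" "card \<sigma> = 2" by (auto simp: edges_def)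
    then obtain a b c where abc: "{a, b, c} \<in> A" "distinct [a, b, c]" "\<sigma> = {u a, u b}" by (rule edge_lift)
    have "\<Union>tri \<inter> cell {a, b} = \<sigma>" using vertices_of_cell[OF abc(1), of "{a, b}"] abc(3) by auto
    moreover have "cell {a, b} \<in> edge_cells" using abc(1,2) unfolding edge_cells_def tiling_cells_def cell_def
      by (intro CollectI exI[of _ "{a, b}"] exI[of _ "{a, b, c}"]) auto
    ultimately show "\<sigma> \<in> (\<lambda>E. \<Union>tri \<inter> E) ` edge_cells" by blast
  qed
qed

lemma card_edge_cells: "card edge_cells = 84" "finite edge_cells"
proof -
  show *: "card edge_cells = 84" using hyp by (simp add: edge_cells_def hyperbolic_37_tiling_def)
  then show "finite edge_cells" by (intro card_ge_0_finite) simp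
qed

text \<open>
  The 84 edge cells map onto the pairs of adjacent corners, so there are at most 84 such pairs, and the
  56 tiles have 168 sides.
\<close>

lemma edge_degree_ge_2: assumes "\<sigma> \<in> edges" shows "edge_degree \<sigma> \<ge> 2"
proof (rule ccontr)
  assume "\<not> edge_degree \<sigma> \<ge> 2"
  then have "(\<Sum>\<sigma>\<in>edges. edge_degree \<sigma>) \<le> (\<Sum>\<sigma>\<in>edges. 1)"
    using edge_degree_const_edges[OF assms] by (intro sum_mono) simp
  moreover have "card edges \<le> 84" using card_image_le[OF card_edge_cells(2), of "\<lambda>E. \<Union>tri \<inter> E"] edge_cells_corners card_edge_cells by simp
  ultimately show False using sum_edge_degree by simp
qed

text \<open>
  Two different tiles have at most two common corners, hence meet exactly in the common side.
\<close>

lemma face_cell_unique_distinct: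
  assumes "s \<in> A" "t \<in> A" "s' \<subseteq> s" "t' \<subseteq> t" "u ` s' = u ` t'" "card s' = 2" "u ` s \<noteq> u ` t"
  shows "cell s' = cell t'"
proof -
  obtain s'' t'' where m: "s'' \<subseteq> s" "t'' \<subseteq> t" "u ` s'' = u ` s \<inter> u ` t" "u ` t'' = u ` s \<inter> u ` t"
    "cell s \<inter> cell t = cell s''" "cell s \<inter> cell t = cell t''" using tiles_meet[OF assms(1,2)] .
  have c: "card (u ` s') = 2" using card_image[OF inj_on_subset[OF inj_corners[OF assms(1)] assms(3)]] assms(6) by simp
  have sub: "u ` s' \<subseteq> u ` s \<inter> u ` t" using assms(3-5) by blast
  have "u ` s \<inter> u ` t \<noteq> u ` s"
  proof
    assume "u ` s \<inter> u ` t = u ` s"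
    then have "u ` s \<subseteq> u ` t" by blast
    then have "u ` s = u ` t" using card_subset_eq[of "u ` t" "u ` s"] card_corners assms(1,2) tile_finite by simp
    then show False using assms(7) by simp
  qed
  then have "card (u ` s \<inter> u ` t) < 3"
    using psubset_card_mono[of "u ` s" "u ` s \<inter> u ` t"] card_corners[OF assms(1)] tile_finite[OF assms(1)] by auto
  then have eq: "u ` s' = u ` s \<inter> u ` t"
    using card_seteq[of "u ` s \<inter> u ` t" "u ` s'"] sub c tile_finite[OF assms(1)] by simp
  have "s' = s''" using inj_on_image_eq_iff[OF inj_corners[OF assms(1)] assms(3) m(1)] m(3) eq by simp
  moreover have "t' = t''" using inj_on_image_eq_iff[OF inj_corners[OF assms(2)] assms(4) m(2)] m(4) eq assms(5) by simp
  ultimately show ?thesis using m(5,6) by simp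
qed

text \<open>
  Two members of \<open>A\<close> may lie over the same tile; the sides of both with given ends are then compared through
  the tile on the other side, which exists by \<open>edge_degree_ge_2\<close>.
\<close>

lemma face_cell_unique:
  assumes "s \<in> A" "t \<in> A" "s' \<subseteq> s" "t' \<subseteq> t" "u ` s' = u ` t'"
  shows "cell s' = cell t'"
proof -
  have cs: "card (u ` s') = card s'" "card (u ` t') = card t'"
    using card_image inj_on_subset inj_corners assms by metis+
  have fs: "finite s'" "finite t'" using assms tile_finite finite_subset by blast+
  have "card s' \<le> 3" using card_mono[OF tile_finite[OF assms(1)] assms(3)] tile_card[OF assms(1)] by simp
  then consider "card s' = 0" | "card s' = 1" | "card s' = 2" | "card s' = 3" by linarith
  then show ?thesis
  proof cases
    case 1
    then have "s' = {}" "t' = {}" using fs assms(5) by auto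
    then show ?thesis by simp
  next
    case 2
    then have "card t' = 1" using cs assms(5) by simp
    then obtain a b where "s' = {a}" "t' = {b}" using 2 by (auto simp: card_1_singleton_iff)
    then show ?thesis using cell_singleton assms by auto
  next
    case 4
    then have "s' = s" "t' = t"
      using card_subset_eq[OF tile_finite[OF assms(1)] assms(3)] card_subset_eq[OF tile_finite[OF assms(2)] assms(4)]
        tile_card assms(1,2,5) cs by auto
    then show ?thesis using tile_eq_iff assms by simp
  next
    case 3
    show ?thesis
    proof (cases "u ` s = u ` t")
      case False
      show ?thesis by (rule face_cell_unique_distinct[OF assms 3 False])
    next
      case True
      have "u ` s' \<in> edges" using 3 cs assms(1,3) by (auto simp: edges_def tri_def)
      then have "card {\<tau> \<in> tri. u ` s' \<subseteq> \<tau>} \<ge> 2" using edge_degree_ge_2 unfolding edge_degree_def by simp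
      then have "\<not> {\<tau> \<in> tri. u ` s' \<subseteq> \<tau>} \<subseteq> {u ` s}"
        using card_mono[of "{u ` s}" "{\<tau> \<in> tri. u ` s' \<subseteq> \<tau>}"] by auto
      then obtain \<rho> where "\<rho> \<in> tri" "u ` s' \<subseteq> \<rho>" "\<rho> \<noteq> u ` s" by blast
      then obtain r where r: "r \<in> A" "u ` r \<noteq> u ` s" "u ` s' \<subseteq> u ` r" by (metis tri_cases)
      then obtain r' where r': "r' \<subseteq> r" "u ` s' = u ` r'" by (metis subset_imageE)
      have "cell s' = cell r'" using face_cell_unique_distinct[OF assms(1) r(1) assms(3) r'] 3 r(2) by simp
      moreover have "cell t' = cell r'"
        using face_cell_unique_distinct[OF assms(2) r(1) assms(4) r'(1)] 3 r'(2) r(2) assms(5) cs True by simp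
      ultimately show ?thesis by simp
    qed
  qed
qed

text \<open>
  An edge cell is determined by its ends, so there are exactly 84 pairs of adjacent corners, with 168
  incidences.
\<close>

lemma edge_degree_2: assumes "\<sigma> \<in> edges" shows "edge_degree \<sigma> = 2"
proof -
  have "inj_on (\<lambda>E. \<Union>tri \<inter> E) edge_cells"
  proof (rule inj_onI)
    fix E E' assume "E \<in> edge_cells" "E' \<in> edge_cells" and eq: "\<Union>tri \<inter> E = \<Union>tri \<inter> E'"
    then obtain a b c a' b' c' where abc: "{a, b, c} \<in> A" "E = cell {a, b}" "{a', b', c'} \<in> A" "E' = cell {a', b'}"
      by (metis edge_cells_cases)
    have "\<Union>tri \<inter> E = u ` {a, b}" "\<Union>tri \<inter> E' = u ` {a', b'}"
      using vertices_of_cell[OF abc(1), of "{a, b}"] vertices_of_cell[OF abc(3), of "{a', b'}"] abc by auto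
    then show "E = E'" using face_cell_unique[OF abc(1,3), of "{a, b}" "{a', b'}"] abc eq by auto
  qed
  then have "card edges = 84" using card_image edge_cells_corners card_edge_cells by metis
  moreover have "(\<Sum>\<sigma>'\<in>edges. edge_degree \<sigma>') = card edges * edge_degree \<sigma>"
    using edge_degree_const_edges[OF _ assms] by simp
  ultimately show ?thesis using sum_edge_degree by simp
qed

end

context tiled_quartic
begin

lemma shared_edge:
  assumes t: "t \<in> A" "r \<in> A" "x \<in> cell t" "x \<in> cell r" and x: "x \<notin> \<Union>tri" and ne: "cell t \<noteq> cell r"
  obtains s where "s \<subseteq> t" "card s = 2" "x \<in> cell s" "u ` s \<subseteq> u ` r"
proof -
  obtain s where m: "s \<subseteq> t" "u ` s = u ` t \<inter> u ` r" "cell t \<inter> cell r = cell s" using tiles_meet[OF t(1,2)] by metis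
  have xs: "x \<in> cell s" using m(3) t(3,4) by blast
  have fs: "finite s" using m(1) tile_finite[OF t(1)] finite_subset by blast
  have "card s \<noteq> 0" using xs cell_empty fs by auto
  moreover have "card s \<noteq> 1"
  proof
    assume "card s = 1"
    then obtain a where "s = {a}" by (auto simp: card_1_singleton_iff)
    then have "x = u a" "a \<in> t" using xs m(1) cell_singleton[OF t(1)] by auto
    then show False using x t(1) by (auto simp: tri_def)
  qed
  moreover have "card s \<noteq> 3"
  proof
    assume "card s = 3"
    then have "s = t" using card_subset_eq[OF tile_finite[OF t(1)] m(1)] tile_card[OF t(1)] by simp
    then have "u ` t \<subseteq> u ` r" using m(2) by blast
    then have "u ` t = u ` r" using card_subset_eq[of "u ` r" "u ` t"] card_corners t tile_finite by simp
    then show False using ne tile_eq_iff t by blast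
  qed
  moreover have "card s \<le> 3" using card_mono[OF tile_finite[OF t(1)] m(1)] tile_card[OF t(1)] by simp
  ultimately have "card s = 2" by linarith
  then show ?thesis using that m xs by blast
qed

text \<open>
  Any two tiles through a point that is not a vertex share an edge through that point, and a tile has only
  one edge through it.  Since seven tiles meet at a vertex, this characterizes the vertices by the number of
  tiles through them, and automorphisms preserve this number.
\<close>

lemma nonvertex_count:
  assumes x: "x \<notin> \<Union>tri" shows "card {F \<in> cell ` A. x \<in> F} \<le> 2"
proof (cases "\<exists>F. {F \<in> cell ` A. x \<in> F} \<subseteq> {F}")
  case True
  then obtain F where "{F \<in> cell ` A. x \<in> F} \<subseteq> {F}" by blast
  then have "card {F \<in> cell ` A. x \<in> F} \<le> card {F}" by (rule card_mono[rotated]) simp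
  then show ?thesis by simp
next
  case False
  then obtain t where t: "t \<in> A" "x \<in> cell t" by blast
  then obtain r where r: "r \<in> A" "x \<in> cell r" "cell r \<noteq> cell t" using False by blast
  obtain s where s: "s \<subseteq> t" "card s = 2" "x \<in> cell s" "u ` s \<subseteq> u ` r"
    using shared_edge[OF t(1) r(1) t(2) r(2) x] r(3) by metis
  obtain a b where ab: "s = {a, b}" "a \<noteq> b" using s(2) by (auto simp: card_2_iff)
  have all: "u ` s \<subseteq> u ` q" if q: "q \<in> A" "x \<in> cell q" for q
  proof (cases "cell t = cell q")
    case True
    then show ?thesis using tile_eq_iff t(1) q(1) s(1) by blast
  next
    case False
    obtain s' where s': "s' \<subseteq> t" "card s' = 2" "x \<in> cell s'" "u ` s' \<subseteq> u ` q"
      using shared_edge[OF t(1) q(1) t(2) q(2) x False] by metis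
    have xi: "x \<in> cell (s \<inter> s')" using cell_Int[OF t(1) s(1) s'(1)] s(3) s'(3) by blast
    have fs: "finite s" "finite s'" using s(2) s'(2) by (auto intro!: card_ge_0_finite)
    have "s = s'"
    proof (rule ccontr)
      assume "s \<noteq> s'"
      then have "\<not> s \<subseteq> s'" using card_subset_eq[OF fs(2), of s] s(2) s'(2) by auto
      then have "s \<inter> s' \<subset> s" by blast
      then have "card (s \<inter> s') < 2" using psubset_card_mono[OF fs(1)] s(2) by metis
      then consider "card (s \<inter> s') = 0" | "card (s \<inter> s') = 1" by linarith
      then show False
      proof cases
        case 1
        then show False using xi cell_empty fs by auto
      next
        case 2
        then obtain d where d: "s \<inter> s' = {d}" by (auto simp: card_1_singleton_iff)
        then have "d \<in> t" using s(1) by blast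
        then show False using xi d cell_singleton[OF t(1)] x t(1) by (auto simp: tri_def)
      qed
    qed
    then show ?thesis using s'(4) by simp
  qed
  have "{F \<in> cell ` A. x \<in> F} \<subseteq> {F \<in> cell ` A. cell {a, b} \<subseteq> F}"
  proof
    fix F assume "F \<in> {F \<in> cell ` A. x \<in> F}"
    then obtain q where q: "q \<in> A" "x \<in> cell q" "F = cell q" by blast
    have "{u a, u b} \<subseteq> u ` q" using all[OF q(1,2)] ab by simp
    then have "cell {a, b} \<subseteq> F" using edge_in_tile_iff[OF t(1) q(1), of a b] s(1) ab q(3) by simp
    then show "F \<in> {F \<in> cell ` A. cell {a, b} \<subseteq> F}" using q(1,3) by blast
  qed
  then have "card {F \<in> cell ` A. x \<in> F} \<le> card {F \<in> cell ` A. cell {a, b} \<subseteq> F}"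
    using finite_tiles by (intro card_mono) auto
  also have "\<dots> = edge_degree {u a, u b}" using edge_degree_eq[OF t(1), of a b] s(1) ab by simp
  also have "\<dots> = 2"
  proof (rule edge_degree_2)
    have "u a \<noteq> u b" using inj_onD[OF inj_corners[OF t(1)], of a b] ab s(1) by auto
    then show "{u a, u b} \<in> edges" using s(1) ab t(1) by (auto simp: edges_def tri_def)
  qed
  finally show ?thesis .
qed

lemma vertex_count: assumes "v \<in> \<Union>tri" shows "card {F \<in> cell ` A. v \<in> F} = 7"
proof -
  obtain t a where "t \<in> A" "a \<in> t" "v = u a" using assms by (auto simp: tri_def)
  then show ?thesis using hyp unfolding hyperbolic_37_tiling_def tiling_cells_3 by blast
qed

lemma automorphism_vertex:
  assumes "\<phi> \<in> klein_automorphisms u" "v \<in> \<Union>tri" shows "\<phi> v \<in> \<Union>tri"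
proof (rule ccontr)
  assume n: "\<phi> v \<notin> \<Union>tri"
  have "{F \<in> cell ` A. v \<in> F} \<noteq> {}" using vertex_count[OF assms(2)] by (metis card.empty zero_neq_numeral)
  then have "v \<in> klein_quartic" using tile_subset by blast
  then have "card {F \<in> cell ` A. {v} \<subseteq> F} \<le> card {F \<in> cell ` A. \<phi> ` {v} \<subseteq> F}"
    by (intro tiles_containing_le assms(1)) simp
  then show False using vertex_count[OF assms(2)] nonvertex_count[OF n] by simp
qed

lemma automorphism_inj: "\<phi> \<in> klein_automorphisms u \<Longrightarrow> inj_on \<phi> (\<Union>tri)"
proof -
  assume \<phi>: "\<phi> \<in> klein_automorphisms u"
  have "\<Union>tri \<subseteq> klein_quartic"
  proof
    fix v assume "v \<in> \<Union>tri"
    then have "{F \<in> cell ` A. v \<in> F} \<noteq> {}" using vertex_count by (metis card.empty zero_neq_numeral)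
    then show "v \<in> klein_quartic" using tile_subset by blast
  qed
  then show "inj_on \<phi> (\<Union>tri)" using automorphism_bij[OF \<phi>] inj_on_subset by (auto simp: bij_betw_def)
qed

lemma automorphism_corners:
  assumes \<phi>: "\<phi> \<in> klein_automorphisms u" and t: "t \<in> A" "t' \<in> A" and s: "s \<subseteq> t" "s' \<subseteq> t'" "card s = card s'"
    and eq: "\<phi> ` cell s = cell s'"
  shows "\<phi> ` u ` s = u ` s'"
proof -
  have sub: "u ` s \<subseteq> \<Union>tri" using t(1) s(1) by (auto simp: tri_def)
  have "\<phi> ` u ` s \<subseteq> u ` s'"
    unfolding vertices_of_cell[OF t(1) s(1), symmetric] vertices_of_cell[OF t(2) s(2), symmetric]
    using automorphism_vertex[OF \<phi>] eq by blast
  moreover have "card (\<phi> ` u ` s) = card (u ` s')"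
    using card_image[OF inj_on_subset[OF automorphism_inj[OF \<phi>] sub]]
      card_image[OF inj_on_subset[OF inj_corners[OF t(1)] s(1)]] card_image[OF inj_on_subset[OF inj_corners[OF t(2)] s(2)]] s(3)
    by simp
  moreover have "finite (u ` s')" using s(2) tile_finite[OF t(2)] finite_subset by blast
  ultimately show ?thesis by (intro card_subset_eq)
qed

lemma flag_lift:
  assumes "{x, y, z} \<in> tri" obtains a b c where "{a, b, c} \<in> A" "distinct [a, b, c]" "x = u a" "y = u b" "z = u c"
proof -
  obtain t where t: "t \<in> A" "{x, y, z} = u ` t" using tri_cases[OF assms] .
  have "x \<in> u ` t" "y \<in> u ` t" "z \<in> u ` t" unfolding t(2)[symmetric] by simp_all
  then obtain a b c where abc: "a \<in> t" "b \<in> t" "c \<in> t" "x = u a" "y = u b" "z = u c" by blast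
  have "card {x, y, z} = 3" using card_tri_member[OF assms] .
  then have d: "distinct [a, b, c]" using abc(4-6) by (auto simp: card_insert_if split: if_splits)
  then have "card {a, b, c} = card t" using tile_card[OF t(1)] by simp
  then have "{a, b, c} = t" using abc(1-3) tile_finite[OF t(1)] by (intro card_subset_eq) auto
  then show ?thesis using that[of a b c] t(1) d abc by simp
qed

sublocale tri_map: flag_transitive_37_complex tri
proof
  show "card t = 3" if "t \<in> tri" for t using card_tri_member[OF that] .
  show "card {t \<in> tri. v \<in> t} = 7" if "v \<in> \<Union>tri" for v using card_star_tri[OF that] .
next
  fix x y z assume xyz: "{x, y, z} \<in> tri"
  have dist: "p \<noteq> q" "q \<noteq> r" "p \<noteq> r" if "{p, q, r} \<in> tri" for p q r
    using card_tri_member[OF that] by (auto simp: card_insert_if split: if_splits)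
  have "{x, y} \<in> edges" using xyz dist[OF xyz] by (auto simp: edges_def)
  then have "card {\<tau> \<in> tri. {x, y} \<subseteq> \<tau>} = 2" using edge_degree_2 unfolding edge_degree_def by blast
  then obtain \<tau>1 \<tau>2 where S: "{\<tau> \<in> tri. {x, y} \<subseteq> \<tau>} = {\<tau>1, \<tau>2}" "\<tau>1 \<noteq> \<tau>2" by (auto simp: card_2_iff)
  have "{x, y, z} \<in> {\<tau> \<in> tri. {x, y} \<subseteq> \<tau>}" using xyz by simp
  then have "{x, y, z} = \<tau>1 \<or> {x, y, z} = \<tau>2" unfolding S(1) by simp
  then obtain \<sigma> where \<sigma>: "{\<tau> \<in> tri. {x, y} \<subseteq> \<tau>} = {{x, y, z}, \<sigma>}" "\<sigma> \<noteq> {x, y, z}"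
  proof
    assume "{x, y, z} = \<tau>1"
    then show ?thesis using that[of \<tau>2] S by simp
  next
    assume "{x, y, z} = \<tau>2"
    then show ?thesis using that[of \<tau>1] S by (simp add: insert_commute)
  qed
  have "\<sigma> \<in> {\<tau> \<in> tri. {x, y} \<subseteq> \<tau>}" unfolding \<sigma>(1) by simp
  then have \<sigma>t: "\<sigma> \<in> tri" "{x, y} \<subseteq> \<sigma>" by simp_all
  have "card (\<sigma> - {x, y}) = 1" using card_tri_member[OF \<sigma>t(1)] \<sigma>t(2) dist[OF xyz]
    by (subst card_Diff_subset) auto
  then obtain w where "\<sigma> - {x, y} = {w}" by (auto simp: card_1_singleton_iff)
  then have w: "\<sigma> = {x, y, w}" using \<sigma>t(2) by auto
  show "\<exists>!w. w \<noteq> z \<and> {x, y, w} \<in> tri"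
  proof (rule ex1I[of _ w])
    have "w \<noteq> z" using w \<sigma>(2) by blast
    then show "w \<noteq> z \<and> {x, y, w} \<in> tri" using w \<sigma>t(1) by simp
    fix w' assume w': "w' \<noteq> z \<and> {x, y, w'} \<in> tri"
    then have "{x, y, w'} \<in> {{x, y, z}, \<sigma>}" unfolding \<sigma>(1)[symmetric] by blast
    moreover have "{x, y, w'} \<noteq> {x, y, z}"
    proof
      assume "{x, y, w'} = {x, y, z}"
      then have "w' \<in> {x, y, z}" by blast
      then show False using w' dist(2,3)[of x y w'] by simp
    qed
    ultimately have "{x, y, w'} = {x, y, w}" using w by simp
    then have "w' \<in> {x, y, w}" by blast
    then show "w' = w" using w' dist(2,3)[of x y w'] by simp
  qed
next
  fix x y z x' y' z' assume "{x, y, z} \<in> tri" "{x', y', z'} \<in> tri"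
  then obtain a b c a' b' c' where L: "{a, b, c} \<in> A" "distinct [a, b, c]" "x = u a" "y = u b" "z = u c"
    "{a', b', c'} \<in> A" "distinct [a', b', c']" "x' = u a'" "y' = u b'" "z' = u c'" by (metis flag_lift)
  obtain \<phi> where \<phi>: "\<phi> \<in> klein_automorphisms u" "\<phi> (u a) = u a'" "\<phi> ` cell {a, b} = cell {a', b'}"
    "\<phi> ` cell {a, b, c} = cell {a', b', c'}" using flag_automorphism_exists[OF L(1,6)] by blast
  have e: "\<phi> ` u ` {a, b} = u ` {a', b'}"
    by (rule automorphism_corners[OF \<phi>(1) L(1,6) _ _ _ \<phi>(3)]) (use L(2,7) in auto)
  have f: "\<phi> ` u ` {a, b, c} = u ` {a', b', c'}"
    by (rule automorphism_corners[OF \<phi>(1) L(1,6) _ _ _ \<phi>(4)]) (use L(2,7) in auto)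
  have d: "u a' \<noteq> u b'" "u a' \<noteq> u c'" "u b' \<noteq> u c'"
    using inj_onD[OF inj_corners[OF L(6)]] L(7) by auto
  have "{u a', \<phi> (u b)} = {u a', u b'}" using e \<phi>(2) by simp
  then have "u b' \<in> {u a', \<phi> (u b)}" by simp
  then have b: "\<phi> (u b) = u b'" using d by simp
  have "{u a', u b', \<phi> (u c)} = {u a', u b', u c'}" using f \<phi>(2) b by simp
  then have "u c' \<in> {u a', u b', \<phi> (u c)}" by simp
  then have c: "\<phi> (u c) = u c'" using d by simp
  have tri: "\<phi> ` \<tau> \<in> tri" if \<tau>: "\<tau> \<in> tri" for \<tau>
  proof -
    obtain t where t: "t \<in> A" "\<tau> = u ` t" using tri_cases[OF \<tau>] .
    obtain t' where t': "t' \<in> A" "\<phi> ` cell t = cell t'" using automorphism_tile[OF \<phi>(1), of "cell t"] t(1) by blast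
    have "\<phi> ` u ` t = u ` t'" by (rule automorphism_corners[OF \<phi>(1) t(1) t'(1) _ _ _ t'(2)]) (simp_all add: tile_card t t')
    then show ?thesis using t(2) t'(1) by (simp add: tri_def)
  qed
  show "\<exists>\<psi>. inj_on \<psi> (\<Union>tri) \<and> (\<forall>t\<in>tri. \<psi> ` t \<in> tri) \<and> \<psi> x = x' \<and> \<psi> y = y' \<and> \<psi> z = z'"
    using automorphism_inj[OF \<phi>(1)] tri \<phi>(2) b c L by blast
next
  fix p :: "nat \<Rightarrow> cp2"
  assume p: "\<And>i. {p i, p (i+1), p (i+2)} \<in> tri" "\<And>i. p (i+3) \<noteq> p i"
  then have "petrie_zigzag u A p" unfolding petrie_zigzag_def tri_def by blast
  from petrie[OF this, of 0] petrie[OF this, of 1] petrie[OF this, of 2]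
  show "p 8 = p 0 \<and> p 9 = p 1 \<and> p 10 = p 2" by simp
qed

text \<open>
  Tiles are images of a closed triangle.
\<close>

lemma compact_tile: assumes "t \<in> A" shows "compact (cell t)"
proof -
  obtain l \<tau> where l: "bij_betw l \<tau> t" "\<tau> = {0..<3::nat}" using tile_param[OF assms] .
  have "cell t = (u \<circ> tile_point l \<tau>) ` simplex_of \<tau>" using cell_param(1)[OF assms l(1) order_refl] l(1) by (simp add: bij_betw_def)
  then show ?thesis
    using compact_continuous_image[OF cell_param(3)[OF assms l(1)]] simplex_of_triangle_compact_connected(1)[of \<tau>] l(2) by simp
qed

lemma quartic_tiles: "klein_quartic = \<Union> (cell ` A)"
  using hyp unfolding hyperbolic_37_tiling_def tiling_cells_3 by simp

lemma connected_quartic: "connected klein_quartic"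
  using covering_space_imp_surjective[OF uniformization] covering_space_imp_continuous[OF uniformization]
    connected_continuous_image[of hdisc u] by (simp add: convex_connected)

text \<open>
  The tiles coming from the Klein map and the other tiles have no common corner, so they form two disjoint
  closed sets that cover the quartic; as the quartic is connected, there are no other tiles.  The labelling is
  then a map from 24 numbers onto 24 vertices.
\<close>

theorem vertex_labelling:
  obtains lab where "inj_on lab {..<24}" "tri = (`) lab ` klein_complex"
proof -
  have "tri \<noteq> {}" using card_tri by auto
  then obtain t where t: "t \<in> A" by (auto simp: tri_def)
  obtain x y z where "u ` t = {x, y, z}" using card_corners[OF t] by (auto simp: card_3_iff)
  then have xyz: "{x, y, z} \<in> tri" using t unfolding tri_def by (metis imageI)
  obtain lab where lab: "(`) lab ` klein_complex \<subseteq> tri"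
    "\<And>\<tau> v. \<tau> \<in> tri \<Longrightarrow> v \<in> \<tau> \<Longrightarrow> v \<in> lab ` {..<24} \<Longrightarrow> \<tau> \<in> (`) lab ` klein_complex"
    by (rule tri_map.klein_labelling[OF xyz]) (rule that)
  let ?L = "(`) lab ` klein_complex"
  \<comment> \<open>\<open>X\<close> consists of the tiles labelled by the Klein map and \<open>Y\<close> of all other tiles.\<close>
  define X where "X = \<Union> (cell ` {t \<in> A. u ` t \<in> ?L})"
  define Y where "Y = \<Union> (cell ` {t \<in> A. u ` t \<notin> ?L})"
  have "closed (\<Union>\<F>)" if "\<F> \<subseteq> cell ` A" for \<F>
    by (rule closed_Union) (use that finite_subset[OF that finite_tiles] compact_tile compact_imp_closed in auto)
  note cl_tiles = this
  have cl: "closed X" "closed Y" unfolding X_def Y_def by (rule cl_tiles, blast)+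
  have "X \<union> Y = \<Union> (cell ` ({t \<in> A. u ` t \<in> ?L} \<union> {t \<in> A. u ` t \<notin> ?L}))"
    unfolding X_def Y_def image_Un Union_Un_distrib ..
  also have "{t \<in> A. u ` t \<in> ?L} \<union> {t \<in> A. u ` t \<notin> ?L} = A"
    by (rule set_eqI, unfold Un_iff mem_Collect_eq, argo)
  finally have XY: "X \<union> Y = klein_quartic" using quartic_tiles by simp
  have disj: "X \<inter> Y = {}"
  proof (rule ccontr)
    assume "X \<inter> Y \<noteq> {}"
    then obtain p where p: "p \<in> X" "p \<in> Y" by (meson disjoint_iff)
    obtain F where F: "F \<in> cell ` {t \<in> A. u ` t \<in> ?L}" "p \<in> F" using p(1) unfolding X_def by (rule UnionE)
    obtain s where s0: "F = cell s" "s \<in> {t \<in> A. u ` t \<in> ?L}" using F(1) by (rule imageE)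
    have s: "s \<in> A" "u ` s \<in> ?L" "p \<in> cell s" using CollectD[OF s0(2)] F(2) s0(1) by argo+
    obtain G where G: "G \<in> cell ` {t \<in> A. u ` t \<notin> ?L}" "p \<in> G" using p(2) unfolding Y_def by (rule UnionE)
    obtain r where r0: "G = cell r" "r \<in> {t \<in> A. u ` t \<notin> ?L}" using G(1) by (rule imageE)
    have r: "r \<in> A" "u ` r \<notin> ?L" "p \<in> cell r" using CollectD[OF r0(2)] G(2) r0(1) by argo+
    note sr = s(1) r(1) s(2) r(2) s(3) r(3)
    obtain s' where m: "s' \<subseteq> s" "u ` s' = u ` s \<inter> u ` r" "cell s \<inter> cell r = cell s'" using tiles_meet[OF sr(1,2)] by metis
    then have "s' \<noteq> {}" using sr(5,6) cell_empty by auto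
    then obtain v where v: "v \<in> u ` s" "v \<in> u ` r" using m(2) by blast
    obtain \<tau> where "\<tau> \<in> klein_complex" "u ` s = lab ` \<tau>" using sr(3) by blast
    then have "v \<in> lab ` {..<24}" using v(1) klein_vertices by blast
    then have "u ` r \<in> ?L" using lab(2)[of "u ` r" v] v(2) sr(2) by (auto simp: tri_def)
    then show False using sr(4) by blast
  qed
  have "X \<noteq> {}"
  proof -
    have "klein_complex \<noteq> {}" using card_klein_complex by auto
    then obtain \<tau> where "lab ` \<tau> \<in> tri" "lab ` \<tau> \<in> ?L" using lab(1) by blast
    then obtain s where s: "s \<in> A" "u ` s \<in> ?L" by (metis tri_cases)
    then obtain a where "a \<in> s" using tile_card by fastforce
    then have "u a \<in> cell s" using corner_in_cell[OF s(1) _ order_refl] by blast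
    then show ?thesis using s by (auto simp: X_def)
  qed
  have "Y = {}"
  proof (rule ccontr)
    assume "Y \<noteq> {}"
    then have "closed X \<and> closed Y \<and> klein_quartic \<subseteq> X \<union> Y \<and> X \<inter> Y \<inter> klein_quartic = {} \<and>
        X \<inter> klein_quartic \<noteq> {} \<and> Y \<inter> klein_quartic \<noteq> {}"
      using cl XY disj \<open>X \<noteq> {}\<close> by auto
    then show False using connected_quartic unfolding connected_closed by blast
  qed
  have eq: "tri = ?L"
  proof
    show "tri \<subseteq> ?L"
    proof
      fix \<tau> assume "\<tau> \<in> tri"
      then obtain s where s: "s \<in> A" "\<tau> = u ` s" by (rule tri_cases)
      then obtain a where "a \<in> s" using tile_card by fastforce
      then have "u a \<in> cell s" using corner_in_cell[OF s(1) _ order_refl] by blast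
      then show "\<tau> \<in> ?L" using \<open>Y = {}\<close> s unfolding Y_def by blast
    qed
  qed (rule lab(1))
  have "\<Union>tri = lab ` {..<24}" unfolding eq klein_vertices[symmetric] by blast
  then have "card (lab ` {..<24}) = card {..<24::nat}" using card_vertices by simp
  then have "inj_on lab {..<24}" by (rule eq_card_imp_inj_on[rotated]) simp
  then show ?thesis using that eq by blast
qed

end

section \<open>The quartic as the realization of the Klein map\<close>

context tiled_quartic
begin

text \<open>
  For each triangle a tile is chosen, with its barycentric parametrization.  On each edge the parametrization
  by one reference triangle is imposed on the other one, after which the parametrizations glue.
\<close>

theorem quartic_homeomorphic_complex:
  obtains f g where "homeomorphism (realization klein_complex) klein_quartic f g"
    "\<And>\<tau> s. \<tau> \<in> klein_complex \<Longrightarrow> s \<subseteq> \<tau> \<Longrightarrow> f ` simplex_of s \<in> tiling_cells u A (card s)"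
proof -
  obtain lab where lab: "inj_on lab {..<24}" "tri = (`) lab ` klein_complex" by (rule vertex_labelling)
  let ?K = "klein_complex"
  have K24: "\<tau> \<subseteq> {..<24}" and K3: "card \<tau> = 3" and Kfin: "finite \<tau>" if "\<tau> \<in> ?K" for \<tau>
  proof -
    show "\<tau> \<subseteq> {..<24}" using klein_vertices that by blast
    show "card \<tau> = 3" using klein_triangle[OF that] by (metis card_3_iff distinct_length_2_or_more)
    then show "finite \<tau>" by (intro card_ge_0_finite) simp
  qed
  have "\<exists>t\<in>A. u ` t = lab ` \<tau>" if "\<tau> \<in> ?K" for \<tau>
  proof -
    have "lab ` \<tau> \<in> tri" unfolding lab(2) using that by blast
    then show ?thesis by (metis tri_cases)
  qed
  then obtain tl where tl: "\<And>\<tau>. \<tau> \<in> ?K \<Longrightarrow> tl \<tau> \<in> A \<and> u ` tl \<tau> = lab ` \<tau>" by metis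
  define l where "l \<tau> i = inv_into (tl \<tau>) u (lab i)" for \<tau> i
  have ul: "u (l \<tau> i) = lab i" "l \<tau> i \<in> tl \<tau>" if "\<tau> \<in> ?K" "i \<in> \<tau>" for \<tau> i
  proof -
    have "lab i \<in> u ` tl \<tau>" using tl that by blast
    then show "u (l \<tau> i) = lab i" "l \<tau> i \<in> tl \<tau>" by (simp_all add: l_def f_inv_into_f inv_into_into)
  qed
  have uls: "u ` l \<tau> ` s = lab ` s" if "\<tau> \<in> ?K" "s \<subseteq> \<tau>" for \<tau> s
    using ul[OF that(1)] that(2) by (force simp: image_image)
  have ls: "l \<tau> ` s \<subseteq> tl \<tau>" if "\<tau> \<in> ?K" "s \<subseteq> \<tau>" for \<tau> s using ul[OF that(1)] that(2) by blast
  have linj: "inj_on (l \<tau>) \<tau>" if "\<tau> \<in> ?K" for \<tau>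
  proof (rule inj_onI)
    fix i j assume ij: "i \<in> \<tau>" "j \<in> \<tau>" "l \<tau> i = l \<tau> j"
    then have "lab i = lab j" using ul[OF that] by metis
    then show "i = j" using inj_onD[OF lab(1)] ij K24[OF that] by blast
  qed
  have bij: "bij_betw (l \<tau>) \<tau> (tl \<tau>)" if "\<tau> \<in> ?K" for \<tau>
  proof -
    have "card (l \<tau> ` \<tau>) = card (tl \<tau>)" using card_image[OF linj[OF that]] K3[OF that] tile_card tl[OF that] by simp
    then have "l \<tau> ` \<tau> = tl \<tau>" using ls[OF that order_refl] tile_finite tl[OF that] by (intro card_subset_eq) auto
    then show ?thesis using linj[OF that] by (simp add: bij_betw_def)
  qed
  define h where "h \<tau> = u \<circ> tile_point (l \<tau>) \<tau>" for \<tau>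
  have hs: "h \<tau> ` simplex_of s = cell (l \<tau> ` s)" if "\<tau> \<in> ?K" "s \<subseteq> \<tau>" for \<tau> s
    unfolding h_def using cell_param(1)[OF _ bij[OF that(1)] that(2)] tl[OF that(1)] by simp
  have hinj: "inj_on (h \<tau>) (simplex_of \<tau>)" and hcont: "continuous_on (simplex_of \<tau>) (h \<tau>)" if "\<tau> \<in> ?K" for \<tau>
    unfolding h_def using cell_param(2,3)[OF _ bij[OF that]] tl[OF that] by simp_all
  have face: "cell (l \<tau> ` s) = cell (l \<tau>' ` s)" if "\<tau> \<in> ?K" "\<tau>' \<in> ?K" "s \<subseteq> \<tau>" "s \<subseteq> \<tau>'" for \<tau> \<tau>' s
    using face_cell_unique[of "tl \<tau>" "tl \<tau>'" "l \<tau> ` s" "l \<tau>' ` s"] tl ls uls that by simp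
  have single: "cell (l \<tau> ` {i}) = {lab i}" if "\<tau> \<in> ?K" "i \<in> \<tau>" for \<tau> i
    using cell_singleton[of "tl \<tau>" "l \<tau> i"] tl ul that by simp
  have hv: "h \<tau> (vertex_pt i) = lab i" if "\<tau> \<in> ?K" "i \<in> \<tau>" for \<tau> i
    using hs[OF that(1), of "{i}"] single[OF that] that(2) by (simp add: simplex_of_singleton)
  define ref where "ref e = (SOME \<tau>. \<tau> \<in> ?K \<and> e \<subseteq> \<tau>)" for e
  have ref: "ref e \<in> ?K \<and> e \<subseteq> ref e" if "\<tau> \<in> ?K" "e \<subseteq> \<tau>" for e \<tau>
    unfolding ref_def by (rule someI[of _ \<tau>]) (use that in simp)
  define good where "good \<tau> H \<longleftrightarrow> continuous_on (simplex_of \<tau>) H \<and> inj_on H (simplex_of \<tau>) \<and>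
      (\<forall>s\<subseteq>\<tau>. H ` simplex_of s = h \<tau> ` simplex_of s) \<and>
      (\<forall>e\<subseteq>\<tau>. card e = 2 \<longrightarrow> (\<forall>x\<in>simplex_of e. H x = h (ref e) x))" for \<tau> H
  have "\<exists>H. good \<tau> H" if \<tau>: "\<tau> \<in> ?K" for \<tau>
    unfolding good_def
  proof (rule reparametrize_boundary[OF K3[OF \<tau>] hcont[OF \<tau>] hinj[OF \<tau>]])
    fix e assume e: "e \<subseteq> \<tau>" "card e = 2"
    have r: "ref e \<in> ?K" "e \<subseteq> ref e" using ref[OF \<tau> e(1)] by auto
    have sub: "simplex_of e \<subseteq> simplex_of (ref e)" by (rule simplex_of_mono[OF Kfin[OF r(1)] r(2)])
    show "continuous_on (simplex_of e) (h (ref e))" using continuous_on_subset[OF hcont[OF r(1)] sub] .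
    show "inj_on (h (ref e)) (simplex_of e)" using inj_on_subset[OF hinj[OF r(1)] sub] .
    show "h (ref e) ` simplex_of e = h \<tau> ` simplex_of e"
      unfolding hs[OF r] hs[OF \<tau> e(1)] by (rule face[OF r(1) \<tau> r(2) e(1)])
    show "h (ref e) (vertex_pt i) = h \<tau> (vertex_pt i)" if i: "i \<in> e" for i
      using hv[OF r(1) subsetD[OF r(2) i]] hv[OF \<tau> subsetD[OF e(1) i]] by simp
  qed
  then obtain H where good: "\<And>\<tau>. \<tau> \<in> ?K \<Longrightarrow> good \<tau> (H \<tau>)" by metis
  have H: "continuous_on (simplex_of \<tau>) (H \<tau>)" "inj_on (H \<tau>) (simplex_of \<tau>)"
      "\<And>s. s \<subseteq> \<tau> \<Longrightarrow> H \<tau> ` simplex_of s = h \<tau> ` simplex_of s"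
      "\<And>e x. e \<subseteq> \<tau> \<Longrightarrow> card e = 2 \<Longrightarrow> x \<in> simplex_of e \<Longrightarrow> H \<tau> x = h (ref e) x" if "\<tau> \<in> ?K" for \<tau>
    using good[OF that] unfolding good_def by simp_all
  have Hs: "H \<tau> ` simplex_of s = cell (l \<tau> ` s)" if "\<tau> \<in> ?K" "s \<subseteq> \<tau>" for \<tau> s
    using H(3)[OF that] hs[OF that] by simp
  have Hv: "H \<tau> (vertex_pt i) = lab i" if "\<tau> \<in> ?K" "i \<in> \<tau>" for \<tau> i
    using Hs[OF that(1), of "{i}"] single[OF that] that(2) by (simp add: simplex_of_singleton)
  have full: "l \<tau> ` \<tau> = tl \<tau>" if "\<tau> \<in> ?K" for \<tau> using bij[OF that] by (simp add: bij_betw_def)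
  have agree: "H \<tau> x = H \<tau>' x" if \<tau>: "\<tau> \<in> ?K" "\<tau>' \<in> ?K" and x: "x \<in> simplex_of (\<tau> \<inter> \<tau>')" for \<tau> \<tau>' x
  proof (cases "\<tau> = \<tau>'")
    case False
    have "\<not> \<tau> \<subseteq> \<tau>'" using card_subset_eq[OF Kfin[OF \<tau>(2)], of \<tau>] K3 \<tau> False by auto
    then have "card (\<tau> \<inter> \<tau>') < 3" using psubset_card_mono[OF Kfin[OF \<tau>(1)], of "\<tau> \<inter> \<tau>'"] K3[OF \<tau>(1)] by auto
    then consider "card (\<tau> \<inter> \<tau>') = 0" | "card (\<tau> \<inter> \<tau>') = 1" | "card (\<tau> \<inter> \<tau>') = 2" by linarith
    then show ?thesis
    proof cases
      case 1
      then have "\<tau> \<inter> \<tau>' = {}" using Kfin[OF \<tau>(1)] by simp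
      then show ?thesis using x by (simp add: simplex_of_def)
    next
      case 2
      then obtain i where i: "\<tau> \<inter> \<tau>' = {i}" by (auto simp: card_1_singleton_iff)
      then have "x = vertex_pt i" "i \<in> \<tau>" "i \<in> \<tau>'" using x by (auto simp: simplex_of_singleton)
      then show ?thesis using Hv \<tau> by simp
    next
      case 3
      then show ?thesis using H(4)[OF \<tau>(1) _ _ x] H(4)[OF \<tau>(2) _ _ x] by simp
    qed
  qed simp
  have meet: "H \<tau> ` simplex_of \<tau> \<inter> H \<tau>' ` simplex_of \<tau>' \<subseteq> H \<tau> ` simplex_of (\<tau> \<inter> \<tau>')" if \<tau>: "\<tau> \<in> ?K" "\<tau>' \<in> ?K" for \<tau> \<tau>'
  proof -
    have tA: "tl \<tau> \<in> A" "tl \<tau>' \<in> A" using tl \<tau> by auto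
    obtain s where m: "s \<subseteq> tl \<tau>" "u ` s = u ` tl \<tau> \<inter> u ` tl \<tau>'" "cell (tl \<tau>) \<inter> cell (tl \<tau>') = cell s"
      using tiles_meet[OF tA] by metis
    have "u ` s = lab ` \<tau> \<inter> lab ` \<tau>'" using m(2) tl \<tau> by simp
    also have "\<dots> = lab ` (\<tau> \<inter> \<tau>')" using inj_on_image_Int[OF lab(1) K24[OF \<tau>(1)] K24[OF \<tau>(2)]] by simp
    also have "\<dots> = u ` l \<tau> ` (\<tau> \<inter> \<tau>')" using uls[OF \<tau>(1), of "\<tau> \<inter> \<tau>'"] by simp
    finally have "s = l \<tau> ` (\<tau> \<inter> \<tau>')"
      using inj_on_image_eq_iff[OF inj_corners[OF tA(1)] m(1) ls[OF \<tau>(1), of "\<tau> \<inter> \<tau>'"]] by simp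
    then show ?thesis using Hs[OF \<tau>(1), of \<tau>] Hs[OF \<tau>(2), of \<tau>'] Hs[OF \<tau>(1), of "\<tau> \<inter> \<tau>'"] full \<tau> m(3) by simp
  qed
  have finK: "finite ?K" using card_klein_complex by (intro card_ge_0_finite) simp
  obtain f g where fg: "homeomorphism (realization ?K) (\<Union>\<tau>\<in>?K. H \<tau> ` simplex_of \<tau>) f g"
    "\<And>\<tau> x. \<tau> \<in> ?K \<Longrightarrow> x \<in> simplex_of \<tau> \<Longrightarrow> f x = H \<tau> x"
    by (rule glue_simplices[OF finK K3 H(1,2) agree meet]; (assumption | rule that; assumption))
  have "(\<Union>\<tau>\<in>?K. H \<tau> ` simplex_of \<tau>) = klein_quartic"
  proof -
    have "(\<Union>\<tau>\<in>?K. H \<tau> ` simplex_of \<tau>) = (\<Union>\<tau>\<in>?K. cell (tl \<tau>))" using Hs full by simp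
    also have "\<dots> = \<Union> (cell ` A)"
    proof
      show "(\<Union>\<tau>\<in>?K. cell (tl \<tau>)) \<subseteq> \<Union> (cell ` A)" using tl by blast
      show "\<Union> (cell ` A) \<subseteq> (\<Union>\<tau>\<in>?K. cell (tl \<tau>))"
      proof (rule Union_least, elim imageE)
        fix F t assume t: "F = cell t" "t \<in> A"
        then have "u ` t \<in> (`) lab ` ?K" unfolding lab(2)[symmetric] tri_def by blast
        then obtain \<tau> where \<tau>: "\<tau> \<in> ?K" "u ` t = lab ` \<tau>" by blast
        then have "cell t = cell (tl \<tau>)" using tile_eq_iff[of t "tl \<tau>"] tl t by simp
        then show "F \<subseteq> (\<Union>\<tau>\<in>?K. cell (tl \<tau>))" using \<tau>(1) t by blast
      qed
    qed
    finally show ?thesis using quartic_tiles by simp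
  qed
  then have homeo: "homeomorphism (realization ?K) klein_quartic f g" using fg(1) by simp
  have "f ` simplex_of s \<in> tiling_cells u A (card s)" if \<tau>: "\<tau> \<in> ?K" and s: "s \<subseteq> \<tau>" for \<tau> s
  proof -
    have "simplex_of s \<subseteq> simplex_of \<tau>" by (rule simplex_of_mono[OF Kfin[OF \<tau>] s])
    then have "f ` simplex_of s = H \<tau> ` simplex_of s" using fg(2)[OF \<tau>] by (intro image_cong) auto
    then have "f ` simplex_of s = u ` (hconvex hull (l \<tau> ` s))" using Hs[OF \<tau> s] by (simp add: cell_def)
    moreover have "card (l \<tau> ` s) = card s" using card_image[OF inj_on_subset[OF linj[OF \<tau>] s]] .
    ultimately show ?thesis unfolding tiling_cells_def using tl[OF \<tau>] ls[OF \<tau> s] by blast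
  qed
  then show ?thesis using that homeo by blast
qed

end

section \<open>The immersed surface\<close>

theorem theorem3p1:
  fixes u :: "complex \<Rightarrow> cp2" and A :: "complex set set"
  assumes "klein_tiling u A"
  shows "\<exists>(T :: nat set set) (f :: (nat \<Rightarrow> real) \<Rightarrow> real^3) (\<pi> :: (nat \<Rightarrow> real) \<Rightarrow> cp2).
     triangulated_surface T \<and> connected (realization T) \<and> infinite T \<and>
     triangle_degree_seven T \<and>
     immersion3 T f \<and> equilateral_faces T f \<and>
     covering_space (realization T) \<pi> klein_quartic \<and> maps_cells_to_cells T \<pi> u A"
proof -
  interpret tiled_quartic u A by unfold_locales (rule assms)
  let ?T = "klein_cover.cover"
  obtain f g where fg: "homeomorphism (realization klein_complex) klein_quartic f g"
    "\<And>\<tau> s. \<tau> \<in> klein_complex \<Longrightarrow> s \<subseteq> \<tau> \<Longrightarrow> f ` simplex_of s \<in> tiling_cells u A (card s)"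
    by (rule quartic_homeomorphic_complex) (rule that)
  let ?\<pi> = "f \<circ> push_forward klein_cover.label"
  have cover: "covering_space (realization ?T) ?\<pi> klein_quartic"
    by (rule covering_space_compose_homeomorphism[OF klein_cover.covering_push_forward fg(1)])
  have "triangulated_surface ?T"
    unfolding triangulated_surface_def
    using klein_cover.card_cover_triangle klein_cover.finite_star covering_space_locally_plane[OF cover uniformization] by blast
  moreover have "maps_cells_to_cells ?T ?\<pi> u A"
    unfolding maps_cells_to_cells_def
  proof (intro ballI allI impI)
    fix t s assume t: "t \<in> ?T" and s: "s \<subseteq> t \<and> s \<noteq> {}"
    have inj: "inj_on klein_cover.label s" using inj_on_subset[OF klein_cover.inj[OF t]] s by blast
    have "finite s" using klein_cover.fin[OF t] s finite_subset by blast
    then have "?\<pi> ` simplex_of s = f ` simplex_of (klein_cover.label ` s)"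
      using push_forward_image_simplex[OF _ inj] by (simp flip: image_image image_comp)
    also have "\<dots> \<in> tiling_cells u A (card (klein_cover.label ` s))"
      using fg(2)[OF klein_cover.image_in[OF t], of "klein_cover.label ` s"] s by blast
    finally show "?\<pi> ` simplex_of s \<in> tiling_cells u A (card s)" using card_image[OF inj] by simp
  qed
  moreover have "infinite ?T" by (rule klein_cover_infinite)
  ultimately show ?thesis
    using klein_cover.connected_realization_cover klein_cover.cover_degree klein_cover.immersion_develop klein_cover.equilateral_develop cover by blast
qed

end
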